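(* Let $\rho_2\ge\rho_1>0$ be real numbers and let $b,q\ge2$ be two integers such that $\gcd(b,q-1)=1$. There exist $C=C(b,q,\rho_1,\rho_2)>0$ and $\eta=\eta(b,q,\rho_1,\rho_2)>0$ such that for all integers $N,D>1$ with $N^{\rho_1}\le D\le N^{\rho_2}$, all $\ell\in\{1,\dots,b-1\}$ and all real $\xi$, the quantity $$S_0(N,D,\xi)=\sum_{D\le m<qD}\ \max_{a\ge0}\left|\sum_{0\le n<N}\mathrm{e}\left(\frac{\ell}{b}s_q(nm+a)\right)\mathrm{e}(n\xi)\right|$$ satisfies $$\left|\frac{S_0(N,D,\xi)}{D}\right|\le CN^{1-\eta}.$$ An admissible value for $\eta$ is $$\eta=\frac{\rho_1\min\left(1/4,\,3\log_q(P^-(q))\right)}{8^{1+\rho_2}(288\rho_2+300)(3\rho_2+2)\left(\log((3\rho_2+4)q)+b\log(q)(3\rho_2+5)\right)}\exp\left(-(3\rho_2+5)\left(\log((3\rho_2+4)q)+(3\rho_2+5)b\log q\right)\right).$$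
   Context: $\mathrm{e}(t)=e^{2\pi i t}$. For an integer $n\ge 0$ with base-$q$ expansion $n=\sum_{k\ge0}n_kq^k$, $n_k\in\{0,\dots,q-1\}$, put $s_q(n)=\sum_{k\ge 0}n_k$. The variables $m,n,a$ are integers; the maximum over integers $a\ge0$ may be read as a supremum. $P^-(q)$ is the smallest prime divisor of $q$ and $\log_q(x)=\log x/\log q$. *)

theory Defs
  imports Complex_Main "HOL-Computational_Algebra.Primes"
begin

definition base_digit :: "nat \<Rightarrow> nat \<Rightarrow> nat \<Rightarrow> nat" where
  "base_digit q n k = (n div q ^ k) mod q"

(* For q >= 2 all digits at positions k >= n vanish (base_digit_eq_0 below), so
   truncating the digit sum at k = n loses nothing. *)
definition digit_sum :: "nat \<Rightarrow> nat \<Rightarrow> nat" where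
  "digit_sum q n = (\<Sum>k\<le>n. base_digit q n k)"

lemma base_digit_eq_0:
  assumes "q \<ge> 2" and "n \<le> k"
  shows "base_digit q n k = 0"
proof -
  have "n < q ^ n" using assms(1) by (simp add: power_gt_expt)
  also have "q ^ n \<le> q ^ k" using assms by (simp add: power_increasing)
  finally show ?thesis by (simp add: base_digit_def)
qed

definition unit_exp :: "real \<Rightarrow> complex" where
  "unit_exp t = cis (2 * pi * t)"

definition smallest_prime_divisor :: "nat \<Rightarrow> nat" where
  "smallest_prime_divisor q = Min {p. prime p \<and> p dvd q}"

(* The supremum over a is a maximum: for fixed m, N, \<xi> the modulus depends only on residues of
   the digit sums modulo b, so only finitely many values occur (all bounded by N). *)
definition S0 :: "nat \<Rightarrow> nat \<Rightarrow> nat \<Rightarrow> nat \<Rightarrow> nat \<Rightarrow> real \<Rightarrow> real" where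
  "S0 b q l N D \<xi> =
     (\<Sum>m\<in>{D..<q * D}. SUP a::nat.
        cmod (\<Sum>n<N. unit_exp (real l / real b * real (digit_sum q (n * m + a))) * unit_exp (real n * \<xi>)))"

(* The constant C may depend on b, q, \<rho>1, \<rho>2 (and on \<eta>), but not on N, D, l, \<xi>. *)
definition admissible_exponent :: "nat \<Rightarrow> nat \<Rightarrow> real \<Rightarrow> real \<Rightarrow> real \<Rightarrow> bool" where
  "admissible_exponent b q \<rho>1 \<rho>2 \<eta> \<longleftrightarrow>
     \<eta> > 0 \<and>
     (\<exists>C>0. \<forall>N D l :: nat. \<forall>\<xi> :: real.
        N > 1 \<longrightarrow> D > 1 \<longrightarrow> real N powr \<rho>1 \<le> real D \<longrightarrow> real D \<le> real N powr \<rho>2 \<longrightarrow>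
        l \<in> {1..b - 1} \<longrightarrow>
        \<bar>S0 b q l N D \<xi> / real D\<bar> \<le> C * real N powr (1 - \<eta>))"

definition explicit_eta :: "nat \<Rightarrow> nat \<Rightarrow> real \<Rightarrow> real \<Rightarrow> real" where
  "explicit_eta b q \<rho>1 \<rho>2 =
     \<rho>1 * min (1 / 4) (3 * log (real q) (real (smallest_prime_divisor q))) /
     (8 powr (1 + \<rho>2) * (288 * \<rho>2 + 300) * (3 * \<rho>2 + 2) *
        (ln ((3 * \<rho>2 + 4) * real q) + real b * ln (real q) * (3 * \<rho>2 + 5))) *
     exp (- (3 * \<rho>2 + 5) *
        (ln ((3 * \<rho>2 + 4) * real q) + (3 * \<rho>2 + 5) * real b * ln (real q)))"

end

theory Submission
  imports Defs "HOL-Analysis.Kronecker_Approximation_Theorem" "HOL-Number_Theory.Cong"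
begin

text \<open>
  Write \<open>f n = e(l/b s\<^sub>q(n))\<close>. Van der Corput's inequality with shifts \<open>r * K\<close> replaces \<open>f\<close> by
  \<open>f(x + r K m) * cnj (f(x + r' K m))\<close>. If \<open>K * m\<close> is very close to a multiple of \<open>q ^ \<mu>\<close>, the shift
  hardly ever changes the digits of \<open>x = n * m + a\<close> in a window just below position \<open>\<mu>\<close>, so these
  digits cancel. A first step with \<open>K = 1\<close> removes the linear phase and all digits above
  \<open>D * q ^ (5 * s)\<close>; the following \<open>k - 1\<close> steps, with \<open>K\<close> from Dirichlet's approximation theorem,
  remove windows of length \<open>\<sigma>\<close> until \<open>\<sigma> + 20 * s\<close> digits are left, where \<open>q ^ (50 * s)\<close> is the
  length of the sum. This works for all \<open>m\<close> outside a set of relative size \<open>O(2 ^ (- s))\<close>.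

  What remains is a sum over \<open>k\<close>-dimensional cubes of a function of few digits. Fixing the side
  lengths and summing over the base point, one splits according to the vector of carries that leave
  a block of \<open>t\<close> digits. In each block, for one choice of the sides, two base points produce the same
  carries but phases that differ by \<open>q - 1\<close>, and \<open>b\<close> does not divide \<open>l * (q - 1)\<close>. Hence every block
  contributes a factor bounded away from \<open>1\<close>, uniformly in the incoming carries and in the higher
  digits; this is where a power of \<open>N\<close> is saved.
\<close>

section \<open>Roots of unity and sums over boxes\<close>

text \<open>The denominators \<open>K\<close> may be as large as
  \<open>q ^ (\<sigma> + 10 * s)\<close>, and van der Corput's inequality tolerates
  \<open>R * K\<close> only if it is short against the length \<open>q ^ (50 * s)\<close>. Hence the
  bound \<open>\<sigma> \<le> 30 * s\<close>, whereas \<open>D\<close> may be a large power of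
  \<open>N\<close>: one window cannot bridge the top and the bottom digits, and \<open>k\<close> is
  taken at least \<open>2 * max 1 \<rho>2\<close>. The price is a \<open>2 ^ k\<close>-th root of
  the saving. The side parameters run up to \<open>R = q ^ (3 * s)\<close>. Common factors of
  \<open>q\<close> with \<open>K\<close> and \<open>m\<close> spoil the equidistribution of the
  lowest \<open>2 * s\<close> digits of the sides, which are therefore frozen; the next
  \<open>s = t * n\<close> digits are uniform and give the saving, in \<open>n\<close> blocks of
  length \<open>t\<close>. Carry vectors decouple the three ranges: low and high digits interact
  with the middle ones only through integers in \<open>{0..k}\<close>, one for each vertex. As
  \<open>t\<close> does not depend on \<open>n\<close>, each block saves a fixed factor, while
  exceptional \<open>m\<close>, discarded terms and boundary terms cost at most a constant times
  \<open>2 ^ (- s)\<close>.\<close>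

lemma abs_sin_mult_le: "\<bar>sin (real n * x)\<bar> \<le> real n * \<bar>sin x\<bar>"
proof (induction n)
  case (Suc n)
  have "\<bar>sin (real (Suc n) * x)\<bar> = \<bar>sin (real n * x) * cos x + cos (real n * x) * sin x\<bar>"
    by (simp add: distrib_right sin_add algebra_simps)
  also have "\<dots> \<le> \<bar>sin (real n * x)\<bar> * \<bar>cos x\<bar> + \<bar>cos (real n * x)\<bar> * \<bar>sin x\<bar>"
    by (metis abs_mult abs_triangle_ineq)
  also have "\<dots> \<le> \<bar>sin (real n * x)\<bar> * 1 + 1 * \<bar>sin x\<bar>"
    by (intro add_mono mult_mono) auto
  finally show ?case using Suc by (simp add: algebra_simps)
qed simp

text \<open>Since \<open>sin (pi / 2) = 1\<close>, the previous inequality at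
  \<open>x = pi / (2 * b)\<close> gives \<open>sin (pi / (2 * b)) \<ge> 1 / b\<close>; the double
  angle formula does the rest.\<close>

lemma cos_pi_div_le:
  assumes "2 \<le> (b::nat)"
  shows "cos (pi / b) \<le> 1 - 2 / b^2"
proof -
  have "1 \<le> b * \<bar>sin (pi / (2*b))\<bar>"
    using abs_sin_mult_le[of b "pi / (2*b)"] assms by simp
  then have "1 / b \<le> \<bar>sin (pi / (2*b))\<bar>"
    using assms by (simp add: field_simps)
  then have "(1 / b)^2 \<le> \<bar>sin (pi / (2*b))\<bar>^2"
    by (intro power_mono) auto
  then have "1 / b^2 \<le> sin (pi / (2*b)) ^ 2"
    by (simp add: power_divide)
  moreover have "cos (pi / b) = 1 - 2 * sin (pi / (2*b)) ^ 2"
    using cos_double_sin[of "pi / (2*b)"] by simp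
  ultimately show ?thesis by simp
qed

text \<open>The modulus is \<open>2 * \<bar>cos (pi * j / b)\<bar>\<close>, and for \<open>j\<close>
  not divisible by \<open>b\<close> the angle keeps, modulo \<open>pi\<close>, a distance of at
  least \<open>pi / b\<close> from the zeros of the sine.\<close>

lemma norm_one_plus_root_le:
  assumes "2 \<le> (b::nat)" and "\<not> int b dvd j"
  shows "norm (1 + cis (2 * pi * (j / b))) \<le> 2 - 4 / b^2"
proof -
  define r where "r = j mod int b"
  have r: "1 \<le> r" "r \<le> int b - 1"
    using assms pos_mod_bound[of "int b" j] pos_mod_sign[of "int b" j]
    by (auto simp: r_def dvd_eq_mod_eq_0 simp del: pos_mod_bound pos_mod_sign)
  have jr: "of_int j / real b = of_int r / real b + of_int (j div int b)"
  proof -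
    have "j = int b * (j div int b) + r" by (simp add: r_def)
    then have "real_of_int j = real b * of_int (j div int b) + of_int r"
      by (metis of_int_add of_int_mult of_int_of_nat_eq)
    then show ?thesis using assms(1) by (simp add: field_simps)
  qed
  define \<phi> where "\<phi> = pi * (r / b)"
  have "2 * pi * (j / b) = 2 * \<phi> + 2 * pi * of_int (j div int b)"
    by (simp add: jr \<phi>_def algebra_simps)
  then have "cis (2 * pi * (j / b)) = cis (2 * \<phi>) * cis (2 * pi * of_int (j div int b))"
    by (simp only: cis_mult)
  also have "cis (2 * pi * of_int (j div int b)) = 1"
    by (intro cis_multiple_2pi) auto
  finally have "1 + cis (2 * pi * (j / b)) = 2 * cos \<phi> * cis \<phi>"
    by (auto simp: complex_eq_iff cos_double_cos sin_double power2_eq_square)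
  then have eq: "norm (1 + cis (2 * pi * (j / b))) = 2 * \<bar>cos \<phi>\<bar>"
    by (simp add: norm_mult)
  have b: "real b \<ge> 2" using assms by simp
  have "pi / b \<le> \<phi>"
    using r b by (simp add: \<phi>_def field_simps)
  moreover have "\<phi> \<le> pi - pi / b"
  proof -
    have "of_int r \<le> real b - 1" using r(2) by linarith
    then have "pi * of_int r \<le> pi * (real b - 1)" by simp
    then show ?thesis using b by (simp add: \<phi>_def field_simps)
  qed
  moreover have "0 < pi / b" using b by simp
  ultimately have "cos \<phi> \<le> cos (pi / b)" "cos (pi - \<phi>) \<le> cos (pi / b)"
    by (intro cos_monotone_0_pi_le; simp)+
  then have "\<bar>cos \<phi>\<bar> \<le> cos (pi / b)" by (simp add: abs_le_iff)
  with cos_pi_div_le[OF assms(1)] eq show ?thesis by simp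
qed

lemma add_mult_in_box:
  fixes X Y :: int
  assumes "u \<in> {0..<X}" "v \<in> {0..<Y}"
  shows "u + X * v \<in> {0..<X * Y}"
proof -
  have "X * v \<le> X * (Y - 1)" using assms by (intro mult_left_mono) auto
  then show ?thesis using assms by (auto simp: algebra_simps)
qed

lemma div_mod_in_box:
  fixes X Y :: int
  assumes "0 < X" "u \<in> {0..<X * Y}"
  shows "u mod X \<in> {0..<X}" "u div X \<in> {0..<Y}"
proof -
  have "X * (u div X) \<le> u"
    using pos_mod_sign[OF assms(1), of u] minus_mod_eq_mult_div[of u X] by linarith
  also have "u < X * Y" using assms by simp
  finally have "u div X < Y" using assms by simp
  then show "u div X \<in> {0..<Y}"
    using assms by (auto simp: pos_imp_zdiv_nonneg_iff)
qed (use assms in auto)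

lemma sum_mult_split:
  fixes X Y :: int
  assumes "0 < X"
  shows "(\<Sum>y\<in>{0..<X * Y}. \<phi> y) = (\<Sum>y0\<in>{0..<X}. \<Sum>y1\<in>{0..<Y}. \<phi> (y0 + X * y1))"
  unfolding sum.cartesian_product
  by (rule sum.reindex_bij_witness[where
        j = "\<lambda>y. (y mod X, y div X)" and i = "\<lambda>(y0, y1). y0 + X * y1"])
    (use assms add_mult_in_box[of _ X _ Y] div_mod_in_box[of X _ Y] in auto)

lemma sum_PiE_mult_split:
  fixes X Y :: int
  assumes "0 < X"
  shows "(\<Sum>h \<in> I \<rightarrow>\<^sub>E {0..<X * Y}. \<phi> h) =
    (\<Sum>h0 \<in> I \<rightarrow>\<^sub>E {0..<X}. \<Sum>h1 \<in> I \<rightarrow>\<^sub>E {0..<Y}. \<phi> (\<lambda>i\<in>I. h0 i + X * h1 i))"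
  unfolding sum.cartesian_product
  by (rule sum.reindex_bij_witness[where
        j = "\<lambda>h. (\<lambda>i\<in>I. h i mod X, \<lambda>i\<in>I. h i div X)" and
        i = "\<lambda>(h0, h1). \<lambda>i\<in>I. h0 i + X * h1 i"])
    (use assms add_mult_in_box[of _ X _ Y] div_mod_in_box[of X _ Y] in
      \<open>auto simp: PiE_iff extensional_def fun_eq_iff restrict_def intro!: arg_cong[of _ _ \<phi>]\<close>)

lemma sum_Pow_Suc:
  "(\<Sum>A\<in>Pow {..<Suc k}. f A) = (\<Sum>A\<in>Pow {..<k}. f A + f (insert k A))"
proof -
  have "inj_on (insert k) (Pow {..<k})"
    by (auto simp: inj_on_def)
  moreover have "Pow {..<k} \<inter> insert k ` Pow {..<k} = {}" by auto
  ultimately show ?thesis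
    unfolding lessThan_Suc Pow_insert
    by (subst sum.union_disjoint) (auto simp: sum.reindex sum.distrib)
qed

lemma sum_Pow_alternating:
  assumes "1 \<le> k"
  shows "(\<Sum>A\<in>Pow {..<k}. (-1) ^ (k + card A)) = (0::int)"
proof -
  obtain k' where k': "k = Suc k'" using assms by (cases k) auto
  have "card (insert k' A) = Suc (card A)" if "A \<in> Pow {..<k'}" for A
    using that by (subst card_insert_disjoint) (auto intro: finite_subset)
  then show ?thesis
    unfolding k' sum_Pow_Suc by (intro sum.neutral) auto
qed

lemma sum_PiE_Suc:
  "(\<Sum>r \<in> {..<Suc k} \<rightarrow>\<^sub>E A. \<phi> r) = (\<Sum>r \<in> {..<k} \<rightarrow>\<^sub>E A. \<Sum>x\<in>A. \<phi> (r(k := x)))"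
proof -
  have "inj_on (\<lambda>(y, g). g(k := y)) (A \<times> ({..<k} \<rightarrow>\<^sub>E A))"
    using inj_combinator[of k "{..<k}" "\<lambda>_. A"] by simp
  then have "(\<Sum>r \<in> {..<Suc k} \<rightarrow>\<^sub>E A. \<phi> r) =
      (\<Sum>p \<in> A \<times> ({..<k} \<rightarrow>\<^sub>E A). \<phi> ((snd p)(k := fst p)))"
    unfolding lessThan_Suc PiE_insert_eq
    by (subst sum.reindex) (auto simp: case_prod_unfold)
  also have "\<dots> = (\<Sum>x\<in>A. \<Sum>r \<in> {..<k} \<rightarrow>\<^sub>E A. \<phi> (r(k := x)))"
    by (simp add: sum.cartesian_product case_prod_unfold)
  finally show ?thesis by (subst sum.swap)
qed

section \<open>Digit sums and carries\<close>

locale digit_phase =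
  fixes q b l :: nat
  assumes q2: "2 \<le> q" and b2: "2 \<le> b" and gcd_b: "gcd b (q - 1) = 1"
    and l1: "1 \<le> l" and lb: "l < b"
begin

definition chi :: "int \<Rightarrow> complex" where
  "chi z = cis (2 * pi * (real l / real b * of_int z))"

text \<open>Integers rather than naturals: cubes have sides of either sign, and flooring division
  makes \<open>sd L\<close> periodic modulo \<open>q ^ L\<close> on all of them.\<close>

definition sd :: "nat \<Rightarrow> int \<Rightarrow> int" where
  "sd L x = (\<Sum>i<L. (x div int q ^ i) mod int q)"

lemma norm_chi [simp]: "norm (chi z) = 1"
  by (simp add: chi_def)

lemma chi_0 [simp]: "chi 0 = 1"
  by (simp add: chi_def)

lemma chi_add: "chi (x + y) = chi x * chi y"
  by (simp add: chi_def cis_mult algebra_simps add_divide_distrib)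

lemma chi_minus: "chi (- x) = cnj (chi x)"
  by (simp add: chi_def cis_cnj)

lemma chi_diff: "chi (x - y) = chi x * cnj (chi y)"
  using chi_add[of x "- y"] by (simp add: chi_minus)

text \<open>The hypothesis \<open>gcd b (q - 1) = 1\<close> enters here: with
  \<open>0 < l < b\<close> it makes \<open>l * (q - 1)\<close> nonzero modulo \<open>b\<close>, so
  the two values differ by a nontrivial \<open>b\<close>-th root of unity as a factor.\<close>

lemma norm_chi_add_le:
  assumes "\<bar>x - y\<bar> = int q - 1"
  shows "norm (chi x + chi y) \<le> 2 - 4 / real b^2"
proof -
  have "\<not> int b dvd int l * (y - x)"
  proof
    assume "int b dvd int l * (y - x)"
    moreover have "int l * \<bar>y - x\<bar> = \<bar>int l * (y - x)\<bar>" by (simp add: abs_mult)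
    moreover have "\<bar>y - x\<bar> = int (q - 1)"
      using assms q2 by (simp add: abs_minus_commute of_nat_diff)
    ultimately have "int b dvd int (l * (q - 1))" by simp
    then have "b dvd l * (q - 1)" by (simp only: of_nat_dvd_iff)
    then have "b dvd l"
      using gcd_b by (metis coprime_dvd_mult_left_iff coprime_iff_gcd_eq_1)
    then show False using l1 lb by (auto dest: dvd_imp_le)
  qed
  then have "norm (1 + cis (2 * pi * (of_int (int l * (y - x)) / b))) \<le> 2 - 4 / real b^2"
    by (rule norm_one_plus_root_le[OF b2])
  moreover have "chi x + chi y = chi x * (1 + cis (2 * pi * (of_int (int l * (y - x)) / b)))"
  proof -
    have "chi y = chi x * chi (y - x)" by (simp flip: chi_add)
    then show ?thesis by (simp add: chi_def algebra_simps)
  qed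
  ultimately show ?thesis by (simp add: norm_mult)
qed

lemma q_pos [simp]: "0 < q" "q \<noteq> 0" "Suc 0 \<le> q"
  using q2 by auto

lemma sd_0 [simp]: "sd 0 x = 0" "sd L 0 = 0"
  by (simp_all add: sd_def)

lemma sd_add: "sd (t + L) x = sd t x + sd L (x div int q ^ t)"
  by (induction L)
    (auto simp: sd_def power_add zdiv_zmult2_eq)

lemma sd_add_mult [simp]: "sd L (x + int q ^ L * z) = sd L x"
proof -
  have "(x + int q ^ L * z) div int q ^ i mod int q = x div int q ^ i mod int q" if "i < L" for i
  proof -
    have "L = i + Suc (L - Suc i)" using that by simp
    then have "int q ^ L = int q ^ i * (int q * int q ^ (L - Suc i))"
      by (metis power_add power_Suc)
    then have "(x + int q ^ L * z) div int q ^ i = x div int q ^ i + int q * (int q ^ (L - Suc i) * z)"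
      by (simp add: mult.assoc add.commute)
    then show ?thesis by simp
  qed
  then show ?thesis by (simp add: sd_def)
qed

lemma sd_cong: "x mod int q ^ L = y mod int q ^ L \<Longrightarrow> sd L x = sd L y"
  by (metis mod_mult_div_eq sd_add_mult)

text \<open>\<open>c A\<close> is the carry that the digits below send into the vertex
  \<open>A\<close>; it depends on the vertex because each vertex is an addition of its own.\<close>

definition cube_phase :: "nat \<Rightarrow> nat \<Rightarrow> (nat set \<Rightarrow> int) \<Rightarrow> (nat \<Rightarrow> int) \<Rightarrow> int \<Rightarrow> int" where
  "cube_phase k L c h y = (\<Sum>A\<in>Pow {..<k}. (-1) ^ (k + card A) * sd L (c A + y + sum h A))"

text \<open>The restriction to \<open>Pow {..<k}\<close> makes carry vectors that agree on all
  vertices equal as functions, so that base points can be grouped by them.\<close>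

definition carry :: "nat \<Rightarrow> nat \<Rightarrow> (nat set \<Rightarrow> int) \<Rightarrow> (nat \<Rightarrow> int) \<Rightarrow> int \<Rightarrow> nat set \<Rightarrow> int" where
  "carry k L c h y = (\<lambda>A\<in>Pow {..<k}. (c A + y + sum h A) div int q ^ L)"

text \<open>The largest modulus of a sum of \<open>chi (cube_phase k L c h y) * B (carry k L c h y)\<close> over all
  functions \<open>B\<close> bounded by \<open>1\<close>. Higher digits enter a sum only through such a factor \<open>B\<close>.\<close>
definition carry_norm :: "nat \<Rightarrow> nat \<Rightarrow> (nat set \<Rightarrow> int) \<Rightarrow> (nat \<Rightarrow> int) \<Rightarrow> real" where
  "carry_norm k L c h = (\<Sum>C\<in>carry k L c h ` {0..<int q ^ L}.
     norm (\<Sum>y | y \<in> {0..<int q ^ L} \<and> carry k L c h y = C. chi (cube_phase k L c h y)))"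

lemma carry_norm_nonneg: "0 \<le> carry_norm k L c h"
  by (simp add: carry_norm_def sum_nonneg)

lemma sum_chi_by_carry:
  "(\<Sum>y\<in>{0..<int q ^ L}. chi (cube_phase k L c h y) * B (carry k L c h y)) =
   (\<Sum>C\<in>carry k L c h ` {0..<int q ^ L}.
     (\<Sum>y | y \<in> {0..<int q ^ L} \<and> carry k L c h y = C. chi (cube_phase k L c h y)) * B C)"
  by (subst sum.image_gen[where g = "carry k L c h"]) (auto simp: sum_distrib_right intro!: sum.cong)

lemma norm_sum_le_carry_norm:
  assumes "\<And>C. norm (B C) \<le> 1"
  shows "norm (\<Sum>y\<in>{0..<int q ^ L}. chi (cube_phase k L c h y) * B (carry k L c h y)) \<le> carry_norm k L c h"
  unfolding sum_chi_by_carry carry_norm_def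
  by (intro sum_norm_le) (simp add: norm_mult assms mult_left_le)

text \<open>The extremal \<open>B\<close> is the conjugate sign of each inner sum, and
  \<open>0\<close> where that sum vanishes.\<close>

lemma carry_norm_attained:
  obtains B where "\<And>C. norm (B C) \<le> 1"
    and "carry_norm k L c h = norm (\<Sum>y\<in>{0..<int q ^ L}. chi (cube_phase k L c h y) * B (carry k L c h y))"
proof -
  define U where "U C = (\<Sum>y | y \<in> {0..<int q ^ L} \<and> carry k L c h y = C. chi (cube_phase k L c h y))" for C
  have "U C * cnj (sgn (U C)) = of_real (norm (U C))" for C
    by (cases "U C = 0") (auto simp: sgn_div_norm scaleR_conv_of_real complex_norm_square[symmetric]
        field_simps power2_eq_square)
  then have "(\<Sum>y\<in>{0..<int q ^ L}. chi (cube_phase k L c h y) * cnj (sgn (U (carry k L c h y)))) =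
      of_real (carry_norm k L c h)"
    unfolding sum_chi_by_carry[where B = "\<lambda>C. cnj (sgn (U C))"] carry_norm_def by (simp add: U_def)
  then show ?thesis
    by (intro that[of "\<lambda>C. cnj (sgn (U C))"]) (auto simp: norm_sgn carry_norm_nonneg)
qed

section \<open>Addition in two blocks of digits\<close>

lemma form_split:
  fixes c :: "nat set \<Rightarrow> int"
  assumes "A \<in> Pow {..<k}"
  shows "c A + (y0 + T * y1) + sum (\<lambda>i\<in>{..<k}. h0 i + T * h1 i) A =
    (c A + y0 + sum h0 A) + T * (y1 + sum h1 A)"
proof -
  have "sum (\<lambda>i\<in>{..<k}. h0 i + T * h1 i) A = (\<Sum>i\<in>A. h0 i + T * h1 i)"
    using assms by (intro sum.cong) auto
  then show ?thesis by (simp add: sum.distrib sum_distrib_left[symmetric] distrib_left)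
qed

lemma form_div:
  "(x + int q ^ t * z) div int q ^ (t + L) = (x div int q ^ t + z) div int q ^ L"
proof -
  have "(x + int q ^ t * z) div int q ^ t = x div int q ^ t + z" by simp
  then show ?thesis by (simp only: power_add zdiv_zmult2_eq of_nat_0_le_iff zero_le_power)
qed

lemma form_sd:
  "sd (t + L) (x + int q ^ t * z) = sd t x + sd L (x div int q ^ t + z)"
proof -
  have "(x + int q ^ t * z) div int q ^ t = x div int q ^ t + z" by simp
  then show ?thesis by (simp only: sd_add sd_add_mult)
qed

text \<open>Schoolbook addition: what leaves the lower \<open>t\<close> digits enters the upper
  \<open>L\<close> digits. Carry vectors thus become the states of a recursion over blocks.\<close>

lemma carry_split:
  "carry k (t + L) c (\<lambda>i\<in>{..<k}. h0 i + int q ^ t * h1 i) (y0 + int q ^ t * y1) =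
   carry k L (carry k t c h0 y0) h1 y1"
proof
  fix A
  show "carry k (t + L) c (\<lambda>i\<in>{..<k}. h0 i + int q ^ t * h1 i) (y0 + int q ^ t * y1) A =
    carry k L (carry k t c h0 y0) h1 y1 A"
  proof (cases "A \<in> Pow {..<k}")
    case True
    then show ?thesis
      unfolding carry_def restrict_apply'[OF True] form_split[OF True] form_div
      by (simp only: add.assoc)
  qed (simp only: carry_def restrict_apply if_False)
qed

lemma cube_phase_split:
  "cube_phase k (t + L) c (\<lambda>i\<in>{..<k}. h0 i + int q ^ t * h1 i) (y0 + int q ^ t * y1) =
   cube_phase k t c h0 y0 + cube_phase k L (carry k t c h0 y0) h1 y1"
  unfolding cube_phase_def sum.distrib[symmetric]
proof (rule sum.cong)
  fix A assume A: "A \<in> Pow {..<k}"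
  show "(-1) ^ (k + card A) *
      sd (t + L) (c A + (y0 + int q ^ t * y1) + sum (\<lambda>i\<in>{..<k}. h0 i + int q ^ t * h1 i) A) =
    (-1) ^ (k + card A) * sd t (c A + y0 + sum h0 A) +
    (-1) ^ (k + card A) * sd L (carry k t c h0 y0 A + y1 + sum h1 A)"
    unfolding form_split[OF A] form_sd carry_def restrict_apply'[OF A]
    by (simp only: distrib_left add.assoc)
qed simp

text \<open>Take the extremal \<open>B\<close> for the long block and sum over the upper digits
  first: the result \<open>U\<close> depends on the lower digits only through their carry vector.
  The modulus stays outside the remaining sum, so cancellation there is still available.\<close>

lemma carry_norm_splitE:
  obtains U where "\<And>C. norm (U C) \<le> carry_norm k L C h1"
    and "carry_norm k (t + L) c (\<lambda>i\<in>{..<k}. h0 i + int q ^ t * h1 i) =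
      norm (\<Sum>y\<in>{0..<int q ^ t}. chi (cube_phase k t c h0 y) * U (carry k t c h0 y))"
proof -
  define h where "h = (\<lambda>i\<in>{..<k}. h0 i + int q ^ t * h1 i)"
  obtain B where B: "\<And>C. norm (B C) \<le> 1"
    "carry_norm k (t + L) c h =
      norm (\<Sum>y\<in>{0..<int q ^ (t + L)}. chi (cube_phase k (t + L) c h y) * B (carry k (t + L) c h y))"
    using carry_norm_attained by blast
  define U where "U C = (\<Sum>y\<in>{0..<int q ^ L}. chi (cube_phase k L C h1 y) * B (carry k L C h1 y))" for C
  have "(\<Sum>y\<in>{0..<int q ^ (t + L)}. chi (cube_phase k (t + L) c h y) * B (carry k (t + L) c h y)) =
    (\<Sum>y\<in>{0..<int q ^ t}. chi (cube_phase k t c h0 y) * U (carry k t c h0 y))"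
    by (simp add: power_add sum_mult_split h_def cube_phase_split carry_split chi_add U_def
        sum_distrib_left mult.assoc)
  then show ?thesis
    using B norm_sum_le_carry_norm[of B] by (intro that[of U]) (auto simp: h_def U_def)
qed

lemma carry_norm_split_le:
  "carry_norm k (t + L) c (\<lambda>i\<in>{..<k}. h0 i + int q ^ t * h1 i) \<le>
    (\<Sum>y\<in>{0..<int q ^ t}. carry_norm k L (carry k t c h0 y) h1)"
proof -
  obtain U where "\<And>C. norm (U C) \<le> carry_norm k L C h1"
    "carry_norm k (t + L) c (\<lambda>i\<in>{..<k}. h0 i + int q ^ t * h1 i) =
      norm (\<Sum>y\<in>{0..<int q ^ t}. chi (cube_phase k t c h0 y) * U (carry k t c h0 y))"
    using carry_norm_splitE by blast
  then show ?thesis by (auto intro!: sum_norm_le simp: norm_mult)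
qed

text \<open>Equal outgoing carries give both base points the same factor \<open>U C\<close>; as
  their phases are not aligned, the trivial contribution \<open>2\<close> drops to
  \<open>2 - 4 / real b^2\<close>.\<close>

lemma carry_norm_split_le_pair:
  assumes "\<alpha> \<in> {0..<int q ^ t}" "\<beta> \<in> {0..<int q ^ t}" "\<alpha> \<noteq> \<beta>"
    and "carry k t c h0 \<alpha> = C" "carry k t c h0 \<beta> = C"
    and "\<bar>cube_phase k t c h0 \<alpha> - cube_phase k t c h0 \<beta>\<bar> = int q - 1"
  shows "carry_norm k (t + L) c (\<lambda>i\<in>{..<k}. h0 i + int q ^ t * h1 i) \<le>
    (\<Sum>y\<in>{0..<int q ^ t} - {\<alpha>, \<beta>}. carry_norm k L (carry k t c h0 y) h1) + (2 - 4 / real b^2) * carry_norm k L C h1"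
proof -
  obtain U where U: "\<And>C. norm (U C) \<le> carry_norm k L C h1"
    "carry_norm k (t + L) c (\<lambda>i\<in>{..<k}. h0 i + int q ^ t * h1 i) =
      norm (\<Sum>y\<in>{0..<int q ^ t}. chi (cube_phase k t c h0 y) * U (carry k t c h0 y))"
    using carry_norm_splitE by blast
  let ?f = "\<lambda>y. chi (cube_phase k t c h0 y) * U (carry k t c h0 y)"
  have "(\<Sum>y\<in>{0..<int q ^ t}. ?f y) = (\<Sum>y\<in>{0..<int q ^ t} - {\<alpha>, \<beta>}. ?f y) + (\<Sum>y\<in>{\<alpha>, \<beta>}. ?f y)"
    by (intro sum.subset_diff) (use assms in auto)
  also have "(\<Sum>y\<in>{\<alpha>, \<beta>}. ?f y) = (chi (cube_phase k t c h0 \<alpha>) + chi (cube_phase k t c h0 \<beta>)) * U C"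
    using assms by (simp add: distrib_right)
  finally have "norm (\<Sum>y\<in>{0..<int q ^ t}. ?f y) \<le>
      norm (\<Sum>y\<in>{0..<int q ^ t} - {\<alpha>, \<beta>}. ?f y) +
      norm (chi (cube_phase k t c h0 \<alpha>) + chi (cube_phase k t c h0 \<beta>)) * norm (U C)"
    by (simp only: norm_mult[symmetric] norm_triangle_ineq)
  also have "\<dots> \<le> (\<Sum>y\<in>{0..<int q ^ t} - {\<alpha>, \<beta>}. carry_norm k L (carry k t c h0 y) h1) +
      (2 - 4 / real b^2) * carry_norm k L C h1"
  proof (rule add_mono)
    show "norm (\<Sum>y\<in>{0..<int q ^ t} - {\<alpha>, \<beta>}. ?f y) \<le>
        (\<Sum>y\<in>{0..<int q ^ t} - {\<alpha>, \<beta>}. carry_norm k L (carry k t c h0 y) h1)"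
      by (rule sum_norm_le) (simp add: norm_mult U)
    have n: "norm (chi (cube_phase k t c h0 \<alpha>) + chi (cube_phase k t c h0 \<beta>)) \<le> 2 - 4 / real b^2"
      by (rule norm_chi_add_le[OF assms(6)])
    show "norm (chi (cube_phase k t c h0 \<alpha>) + chi (cube_phase k t c h0 \<beta>)) * norm (U C) \<le>
        (2 - 4 / real b^2) * carry_norm k L C h1"
      by (rule mult_mono[OF n U(1) order_trans[OF norm_ge_zero n] norm_ge_zero])
  qed
  finally show ?thesis by (simp add: U)
qed

section \<open>Two base points with equal carries and different phases\<close>

lemma sd_mult_add:
  assumes "0 \<le> x" "x < int q ^ t"
  shows "sd (t + L) (x + int q ^ t * z) = sd t x + sd L z"
  using assms by (simp add: form_sd div_pos_pos_trivial)

lemma sd_2: "sd 2 1 = 1" "sd 2 (int q) = 1" "sd 2 (int q - 1) = int q - 1"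
proof -
  have "(int q - 1) mod int q = int q - 1" "(int q - 1) div int q = 0"
    using q2 by (intro mod_pos_pos_trivial div_pos_pos_trivial; simp)+
  then show "sd 2 (int q - 1) = int q - 1" by (simp add: sd_def numeral_2_eq_2)
qed (use q2 in \<open>simp_all add: sd_def numeral_2_eq_2 mod_pos_pos_trivial div_pos_pos_trivial\<close>)

text \<open>For \<open>r = k - i > 0\<close> the number \<open>q ^ Suc J - r\<close> is
  \<open>q ^ J - r\<close> with a further digit \<open>q - 1\<close> in position \<open>J\<close>.
  For \<open>r = 0\<close> both numbers are powers of \<open>q\<close>.\<close>

lemma sd_two_blocks:
  assumes "0 \<le> i" "i \<le> k" "k \<le> int q ^ J" 
  shows "sd (J + 2) (int q ^ Suc J - k + i) - sd (J + 2) (int q ^ J - k + i) =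
    (if i = k then 0 else int q - 1)"
proof (cases "i = k")
  case True
  then show ?thesis
    using sd_mult_add[of 0 J 2 1] sd_mult_add[of 0 J 2 "int q"] by (simp add: sd_2 mult.commute)
next
  case False
  let ?x = "int q ^ J - k + i"
  have x: "0 \<le> ?x" "?x < int q ^ J" using assms False by auto
  have eq: "int q ^ Suc J - k + i = ?x + int q ^ J * (int q - 1)" by (simp add: algebra_simps)
  show ?thesis
    unfolding eq using sd_mult_add[OF x, of 2 0] sd_mult_add[OF x, of 2 "int q - 1"] False by (simp add: sd_2)
qed

text \<open>The two values of \<open>y\<close> produce the numbers \<open>q ^ J - r\<close> and \<open>q ^ (J + 1) - r\<close> with
  \<open>0 \<le> r \<le> k\<close>; these digit sums differ by \<open>q - 1\<close> except for \<open>r = 0\<close>.\<close>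
lemma phase_change:
  assumes k: "1 \<le> k" "k < q ^ t1" "k \<le> q ^ J" and t: "t = t1 + (J + 2)"
    and c: "\<And>A. A \<in> Pow {..<k} \<Longrightarrow> c A \<in> {0..int k}"
  defines "h0 \<equiv> \<lambda>i\<in>{..<k}. int q ^ t1"
    and "\<alpha> \<equiv> int q ^ t1 * (int q ^ J - k)" and "\<beta> \<equiv> int q ^ t1 * (int q ^ Suc J - k)"
  shows "h0 \<in> {..<k} \<rightarrow>\<^sub>E {0..<int q ^ t}"
    and "\<alpha> \<in> {0..<int q ^ t}" "\<beta> \<in> {0..<int q ^ t}" "\<alpha> \<noteq> \<beta>"
    and "carry k t c h0 \<alpha> = (\<lambda>A\<in>Pow {..<k}. 0)" "carry k t c h0 \<beta> = (\<lambda>A\<in>Pow {..<k}. 0)"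
    and "\<bar>cube_phase k t c h0 \<alpha> - cube_phase k t c h0 \<beta>\<bar> = int q - 1"
proof -
  let ?T = "int q ^ t1"
  have T: "int k < ?T" "int k \<le> int q ^ J"
    using k by (metis of_nat_less_iff of_nat_power, metis of_nat_le_iff of_nat_power)
  have J: "int q ^ J < int q ^ Suc J" "int q ^ Suc J < int q ^ (J + 2)"
    using q2 by simp_all
  have tt: "int q ^ t = ?T * int q ^ (J + 2)" by (simp add: t power_add)
  have "?T * 1 < ?T * int q ^ (J + 2)"
    using q2 one_less_power[of "int q" "J + 2"] by (intro mult_strict_left_mono) auto
  then show "h0 \<in> {..<k} \<rightarrow>\<^sub>E {0..<int q ^ t}"
    by (auto simp: h0_def tt)
  have box: "x + ?T * Y \<in> {0..<int q ^ t}" if "0 \<le> x" "x < ?T" "0 \<le> Y" "Y \<le> int q ^ Suc J" for x Y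
    unfolding tt using that J(2) by (intro add_mult_in_box) (auto simp del: power_Suc)
  show "\<alpha> \<in> {0..<int q ^ t}" "\<beta> \<in> {0..<int q ^ t}"
    using box[of 0 "int q ^ J - k"] box[of 0 "int q ^ Suc J - k"] T J
    unfolding \<alpha>_def \<beta>_def add_0 by linarith+
  show "\<alpha> \<noteq> \<beta>" using J q2 by (auto simp: \<alpha>_def \<beta>_def)
  have sm: "sum h0 A = ?T * card A" "card A \<le> k" "card A = k \<longleftrightarrow> A = {..<k}" if "A \<in> Pow {..<k}" for A
  proof -
    have "sum h0 A = (\<Sum>i\<in>A. ?T)" using that by (intro sum.cong) (auto simp: h0_def)
    then show "sum h0 A = ?T * card A" by simp
    show "card A \<le> k" using that card_mono[of "{..<k}" A] by auto
    show "card A = k \<longleftrightarrow> A = {..<k}" using that card_subset_eq[of "{..<k}" A] by auto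
  qed
  \<comment> \<open>The lowest \<open>t1\<close> digits are a buffer: they hold the incoming carry
    \<open>c A \<le> k < q ^ t1\<close>, which therefore never reaches the digits above.\<close>
  have fm: "c A + ?T * Y + sum h0 A = c A + ?T * (Y + card A)" if "A \<in> Pow {..<k}" for A and Y :: int
    using sm[OF that] by (simp add: algebra_simps)
  have cr: "carry k t c h0 (?T * Y) = (\<lambda>A\<in>Pow {..<k}. 0)" if Y: "0 \<le> Y" "Y + k \<le> int q ^ Suc J" for Y :: int
  proof -
    have "(c A + ?T * Y + sum h0 A) div int q ^ t = 0" if A: "A \<in> Pow {..<k}" for A
    proof -
      have "c A + ?T * (Y + card A) \<in> {0..<int q ^ t}"
        using c[OF A] sm(2)[OF A] T(1) Y unfolding atLeastAtMost_iff by (intro box) linarith+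
      then show ?thesis unfolding fm[OF A] by (intro div_pos_pos_trivial) auto
    qed
    then show ?thesis unfolding carry_def by (intro restrict_ext)
  qed
  show "carry k t c h0 \<alpha> = (\<lambda>A\<in>Pow {..<k}. 0)" "carry k t c h0 \<beta> = (\<lambda>A\<in>Pow {..<k}. 0)"
    unfolding \<alpha>_def \<beta>_def using T J by (intro cr; linarith)+
  have "cube_phase k t c h0 \<beta> - cube_phase k t c h0 \<alpha> =
      (\<Sum>A\<in>Pow {..<k}. (-1) ^ (k + card A) * (if A = {..<k} then 0 else int q - 1))"
    unfolding cube_phase_def sum_subtractf[symmetric]
  proof (rule sum.cong)
    fix A assume A: "A \<in> Pow {..<k}"
    have cA: "0 \<le> c A" "c A < ?T" using c[OF A] T unfolding atLeastAtMost_iff by linarith+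
    have "sd t (c A + \<beta> + sum h0 A) - sd t (c A + \<alpha> + sum h0 A) =
        sd (J + 2) (int q ^ Suc J - k + card A) - sd (J + 2) (int q ^ J - k + card A)"
      unfolding \<alpha>_def \<beta>_def fm[OF A] t sd_mult_add[OF cA] by simp
    also have "\<dots> = (if A = {..<k} then 0 else int q - 1)"
      using sm[OF A] T by (subst sd_two_blocks) auto
    finally show "(-1) ^ (k + card A) * sd t (c A + \<beta> + sum h0 A) -
        (-1) ^ (k + card A) * sd t (c A + \<alpha> + sum h0 A) =
        (-1) ^ (k + card A) * (if A = {..<k} then 0 else int q - 1)"
      by (simp add: right_diff_distrib[symmetric])
  qed simp
  \<comment> \<open>The constant part cancels because, for \<open>1 \<le> k\<close>, even and odd
    vertices are equally many; only the full vertex \<open>{..<k}\<close>, with sign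
    \<open>(-1) ^ (2 * k)\<close>, survives.\<close>
  also have "\<dots> = (\<Sum>A\<in>Pow {..<k}. (-1) ^ (k + card A) * (int q - 1)) -
      (\<Sum>A\<in>Pow {..<k}. if A = {..<k} then int q - 1 else 0)"
    unfolding sum_subtractf[symmetric]
    by (rule sum.cong) (auto simp: mult_2[symmetric] simp flip: power_mult)
  also have "\<dots> = - (int q - 1)"
    using sum_Pow_alternating[OF k(1)] by (simp flip: sum_distrib_right)
  finally show "\<bar>cube_phase k t c h0 \<alpha> - cube_phase k t c h0 \<beta>\<bar> = int q - 1"
    using q2 by simp
qed

text \<open>At most \<open>k + 1\<close> numbers below \<open>q ^ t\<close> and a carry of at most
  \<open>k\<close> add up to less than \<open>(k + 1) * q ^ t\<close>. So the range
  \<open>{0..k}\<close> reproduces itself from block to block.\<close>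

lemma carry_bounds:
  assumes "\<And>A. A \<in> Pow {..<k} \<Longrightarrow> c A \<in> {0..int k}" and "h \<in> {..<k} \<rightarrow>\<^sub>E {0..<int q ^ t}"
    and "y \<in> {0..<int q ^ t}" and A: "A \<in> Pow {..<k}"
  shows "carry k t c h y A \<in> {0..int k}"
proof -
  let ?T = "int q ^ t"
  have "0 \<le> sum h A" using assms by (intro sum_nonneg) (auto simp: PiE_iff)
  moreover have "sum h A \<le> (\<Sum>i\<in>A. ?T - 1)" using assms by (intro sum_mono) (auto simp: PiE_iff)
  moreover have "(\<Sum>i\<in>A. ?T - 1) \<le> k * (?T - 1)"
    using A card_mono[of "{..<k}" A] by (auto intro!: mult_right_mono)
  ultimately have "c A + y + sum h A \<in> {0..<?T * (k + 1)}"
    using assms(1)[OF A] assms(3) by (auto simp: algebra_simps)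
  then have "(c A + y + sum h A) div ?T \<in> {0..<int (k + 1)}"
    by (intro div_mod_in_box) auto
  then show ?thesis using A by (simp add: carry_def)
qed

text \<open>Among the \<open>q ^ (k * t)\<close> side vectors of the lowest block a single one,
  \<open>z\<close>, saves \<open>4 / real b^2\<close>; the others are estimated trivially. The
  carries entering the next block depend on the lower digits, so the induction is over all
  \<open>c\<close> with values in \<open>{0..k}\<close>.\<close>

lemma sum_carry_norm_le:
  assumes k: "1 \<le> k" "k < q ^ t1" "k \<le> q ^ J" and t: "t = t1 + (J + 2)"
  assumes "\<And>A. A \<in> Pow {..<k} \<Longrightarrow> c A \<in> {0..int k}"
  shows "(\<Sum>h \<in> {..<k} \<rightarrow>\<^sub>E {0..<int q ^ (t * n)}. carry_norm k (t * n) c h) \<le>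
    (real q ^ ((k + 1) * t) - 4 / real b^2) ^ n"
  using assms(5)
proof (induction n arbitrary: c)
  case 0
  have "{0..<1::int} = {0}" by auto
  moreover have "PiE {..<k} (\<lambda>_. {0::int}) = {\<lambda>i\<in>{..<k}. 0}"
    by (auto simp: PiE_iff extensional_def fun_eq_iff)
  moreover have "carry_norm k 0 c h = 1" for h
  proof -
    have "{y::int. y = 0 \<and> carry k 0 c h y = carry k 0 c h 0} = {0}" by auto
    then show ?thesis using \<open>{0..<1::int} = {0}\<close> by (simp add: carry_norm_def cube_phase_def)
  qed
  ultimately show ?case by simp
next
  case (Suc n)
  let ?T = "int q ^ t" and ?L = "t * n" and ?E = "(real q ^ ((k + 1) * t) - 4 / real b^2) ^ n"
  let ?P = "\<lambda>X. {..<k} \<rightarrow>\<^sub>E {0..<X::int}"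
  \<comment> \<open>These are the data of \<open>phase_change\<close>; they are the same for every
    \<open>c\<close>.\<close>
  define z :: "nat \<Rightarrow> int" where "z = (\<lambda>i\<in>{..<k}. int q ^ t1)"
  define \<alpha> where "\<alpha> = int q ^ t1 * (int q ^ J - k)"
  define \<beta> where "\<beta> = int q ^ t1 * (int q ^ Suc J - k)"
  define C where "C = carry k t c z \<alpha>"
  have pc: "z \<in> ?P ?T" "\<alpha> \<in> {0..<?T}" "\<beta> \<in> {0..<?T}" "\<alpha> \<noteq> \<beta>"
    "carry k t c z \<alpha> = C" "carry k t c z \<beta> = C"
    "\<bar>cube_phase k t c z \<alpha> - cube_phase k t c z \<beta>\<bar> = int q - 1"
    using phase_change[OF k t Suc.prems] by (simp_all add: z_def \<alpha>_def \<beta>_def C_def)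
  have IH: "(\<Sum>h1\<in>?P (int q ^ ?L). carry_norm k ?L (carry k t c h0 y) h1) \<le> ?E"
    if "h0 \<in> ?P ?T" "y \<in> {0..<?T}" for h0 y
    using Suc.prems that by (intro Suc.IH carry_bounds) auto
  have b4: "0 \<le> 2 - 4 / real b^2"
    using b2 power_mono[of 2 "real b" 2] by (simp add: field_simps)
  have step: "(\<Sum>h1\<in>?P (int q ^ ?L). carry_norm k (t + ?L) c (\<lambda>i\<in>{..<k}. h0 i + ?T * h1 i)) \<le>
      (real q ^ t - (if h0 = z then 4 / real b^2 else 0)) * ?E" if h0: "h0 \<in> ?P ?T" for h0
  proof (cases "h0 = z")
    case True
    have "(\<Sum>h1\<in>?P (int q ^ ?L). carry_norm k (t + ?L) c (\<lambda>i\<in>{..<k}. h0 i + ?T * h1 i)) \<le>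
      (\<Sum>h1\<in>?P (int q ^ ?L). (\<Sum>y\<in>{0..<?T} - {\<alpha>, \<beta>}. carry_norm k ?L (carry k t c z y) h1) +
        (2 - 4 / real b^2) * carry_norm k ?L C h1)"
      unfolding True by (intro sum_mono carry_norm_split_le_pair pc)
    also have "\<dots> = (\<Sum>y\<in>{0..<?T} - {\<alpha>, \<beta>}. \<Sum>h1\<in>?P (int q ^ ?L). carry_norm k ?L (carry k t c z y) h1) +
        (2 - 4 / real b^2) * (\<Sum>h1\<in>?P (int q ^ ?L). carry_norm k ?L C h1)"
      unfolding sum.distrib sum_distrib_left by (subst sum.swap) simp
    also have "\<dots> \<le> (\<Sum>y\<in>{0..<?T} - {\<alpha>, \<beta>}. ?E) + (2 - 4 / real b^2) * ?E"
      using IH[OF pc(1)] IH[OF pc(1,2)] b4 unfolding C_def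
      by (intro add_mono sum_mono mult_left_mono) auto
    also have "(\<Sum>y\<in>{0..<?T} - {\<alpha>, \<beta>}. ?E) = (real q ^ t - 2) * ?E"
    proof -
      have "card ({0..<?T} - {\<alpha>, \<beta>}) = card {0..<?T} - 2"
        using pc by (subst card_Diff_subset) auto
      moreover have "2 \<le> card {0..<?T}"
        using card_mono[of "{0..<?T}" "{\<alpha>, \<beta>}"] pc by auto
      ultimately show ?thesis by (simp add: of_nat_diff)
    qed
    also have "(real q ^ t - 2) * ?E + (2 - 4 / real b^2) * ?E =
        (real q ^ t - (if h0 = z then 4 / real b^2 else 0)) * ?E"
      using True by (simp add: left_diff_distrib)
    finally show ?thesis .
  next
    case False
    have "(\<Sum>h1\<in>?P (int q ^ ?L). carry_norm k (t + ?L) c (\<lambda>i\<in>{..<k}. h0 i + ?T * h1 i)) \<le>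
      (\<Sum>h1\<in>?P (int q ^ ?L). \<Sum>y\<in>{0..<?T}. carry_norm k ?L (carry k t c h0 y) h1)"
      by (intro sum_mono carry_norm_split_le)
    also have "\<dots> = (\<Sum>y\<in>{0..<?T}. \<Sum>h1\<in>?P (int q ^ ?L). carry_norm k ?L (carry k t c h0 y) h1)"
      by (rule sum.swap)
    also have "\<dots> \<le> (\<Sum>y\<in>{0..<?T}. ?E)"
      using IH[OF h0] by (intro sum_mono) auto
    also have "\<dots> = (real q ^ t - (if h0 = z then 4 / real b^2 else 0)) * ?E"
      using False by simp
    finally show ?thesis .
  qed
  have "(\<Sum>h \<in> ?P (int q ^ (t * Suc n)). carry_norm k (t * Suc n) c h) =
      (\<Sum>h0\<in>?P ?T. \<Sum>h1\<in>?P (int q ^ ?L). carry_norm k (t + ?L) c (\<lambda>i\<in>{..<k}. h0 i + ?T * h1 i))"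
    by (simp add: power_add sum_PiE_mult_split)
  also have "\<dots> \<le> (\<Sum>h0\<in>?P ?T. (real q ^ t - (if h0 = z then 4 / real b^2 else 0)) * ?E)"
    by (intro sum_mono step)
  also have "\<dots> = (real (card (?P ?T)) * real q ^ t - 4 / real b^2) * ?E"
    using pc(1) finite_PiE[of "{..<k}" "\<lambda>_. {0..<?T}"]
    by (simp add: sum_distrib_right[symmetric] sum_subtractf)
  also have "real (card (?P ?T)) * real q ^ t = real q ^ ((k + 1) * t)"
  proof -
    have "card (?P ?T) = (q ^ t) ^ k" by (simp add: card_PiE nat_power_eq)
    then show ?thesis by (simp add: add_mult_distrib power_add mult.commute[of k] flip: power_mult)
  qed
  finally show ?case by (simp only: power_Suc)
qed

end

section \<open>Van der Corput's inequality and counting lemmas\<close>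

lemma norm_sum_shift_diff_le:
  fixes g :: "nat \<Rightarrow> complex"
  assumes "\<And>n. norm (g n) \<le> 1"
  shows "norm ((\<Sum>n<N. g (n + h)) - (\<Sum>n<N. g n)) \<le> 2 * h"
proof (induction h)
  case (Suc h)
  have "(\<Sum>n<N. g (n + Suc h)) - (\<Sum>n<N. g (n + h)) = g (N + h) - g h"
    using sum_lessThan_telescope[of "\<lambda>n. g (n + h)" N] by (simp flip: sum_subtractf)
  then have "norm ((\<Sum>n<N. g (n + Suc h)) - (\<Sum>n<N. g (n + h))) \<le> 1 + 1"
    using norm_triangle_ineq4[of "g (N + h)" "g h"] assms[of "N + h"] assms[of h] by simp
  then show ?case
    using Suc norm_triangle_ineq[of "(\<Sum>n<N. g (n + Suc h)) - (\<Sum>n<N. g (n + h))"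
        "(\<Sum>n<N. g (n + h)) - (\<Sum>n<N. g n)"] by simp
qed simp

text \<open>Average over the shifts \<open>r * K\<close>, apply Cauchy-Schwarz and expand the
  square. Shifting changes the sum by at most \<open>2 * R * K\<close>; this error stays linear
  after squaring because both normalised sums are at most \<open>1\<close>.\<close>

lemma van_der_Corput:
  fixes g :: "nat \<Rightarrow> complex"
  assumes g: "\<And>n. norm (g n) \<le> 1" and N: "0 < N" and R: "0 < R"
  shows "(norm (\<Sum>n<N. g n) / N)\<^sup>2 \<le>
    (\<Sum>r<R. \<Sum>r'<R. norm (\<Sum>n<N. g (n + r * K) * cnj (g (n + r' * K)))) / (real R ^ 2 * N)
      + 4 * (real R * K / N)"
proof -
  define G where "G n = (\<Sum>r<R. g (n + r * K))" for n
  define S where "S = (\<Sum>n<N. g n)"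
  define E where "E = (\<Sum>n<N. G n)"
  define V where "V = (\<Sum>r<R. \<Sum>r'<R. norm (\<Sum>n<N. g (n + r * K) * cnj (g (n + r' * K))))"
  have EE: "E = (\<Sum>r<R. \<Sum>n<N. g (n + r * K))"
    unfolding E_def G_def by (rule sum.swap)
  have "norm (E - R * S) = norm (\<Sum>r<R. (\<Sum>n<N. g (n + r * K)) - S)"
    by (simp add: EE sum_subtractf)
  also have "\<dots> \<le> (\<Sum>r<R. 2 * (real R * K))"
  proof (rule sum_norm_le)
    fix r assume "r \<in> {..<R}"
    then have "r * K \<le> R * K" by simp
    then have "real (r * K) \<le> real R * K" by (metis of_nat_le_iff of_nat_mult)
    then show "norm ((\<Sum>n<N. g (n + r * K)) - S) \<le> 2 * (real R * K)"
      using norm_sum_shift_diff_le[where g = g and N = N and h = "r * K"] g by (simp add: S_def)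
  qed
  finally have ES: "norm (E - R * S) \<le> R * (2 * (real R * K))" by simp
  define x where "x = norm S / N"
  define y where "y = norm E / (R * N)"
  have "R * norm S \<le> norm E + R * (2 * (real R * K))"
    using ES norm_triangle_sub[of "R * S" E] by (simp add: norm_mult norm_minus_commute)
  then have xy: "x \<le> y + 2 * (real R * K / N)"
    using N R by (simp add: x_def y_def field_simps)
  have x1: "0 \<le> x" "x \<le> 1"
    using N sum_norm_bound[of "{..<N}" g 1] g by (auto simp: x_def S_def)
  have G: "norm (G n) \<le> R" for n
    using sum_norm_bound[of "{..<R}" "\<lambda>r. g (n + r * K)" 1] g by (simp add: G_def)
  have y1: "0 \<le> y" "y \<le> 1"
    using N R sum_norm_bound[of "{..<N}" G R] G by (auto simp: y_def E_def mult.commute)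
  have "x\<^sup>2 \<le> y\<^sup>2 + 4 * (real R * K / N)"
  proof (cases "x \<le> y")
    case True
    then have "x\<^sup>2 \<le> y\<^sup>2" using x1 by (intro power_mono)
    then show ?thesis by (simp add: add_increasing2)
  next
    case False
    have "x\<^sup>2 - y\<^sup>2 = (x - y) * (x + y)" by (simp add: power2_eq_square algebra_simps)
    also have "\<dots> \<le> (2 * (real R * K / N)) * 2"
      using False xy x1 y1 by (intro mult_mono) auto
    finally show ?thesis by simp
  qed
  moreover have "y\<^sup>2 \<le> V / (real R ^ 2 * N)"
  proof -
    have "of_real (\<Sum>n<N. (norm (G n))\<^sup>2) =
        (\<Sum>n<N. \<Sum>r<R. \<Sum>r'<R. g (n + r * K) * cnj (g (n + r' * K)))"
    proof -
      have "of_real ((norm (G n))\<^sup>2) = (\<Sum>r<R. \<Sum>r'<R. g (n + r * K) * cnj (g (n + r' * K)))" for n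
        by (simp only: complex_norm_square) (simp add: G_def sum_product)
      then show ?thesis by (simp only: of_real_sum)
    qed
    also have "\<dots> = (\<Sum>r<R. \<Sum>r'<R. \<Sum>n<N. g (n + r * K) * cnj (g (n + r' * K)))"
    proof -
      have "(\<Sum>n<N. \<Sum>r'<R. g (n + r * K) * cnj (g (n + r' * K))) =
          (\<Sum>r'<R. \<Sum>n<N. g (n + r * K) * cnj (g (n + r' * K)))" for r
        by (rule sum.swap)
      then show ?thesis by (subst sum.swap) simp
    qed
    finally have eq: "of_real (\<Sum>n<N. (norm (G n))\<^sup>2) =
        (\<Sum>r<R. \<Sum>r'<R. \<Sum>n<N. g (n + r * K) * cnj (g (n + r' * K)))" .
    have "0 \<le> (\<Sum>n<N. (norm (G n))\<^sup>2)" by (intro sum_nonneg) auto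
    then have "(\<Sum>n<N. (norm (G n))\<^sup>2) =
        norm (\<Sum>r<R. \<Sum>r'<R. \<Sum>n<N. g (n + r * K) * cnj (g (n + r' * K)))"
      unfolding eq[symmetric] by (simp only: norm_of_real abs_of_nonneg)
    also have "\<dots> \<le> V" unfolding V_def by (intro sum_norm_le order_refl)
    finally have GV: "(\<Sum>n<N. (norm (G n))\<^sup>2) \<le> V" .
    have "(norm E)\<^sup>2 \<le> (\<Sum>n<N. norm (G n))\<^sup>2"
      unfolding E_def by (intro power_mono norm_sum) auto
    also have "\<dots> \<le> (\<Sum>n<N. (norm (G n))\<^sup>2) * N"
      using sum_squared_le_sum_of_squares[of "\<lambda>n. norm (G n)" "{..<N}"] by (simp only: card_lessThan)
    also have "\<dots> \<le> V * N" using GV by (intro mult_right_mono) auto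
    finally have "(norm E)\<^sup>2 / (real R * N)\<^sup>2 \<le> V * N / (real R * N)\<^sup>2"
      by (intro divide_right_mono) auto
    also have "V * N / (real R * N)\<^sup>2 = V / (real R ^ 2 * N)"
      using N by (simp add: power2_eq_square)
    finally show ?thesis by (simp add: y_def power_divide)
  qed
  ultimately show ?thesis by (simp add: x_def S_def V_def)
qed

text \<open>Halving keeps the errors from piling up: \<open>(a 0 / 2)^2\<close> is at most the
  maximum of \<open>a 1 / 2\<close> and \<open>\<tau>\<close>, so either the induction continues or
  the quantity is already down to \<open>\<tau> \<le> 1\<close>, and the error is paid once.\<close>

lemma iterated_square_bound:
  fixes a :: "nat \<Rightarrow> real"
  assumes "\<And>i. 0 \<le> a i" and "0 \<le> \<tau>" "\<tau> \<le> 1"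
    and "\<And>i. i < k \<Longrightarrow> (a i)\<^sup>2 \<le> a (Suc i) + \<tau>"
  shows "(a 0 / 2) ^ 2 ^ k \<le> a k + \<tau>"
  using assms(1,4)
proof (induction k arbitrary: a)
  case 0
  then show ?case using assms(2) 0(1)[of 0] by (simp del: 0)
next
  case (Suc k)
  have IH: "(a 1 / 2) ^ 2 ^ k \<le> a (Suc k) + \<tau>"
    using Suc.IH[of "\<lambda>i. a (Suc i)"] Suc.prems by simp
  define m where "m = max (a 1 / 2) \<tau>"
  have "(a 0 / 2)\<^sup>2 \<le> m"
    using Suc.prems(2)[of 0] Suc.prems(1)[of 1] assms(2) by (simp add: m_def power_divide)
  then have "((a 0 / 2)\<^sup>2) ^ 2 ^ k \<le> m ^ 2 ^ k" by (intro power_mono) auto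
  also have "m ^ 2 ^ k \<le> a (Suc k) + \<tau>"
  proof (cases "a 1 / 2 \<le> \<tau>")
    case True
    have "\<tau> ^ 2 ^ k \<le> \<tau> ^ 1" using assms by (intro power_decreasing) auto
    then show ?thesis using True Suc.prems(1)[of "Suc k"] by (simp add: m_def max_def)
  qed (use IH in \<open>auto simp: m_def max_def\<close>)
  finally show ?case by (simp add: power_mult)
qed

text \<open>In each interval of length \<open>B\<close> all elements lie within \<open>A\<close> of
  the smallest one, and \<open>N div B + 1\<close> such intervals cover
  \<open>{..<N}\<close>.\<close>

lemma card_gap_le:
  assumes S: "S \<subseteq> {..<N}" and B: "1 \<le> B"
    and gap: "\<And>n n'. n \<in> S \<Longrightarrow> n' \<in> S \<Longrightarrow> n < n' \<Longrightarrow> n' - n < B \<Longrightarrow> n' - n < A"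
    and A: "1 \<le> A"
  shows "card S \<le> A * (N div B + 1)"
proof -
  have fin: "finite S" using S finite_subset by blast
  have "S \<subseteq> (\<Union>c\<le>N div B. S \<inter> {c * B..<c * B + B})"
  proof
    fix n assume n: "n \<in> S"
    have "n \<in> {n div B * B..<n div B * B + B}"
      using B dividend_less_div_times[of B n] by (simp add: add.commute)
    moreover have "n div B \<le> N div B" using n S by (intro div_le_mono) auto
    ultimately show "n \<in> (\<Union>c\<le>N div B. S \<inter> {c * B..<c * B + B})" using n by blast
  qed
  then have "card S \<le> card (\<Union>c\<le>N div B. S \<inter> {c * B..<c * B + B})"
    using fin by (intro card_mono) auto
  also have "\<dots> \<le> (\<Sum>c\<le>N div B. card (S \<inter> {c * B..<c * B + B}))"
    by (rule card_UN_le) simp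
  also have "\<dots> \<le> (\<Sum>c\<le>N div B. A)"
  proof (rule sum_mono)
    fix c
    define W where "W = S \<inter> {c * B..<c * B + B}"
    show "card (S \<inter> {c * B..<c * B + B}) \<le> A"
    proof (cases "W = {}")
      case False
      have finW: "finite W" using fin by (simp add: W_def)
      have "W \<subseteq> {Min W..<Min W + A}"
      proof
        fix n assume n: "n \<in> W"
        have mn: "Min W \<in> W" "Min W \<le> n" using finW False n by auto
        show "n \<in> {Min W..<Min W + A}"
        proof (cases "Min W = n")
          case False
          then have "n - Min W < A"
            using mn n by (intro gap) (auto simp: W_def)
          then show ?thesis using mn by auto
        qed (use A in auto)
      qed
      then show ?thesis using card_mono[of "{Min W..<Min W + A}" W] by (simp add: W_def)
    qed (simp add: W_def)
  qed
  finally show ?thesis by (simp add: mult.commute)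
qed

text \<open>All solutions lie within \<open>2 * Y / K\<close> of the least one.\<close>

lemma card_near_point_le:
  fixes c :: int and K Y :: nat
  assumes "1 \<le> K"
  shows "finite {m::nat. \<bar>int K * int m - c\<bar> \<le> int Y}"
    and "card {m::nat. \<bar>int K * int m - c\<bar> \<le> int Y} \<le> 2 * Y div K + 1"
proof -
  let ?P = "\<lambda>m::nat. \<bar>int K * int m - c\<bar> \<le> int Y"
  have "{m. ?P m} \<subseteq> {(LEAST m. ?P m)..(LEAST m. ?P m) + 2 * Y div K}"
  proof
    fix m assume m: "m \<in> {m. ?P m}"
    define m0 where "m0 = (LEAST m. ?P m)"
    have m0: "?P m0" "m0 \<le> m"
      using LeastI[of ?P m] Least_le[of ?P m] m by (auto simp: m0_def)
    then have "int K * (int m - int m0) \<le> 2 * int Y"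
      using m by (simp add: right_diff_distrib abs_le_iff)
    then have "int (K * (m - m0)) \<le> int (2 * Y)" using m0 by (simp add: of_nat_diff)
    then have "K * (m - m0) \<le> 2 * Y" by (simp only: of_nat_le_iff)
    then have "m - m0 \<le> 2 * Y div K"
      using assms by (simp add: less_eq_div_iff_mult_less_eq mult.commute)
    then show "m \<in> {(LEAST m. ?P m)..(LEAST m. ?P m) + 2 * Y div K}"
      using m0 by (auto simp: m0_def)
  qed
  then show "finite {m. ?P m}" "card {m. ?P m} \<le> 2 * Y div K + 1"
    using finite_subset card_mono[of "{(LEAST m. ?P m)..(LEAST m. ?P m) + 2 * Y div K}" "{m. ?P m}"]
    by auto
qed

text \<open>Since \<open>Y < D\<close>, the multiple \<open>t * M\<close> is positive; hence at most \<open>2 * K * X / M\<close> values of \<open>t\<close>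
  occur and each of them admits at most \<open>3 * Y / K\<close> values of \<open>m\<close>.\<close>
lemma card_near_multiple_le:
  fixes M :: int
  assumes "1 \<le> K" "K \<le> Y" "Y < D" "D \<le> X" "0 < M"
  shows "card {m \<in> {D..<X}. \<exists>t. \<bar>int K * int m - t * M\<bar> \<le> int Y} \<le> 6 * real X * Y / M"
proof -
  define T where "T = (2 * int K * int X) div M"
  have "{m \<in> {D..<X}. \<exists>t. \<bar>int K * int m - t * M\<bar> \<le> int Y} \<subseteq>
      (\<Union>t\<in>{1..T}. {m. \<bar>int K * int m - t * M\<bar> \<le> int Y})"
  proof
    fix m assume "m \<in> {m \<in> {D..<X}. \<exists>t. \<bar>int K * int m - t * M\<bar> \<le> int Y}"
    then obtain t where m: "D \<le> m" "m < X" and t: "\<bar>int K * int m - t * M\<bar> \<le> int Y" by auto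
    have "1 * int m \<le> int K * int m" using assms by (intro mult_right_mono) auto
    then have "0 < t * M" using t m assms by linarith
    then have "1 \<le> t" using assms by (simp add: zero_less_mult_iff)
    \<comment> \<open>\<open>Y < D \<le> X \<le> K * X\<close> turns the error \<open>Y\<close> into
      a factor \<open>2\<close>.\<close>
    moreover have "t * M \<le> int K * int X + int K * int X"
    proof -
      have "int K * int m \<le> int K * int X" using m by (intro mult_left_mono) auto
      moreover have "1 * int X \<le> int K * int X" using assms by (intro mult_right_mono) auto
      ultimately show ?thesis using t assms by linarith
    qed
    then have "t \<le> T" unfolding T_def using assms zdiv_mono1[of "t * M" _ M] by simp
    ultimately show "m \<in> (\<Union>t\<in>{1..T}. {m. \<bar>int K * int m - t * M\<bar> \<le> int Y})"
      using t by auto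
  qed
  then have "card {m \<in> {D..<X}. \<exists>t. \<bar>int K * int m - t * M\<bar> \<le> int Y} \<le>
      card (\<Union>t\<in>{1..T}. {m. \<bar>int K * int m - t * M\<bar> \<le> int Y})"
    using card_near_point_le(1)[OF assms(1)] by (intro card_mono) auto
  also have "\<dots> \<le> (\<Sum>t\<in>{1..T}. card {m. \<bar>int K * int m - t * M\<bar> \<le> int Y})"
    by (rule card_UN_le) simp
  also have "\<dots> \<le> (\<Sum>t\<in>{1..T}. 2 * Y div K + 1)"
    by (intro sum_mono card_near_point_le assms)
  finally have "real (card {m \<in> {D..<X}. \<exists>t. \<bar>int K * int m - t * M\<bar> \<le> int Y}) \<le>
      real (nat T * (2 * Y div K + 1))"
    by (simp only: of_nat_le_iff sum_constant card_atLeastAtMost_int) (simp add: mult.commute)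
  also have "\<dots> \<le> (2 * real K * X / M) * (3 * Y / K)"
  proof -
    have "real (nat T) \<le> 2 * real K * X / M"
    proof -
      have "0 \<le> T" unfolding T_def using assms by (auto intro!: pos_imp_zdiv_nonneg_iff[THEN iffD2])
      moreover have "of_int T \<le> of_int (2 * int K * int X) / real_of_int M"
        unfolding T_def by (rule real_of_int_div4)
      ultimately show ?thesis by simp
    qed
    moreover have "real (2 * Y div K + 1) \<le> 3 * Y / K"
    proof -
      have "real (2 * Y div K) \<le> real (2 * Y) / K" by (rule of_nat_div_le_of_nat)
      moreover have "1 \<le> real Y / K" using assms by simp
      ultimately show ?thesis by (simp add: add_divide_distrib[symmetric])
    qed
    ultimately show ?thesis unfolding of_nat_mult by (intro mult_mono) auto
  qed
  also have "\<dots> = 6 * real X * Y / M" using assms by simp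
  finally show ?thesis .
qed

lemma card_multiples_le:
  assumes "1 \<le> D" "1 \<le> d"
  shows "real (card {m \<in> {D..<X}. d dvd m}) \<le> real X / d"
proof -
  have "{m \<in> {D..<X}. d dvd m} \<subseteq> (\<lambda>i. d * i) ` {1..X div d}"
  proof
    fix m assume "m \<in> {m \<in> {D..<X}. d dvd m}"
    then have m: "1 \<le> m" "m < X" "d dvd m" using assms by auto
    from m(3) obtain i where "m = d * i" by (rule dvdE)
    with m have i: "m = d * i" "1 \<le> m" "m < X" by auto
    then have "i \<le> X div d" using assms by (simp add: less_eq_div_iff_mult_less_eq mult.commute)
    moreover have "1 \<le> i" using i by (cases i) auto
    ultimately show "m \<in> (\<lambda>i. d * i) ` {1..X div d}" using i by auto
  qed
  then have "card {m \<in> {D..<X}. d dvd m} \<le> card {1..X div d}"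
    by (intro surj_card_le) auto
  then show ?thesis using of_nat_div_le_of_nat[of X d, where ?'a = real] by simp
qed

section \<open>Cubes along arithmetic progressions\<close>

text \<open>Each van der Corput step leaves two free shifts, hence the two families \<open>u\<close>
  and \<open>w\<close>; their differences become the sides once the base point has been
  moved.\<close>

primrec cube :: "nat \<Rightarrow> (int \<Rightarrow> int) \<Rightarrow> (nat \<Rightarrow> int) \<Rightarrow> (nat \<Rightarrow> int) \<Rightarrow> int \<Rightarrow> int" where
  "cube 0 g u w x = g x"
| "cube (Suc k) g u w x = cube k g u w (x + u k) - cube k g u w (x + w k)"

lemma cube_cong:
  assumes "\<And>i. i < k \<Longrightarrow> u i = u' i" "\<And>i. i < k \<Longrightarrow> w i = w' i"
  shows "cube k g u w x = cube k g u' w' x"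
  using assms by (induction k arbitrary: x) auto

lemma cube_add: "cube k (\<lambda>x. g x + f x) u w x = cube k g u w x + cube k f u w x"
  by (induction k arbitrary: x) auto

lemma cube_differences:
  "cube k g u w x = cube k g (\<lambda>i. u i - w i) (\<lambda>_. 0) (x + (\<Sum>i<k. w i))"
  by (induction k arbitrary: x) (simp_all add: algebra_simps)

lemma cube_eq_sum_Pow:
  "cube k g h (\<lambda>_. 0) x = (\<Sum>A\<in>Pow {..<k}. (-1) ^ (k + card A) * g (x + sum h A))"
proof (induction k arbitrary: x)
  case (Suc k)
  have "card (insert k A) = Suc (card A)" "sum h (insert k A) = h k + sum h A" if "A \<in> Pow {..<k}" for A
    using that finite_subset[of A "{..<k}"] by (auto intro!: card_insert_disjoint sum.insert)
  then show ?case
    unfolding sum_Pow_Suc cube.simps Suc.IH sum_subtractf[symmetric]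
    by (intro sum.cong refl) (simp add: add.assoc)
qed simp

text \<open>If \<open>z * v\<close> is \<open>J\<close> modulo \<open>M\<close>, replacing
  \<open>r\<close> by \<open>r + z * y\<close> moves \<open>r * v\<close> by \<open>J * y\<close>.
  The number of solutions is therefore invariant under translation by \<open>J\<close>, even when
  \<open>v\<close> and \<open>M\<close> have common factors; the reverse inequality is the case
  \<open>- y\<close>.\<close>

lemma card_residue_shift_le:
  fixes M :: nat
  assumes M: "0 < M" and z: "int M dvd z * v - J"
  shows "card {r \<in> {..<M}. int M dvd int r * v + a - x} \<le>
    card {r \<in> {..<M}. int M dvd int r * v + a - (x + J * y)}"
proof (rule card_inj_on_le)
  define f where "f r = nat ((int r + z * y) mod int M)" for r
  have f: "int (f r) = (int r + z * y) mod int M" for r using M by (simp add: f_def)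
  show "inj_on f {r \<in> {..<M}. int M dvd int r * v + a - x}"
  proof (rule inj_onI)
    fix r r' assume r: "r \<in> {r \<in> {..<M}. int M dvd int r * v + a - x}"
      "r' \<in> {r \<in> {..<M}. int M dvd int r * v + a - x}" "f r = f r'"
    then have "(int r + z * y) mod int M = (int r' + z * y) mod int M" using f by metis
    then have "int r mod int M = int r' mod int M"
      by (metis add_diff_cancel_right' mod_diff_left_eq)
    then show "r = r'" using r by simp
  qed
  show "f ` {r \<in> {..<M}. int M dvd int r * v + a - x} \<subseteq>
    {r \<in> {..<M}. int M dvd int r * v + a - (x + J * y)}"
  proof safe
    fix r assume r: "int M dvd int r * v + a - x"
    have "int (f r) < int M" using M by (simp add: f)
    then show "f r < M" by simp
    have "int M dvd (int r + z * y) - int (f r)" by (simp add: f dvd_minus_mod)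
    then have "int M dvd (int r * v + a - x) + (z * v - J) * y - ((int r + z * y) - int (f r)) * v"
      by (rule dvd_diff[OF dvd_add[OF r dvd_mult2[OF z]] dvd_mult2])
    then show "int M dvd int (f r) * v + a - (x + J * y)" by (simp add: algebra_simps)
  qed
qed simp

lemma card_residue_shift:
  fixes M :: nat
  assumes "0 < M" "int M dvd z * v - J"
  shows "card {r \<in> {..<M}. int M dvd int r * v + a - (x + J * y)} =
    card {r \<in> {..<M}. int M dvd int r * v + a - x}"
  using card_residue_shift_le[OF assms, of a x y]
    card_residue_shift_le[OF assms, of a "x + J * y" "- y"] by simp

lemma mod_eq_iff_dvd:
  fixes x M :: int
  assumes "x \<in> {0..<M}"
  shows "y mod M = x \<longleftrightarrow> M dvd y - x"
  using assms by (metis atLeastLessThan_iff mod_eq_dvd_iff mod_pos_pos_trivial)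

lemma sum_by_residue:
  fixes M :: nat and \<Phi> :: "int \<Rightarrow> 'a::{comm_semiring_1}"
  assumes "0 < M"
  shows "(\<Sum>n<M. \<Phi> ((int n * v + a) mod int M)) =
    (\<Sum>x\<in>{0..<int M}. of_nat (card {n \<in> {..<M}. int M dvd int n * v + a - x}) * \<Phi> x)"
proof -
  have "(\<Sum>n<M. \<Phi> ((int n * v + a) mod int M)) =
      (\<Sum>x\<in>{0..<int M}. \<Sum>n\<in>{n\<in>{..<M}. (int n * v + a) mod int M = x}. \<Phi> ((int n * v + a) mod int M))"
    using assms by (intro sum.group[symmetric]) auto
  also have "\<dots> = (\<Sum>x\<in>{0..<int M}. of_nat (card {n \<in> {..<M}. int M dvd int n * v + a - x}) * \<Phi> x)"
  proof (rule sum.cong[OF refl])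
    fix x assume x: "x \<in> {0..<int M}"
    have "(\<Sum>n\<in>{n\<in>{..<M}. (int n * v + a) mod int M = x}. \<Phi> ((int n * v + a) mod int M)) =
        (\<Sum>n\<in>{n\<in>{..<M}. (int n * v + a) mod int M = x}. \<Phi> x)"
      by (intro sum.cong) auto
    then show "(\<Sum>n\<in>{n\<in>{..<M}. (int n * v + a) mod int M = x}. \<Phi> ((int n * v + a) mod int M)) =
        of_nat (card {n \<in> {..<M}. int M dvd int n * v + a - x}) * \<Phi> x"
      using mod_eq_iff_dvd[OF x] by simp
  qed
  finally show ?thesis .
qed

text \<open>The fibres of a map that acts coordinatewise are products.\<close>

lemma sum_PiE_by_image:
  fixes F :: "('i \<Rightarrow> 'c) \<Rightarrow> real"
  assumes "finite I" "finite A" "finite T" and "\<And>i r. i \<in> I \<Longrightarrow> r \<in> A \<Longrightarrow> \<eta> i r \<in> T"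
  shows "(\<Sum>r \<in> I \<rightarrow>\<^sub>E A. F (\<lambda>i\<in>I. \<eta> i (r i))) =
    (\<Sum>x \<in> I \<rightarrow>\<^sub>E T. (\<Prod>i\<in>I. real (card {r \<in> A. \<eta> i r = x i})) * F x)"
proof -
  let ?g = "\<lambda>r. \<lambda>i\<in>I. \<eta> i (r i)"
  have "(\<Sum>r \<in> I \<rightarrow>\<^sub>E A. F (?g r)) =
      (\<Sum>x \<in> I \<rightarrow>\<^sub>E T. \<Sum>r\<in>{r \<in> I \<rightarrow>\<^sub>E A. ?g r = x}. F (?g r))"
    using assms by (intro sum.group[symmetric] finite_PiE) (auto simp: PiE_iff)
  also have "\<dots> = (\<Sum>x \<in> I \<rightarrow>\<^sub>E T. (\<Prod>i\<in>I. real (card {r \<in> A. \<eta> i r = x i})) * F x)"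
  proof (rule sum.cong[OF refl])
    fix x assume x: "x \<in> I \<rightarrow>\<^sub>E T"
    have "{r \<in> I \<rightarrow>\<^sub>E A. ?g r = x} = PiE I (\<lambda>i. {r \<in> A. \<eta> i r = x i})"
      using x by (auto simp: PiE_iff extensional_def fun_eq_iff)
    then have "real (card {r \<in> I \<rightarrow>\<^sub>E A. ?g r = x}) = (\<Prod>i\<in>I. real (card {r \<in> A. \<eta> i r = x i}))"
      using assms by (simp add: card_PiE)
    then show "(\<Sum>r\<in>{r \<in> I \<rightarrow>\<^sub>E A. ?g r = x}. F (?g r)) =
        (\<Prod>i\<in>I. real (card {r \<in> A. \<eta> i r = x i})) * F x"
      by simp
  qed
  finally show ?thesis .
qed

section \<open>Cubes over full periods of an arithmetic progression\<close>

context digit_phase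
begin

lemma carry_norm_cong:
  assumes "\<And>A. A \<in> Pow {..<k} \<Longrightarrow> c A = c' A" and "\<And>i. i < k \<Longrightarrow> h i = h' i"
  shows "carry_norm k L c h = carry_norm k L c' h'"
proof -
  have "sum h A = sum h' A" if "A \<in> Pow {..<k}" for A
    using that assms(2) by (intro sum.cong) auto
  then have "cube_phase k L c h = cube_phase k L c' h'" "carry k L c h = carry k L c' h'"
    using assms(1) unfolding cube_phase_def carry_def
    by (intro ext sum.cong restrict_ext refl; simp)+
  then show ?thesis by (simp add: carry_norm_def)
qed

text \<open>\<open>xl\<close> stands for the lowest \<open>j\<close> digits, \<open>y\<close> for
  the next \<open>L\<close>, \<open>xh\<close> for the top \<open>e\<close>. With \<open>xl\<close>
  and the sides fixed, the low digits give a constant phase and the incoming carries, and the top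
  digits see \<open>y\<close> only through its carry vector. The constant phase and the top digits
  go into the bounded factor \<open>B\<close>.\<close>

lemma norm_sum_chi_cube_le_carry_norm:
  fixes h :: "nat \<Rightarrow> int"
  shows "norm (\<Sum>y\<in>{0..<int q ^ L}.
      chi (cube k (sd (j + (L + e))) h (\<lambda>_. 0) (xl + int q ^ j * (y + int q ^ L * xh)))) \<le>
    carry_norm k L (\<lambda>A. (xl + (\<Sum>i\<in>A. h i mod int q ^ j)) div int q ^ j)
      (\<lambda>i. (h i div int q ^ j) mod int q ^ L)"
proof -
  let ?J = "int q ^ j" and ?P = "int q ^ L"
  define c where "c A = (xl + (\<Sum>i\<in>A. h i mod ?J)) div ?J" for A
  define b' where "b' i = (h i div ?J) mod ?P" for i
  define s where "s A = xl + (\<Sum>i\<in>A. h i mod ?J)" for A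
  define Z where "Z A = xh + (\<Sum>i\<in>A. h i div ?J div ?P)" for A
  define sg :: "nat set \<Rightarrow> int" where "sg A = (-1) ^ (k + card A)" for A
  define B where "B C = chi (\<Sum>A\<in>Pow {..<k}. sg A * sd j (s A)) *
    chi (\<Sum>A\<in>Pow {..<k}. sg A * sd e (C A + Z A))" for C
  have "chi (cube k (sd (j + (L + e))) h (\<lambda>_. 0) (xl + ?J * (y + ?P * xh))) =
      chi (cube_phase k L c b' y) * B (carry k L c b' y)" for y
  proof -
    have X: "xl + ?J * (y + ?P * xh) + sum h A = s A + ?J * ((y + sum b' A) + ?P * Z A)" for A
    proof -
      have "h i = h i mod ?J + ?J * (b' i + ?P * (h i div ?J div ?P))" for i
        by (simp add: b'_def)
      then have "sum h A = (\<Sum>i\<in>A. h i mod ?J + ?J * (b' i + ?P * (h i div ?J div ?P)))"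
        by (metis (no_types, lifting) sum.cong)
      also have "\<dots> = (\<Sum>i\<in>A. h i mod ?J) + ?J * (sum b' A + ?P * (\<Sum>i\<in>A. h i div ?J div ?P))"
        by (simp add: sum.distrib sum_distrib_left distrib_left)
      finally show ?thesis by (simp add: s_def Z_def algebra_simps)
    qed
    have "sd (j + (L + e)) (xl + ?J * (y + ?P * xh) + sum h A) = sd j (s A) +
        (sd L (c A + y + sum b' A) + sd e ((c A + y + sum b' A) div ?P + Z A))" for A
    proof -
      have "c A + ((y + sum b' A) + ?P * Z A) = (c A + y + sum b' A) + ?P * Z A" by simp
      then show ?thesis by (simp only: X form_sd c_def s_def)
    qed
    then have "cube k (sd (j + (L + e))) h (\<lambda>_. 0) (xl + ?J * (y + ?P * xh)) =
        (\<Sum>A\<in>Pow {..<k}. sg A * sd j (s A) + (sg A * sd L (c A + y + sum b' A) +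
          sg A * sd e ((c A + y + sum b' A) div ?P + Z A)))"
      by (simp add: cube_eq_sum_Pow sg_def distrib_left)
    also have "\<dots> = (\<Sum>A\<in>Pow {..<k}. sg A * sd j (s A)) + (cube_phase k L c b' y +
        (\<Sum>A\<in>Pow {..<k}. sg A * sd e (carry k L c b' y A + Z A)))"
      unfolding sum.distrib cube_phase_def sg_def carry_def by simp
    finally show ?thesis by (simp add: chi_add B_def)
  qed
  moreover have "norm (B C) \<le> 1" for C by (simp add: B_def norm_mult)
  ultimately have "norm (\<Sum>y\<in>{0..<?P}.
      chi (cube k (sd (j + (L + e))) h (\<lambda>_. 0) (xl + ?J * (y + ?P * xh)))) \<le> carry_norm k L c b'"
    using norm_sum_le_carry_norm[of B k L c b'] by simp
  then show ?thesis unfolding c_def b'_def .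
qed

lemma cube_sd_cong:
  assumes "int q ^ L dvd x - y"
  shows "cube k (sd L) u w x = cube k (sd L) u w y"
  using assms
proof (induction k arbitrary: x y)
  case 0
  then show ?case by (auto intro!: sd_cong simp: mod_eq_dvd_iff)
next
  case (Suc k)
  then have "cube k (sd L) u w (x + d) = cube k (sd L) u w (y + d)" for d
    by (intro Suc.IH) simp
  then show ?case by simp
qed

text \<open>The hypothesis on \<open>z\<close> makes the number of \<open>n\<close> with
  \<open>int n * m + a\<close> congruent to \<open>x\<close> depend only on the lowest
  \<open>j\<close> digits of \<open>x\<close>. A full period thus becomes a full sum over the other
  digits, weighted by \<open>\<iota>\<close>; the second claim evaluates the total weight.\<close>

lemma norm_sum_chi_cube_progression_le:
  fixes h :: "nat \<Rightarrow> int" and m a :: int and j L e :: nat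
  defines "M \<equiv> q ^ (j + (L + e))"
  assumes z: "int M dvd z * m - int q ^ j"
  defines "\<iota> \<equiv> \<lambda>x. real (card {n \<in> {..<M}. int M dvd int n * m + a - x})"
  shows "norm (\<Sum>n<M. chi (cube k (sd (j + (L + e))) h (\<lambda>_. 0) (int n * m + a))) \<le>
    real q ^ e * (\<Sum>xl\<in>{0..<int q ^ j}. \<iota> xl *
      carry_norm k L (\<lambda>A. (xl + (\<Sum>i\<in>A. h i mod int q ^ j)) div int q ^ j)
        (\<lambda>i. (h i div int q ^ j) mod int q ^ L))"
    and "(\<Sum>xl\<in>{0..<int q ^ j}. \<iota> xl) * real q ^ (L + e) = real M"
proof -
  let ?J = "int q ^ j" and ?P = "int q ^ L" and ?E = "int q ^ e"
  define \<Phi> where "\<Phi> x = chi (cube k (sd (j + (L + e))) h (\<lambda>_. 0) x)" for x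
  define Z where "Z xl = carry_norm k L (\<lambda>A. (xl + (\<Sum>i\<in>A. h i mod ?J)) div ?J) (\<lambda>i. (h i div ?J) mod ?P)" for xl
  have M0: "0 < M" by (simp add: M_def)
  have M: "int M = ?J * (?P * ?E)" by (simp add: M_def power_add)
  have \<iota>: "\<iota> (x + ?J * y) = \<iota> x" for x y
    unfolding \<iota>_def using card_residue_shift[OF M0 z] by simp
  have "\<Phi> (int n * m + a) = \<Phi> ((int n * m + a) mod int M)" for n
    unfolding \<Phi>_def by (intro arg_cong[of _ _ chi] cube_sd_cong) (simp add: M_def)
  then have "(\<Sum>n<M. \<Phi> (int n * m + a)) = (\<Sum>x\<in>{0..<int M}. of_real (\<iota> x) * \<Phi> x)"
    using sum_by_residue[OF M0, of \<Phi> m a] by (simp add: \<iota>_def)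
  also have "\<dots> = (\<Sum>xl\<in>{0..<?J}. \<Sum>y\<in>{0..<?P}. \<Sum>xh\<in>{0..<?E}.
      of_real (\<iota> xl) * \<Phi> (xl + ?J * (y + ?P * xh)))"
    unfolding M by (simp add: sum_mult_split \<iota>)
  also have "\<dots> = (\<Sum>xl\<in>{0..<?J}. of_real (\<iota> xl) *
      (\<Sum>xh\<in>{0..<?E}. \<Sum>y\<in>{0..<?P}. \<Phi> (xl + ?J * (y + ?P * xh))))"
    by (subst (2) sum.swap) (simp add: sum_distrib_left)
  also have "norm \<dots> \<le> (\<Sum>xl\<in>{0..<?J}. \<iota> xl * (real q ^ e * Z xl))"
  proof (rule sum_norm_le)
    fix xl
    have "norm (\<Sum>xh\<in>{0..<?E}. \<Sum>y\<in>{0..<?P}. \<Phi> (xl + ?J * (y + ?P * xh))) \<le>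
        (\<Sum>xh\<in>{0..<?E}. Z xl)"
      unfolding \<Phi>_def Z_def by (intro sum_norm_le norm_sum_chi_cube_le_carry_norm)
    then have "norm (\<Sum>xh\<in>{0..<?E}. \<Sum>y\<in>{0..<?P}. \<Phi> (xl + ?J * (y + ?P * xh))) \<le> real q ^ e * Z xl"
      by (simp add: nat_power_eq)
    then show "norm (of_real (\<iota> xl) * (\<Sum>xh\<in>{0..<?E}. \<Sum>y\<in>{0..<?P}. \<Phi> (xl + ?J * (y + ?P * xh))))
        \<le> \<iota> xl * (real q ^ e * Z xl)"
      unfolding norm_mult by (intro mult_mono) (auto simp: \<iota>_def)
  qed
  also have "\<dots> = real q ^ e * (\<Sum>xl\<in>{0..<?J}. \<iota> xl * Z xl)"
    by (simp add: sum_distrib_left algebra_simps)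
  finally show "norm (\<Sum>n<M. chi (cube k (sd (j + (L + e))) h (\<lambda>_. 0) (int n * m + a))) \<le>
    real q ^ e * (\<Sum>xl\<in>{0..<?J}. \<iota> xl *
      carry_norm k L (\<lambda>A. (xl + (\<Sum>i\<in>A. h i mod ?J)) div ?J) (\<lambda>i. (h i div ?J) mod ?P))"
    by (simp add: \<Phi>_def Z_def)
  have "real M = (\<Sum>x\<in>{0..<int M}. \<iota> x)"
    using sum_by_residue[OF M0, of "\<lambda>_. 1::real" m a] by (simp add: \<iota>_def)
  also have "\<dots> = (\<Sum>xl\<in>{0..<?J}. \<Sum>y\<in>{0..<?P * ?E}. \<iota> xl)"
    unfolding M by (simp add: sum_mult_split \<iota>)
  also have "\<dots> = (\<Sum>xl\<in>{0..<?J}. \<iota> xl) * real q ^ (L + e)"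
    by (simp add: power_add nat_mult_distrib nat_power_eq sum_distrib_right mult.commute)
  finally show "(\<Sum>xl\<in>{0..<?J}. \<iota> xl) * real q ^ (L + e) = real M" ..
qed

end

section \<open>Ingredients of the differencing step\<close>

lemma cube_shift: "cube k g u w (x + d) = cube k (\<lambda>y. g (y + d)) u w x"
proof (induction k arbitrary: x)
  case (Suc k)
  show ?case using Suc.IH[of "x + u k"] Suc.IH[of "x + w k"] by (simp add: ac_simps)
qed simp

text \<open>A set without multiplicities suffices: it only serves to bound the number of places
  where a shift may disturb a digit.\<close>

primrec shifts :: "nat \<Rightarrow> (nat \<Rightarrow> int) \<Rightarrow> (nat \<Rightarrow> int) \<Rightarrow> int set" where
  "shifts 0 u w = {0}"
| "shifts (Suc k) u w = (\<lambda>z. z + u k) ` shifts k u w \<union> (\<lambda>z. z + w k) ` shifts k u w"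

lemma card_shifts_le: "finite (shifts k u w) \<and> card (shifts k u w) \<le> 2 ^ k"
proof (induction k)
  case (Suc k)
  then have "card ((\<lambda>z. z + u k) ` shifts k u w) \<le> 2 ^ k" "card ((\<lambda>z. z + w k) ` shifts k u w) \<le> 2 ^ k"
    using card_image_le order_trans by blast+
  then show ?case
    using Suc card_Un_le[of "(\<lambda>z. z + u k) ` shifts k u w" "(\<lambda>z. z + w k) ` shifts k u w"] by simp
qed simp

lemma cube_cong_shifts:
  assumes "\<And>z. z \<in> shifts k u w \<Longrightarrow> g (x + z) = f (x + z)"
  shows "cube k g u w x = cube k f u w x"
  using assms
proof (induction k arbitrary: x)
  case (Suc k)
  have "cube k g u w (x + u k) = cube k f u w (x + u k)"
  proof (rule Suc.IH)
    show "g (x + u k + z) = f (x + u k + z)" if "z \<in> shifts k u w" for z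
      using Suc.prems[of "z + u k"] that by (simp add: ac_simps)
  qed
  moreover have "cube k g u w (x + w k) = cube k f u w (x + w k)"
  proof (rule Suc.IH)
    show "g (x + w k + z) = f (x + w k + z)" if "z \<in> shifts k u w" for z
      using Suc.prems[of "z + w k"] that by (simp add: ac_simps)
  qed
  ultimately show ?case by simp
qed simp

lemma power2_mean_le:
  fixes T :: "'a \<Rightarrow> real"
  assumes "finite S" "S \<noteq> {}"
  shows "((\<Sum>s\<in>S. T s) / card S)\<^sup>2 \<le> (\<Sum>s\<in>S. (T s)\<^sup>2) / card S"
proof -
  have "((\<Sum>s\<in>S. T s) / card S)\<^sup>2 \<le> (\<Sum>s\<in>S. (T s)\<^sup>2) * card S / (card S)\<^sup>2"
    unfolding power_divide using sum_squared_le_sum_of_squares[of T S]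
    by (simp add: divide_right_mono)
  then show ?thesis using assms by (simp add: power2_eq_square)
qed

lemma norm_unit_exp [simp]: "norm (unit_exp x) = 1"
  by (simp add: unit_exp_def)

lemma unit_exp_add: "unit_exp (x + y) = unit_exp x * unit_exp y"
  by (simp add: unit_exp_def cis_mult algebra_simps)

lemma unit_exp_0 [simp]: "unit_exp 0 = 1"
  by (simp add: unit_exp_def)

lemma unit_exp_mult_cnj: "unit_exp x * cnj (unit_exp x) = 1"
  by (simp add: complex_norm_square[symmetric])

context digit_phase
begin

text \<open>Each side runs through a progression of full length \<open>R\<close>. Its lowest
  \<open>j\<close> digits occur with weights \<open>\<kappa>\<close> and are fixed first; the next
  \<open>L\<close> digits are then uniform, which is the average that
  \<open>sum_carry_norm_le\<close> estimates. Higher digits of the sides have already disappeared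
  into the bounded factor.\<close>

lemma sum_norm_chi_cube_le:
  fixes v w :: "nat \<Rightarrow> int" and m a :: int and j n e :: nat
  assumes k: "1 \<le> k" "k < q ^ t1" "k \<le> q ^ J" and t: "t = t1 + (J + 2)"
  defines "L \<equiv> t * n"
  defines "M \<equiv> q ^ (j + (L + e))" and "R \<equiv> q ^ (j + L)"
  assumes m: "\<exists>z. int M dvd z * m - int q ^ j"
    and v: "\<And>i. i < k \<Longrightarrow> \<exists>z. int R dvd z * v i - int q ^ j"
  shows "(\<Sum>r\<in>{..<k} \<rightarrow>\<^sub>E {..<R}. norm (\<Sum>n<M. chi (cube k (sd (j + (L + e)))
      (\<lambda>i. int (r i) * v i - w i) (\<lambda>_. 0) (int n * m + a)))) \<le>
    real R ^ k * M * (1 - 4 / real b^2 / real q ^ ((k + 1) * t)) ^ n"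
proof -
  let ?J = "int q ^ j" and ?P = "int q ^ L"
  define E where "E = (real q ^ ((k + 1) * t) - 4 / real b^2) ^ n"
  define \<iota> where "\<iota> x = real (card {n \<in> {..<M}. int M dvd int n * m + a - x})" for x
  define h where "h r i = int (r i) * v i - w i" for r :: "nat \<Rightarrow> nat" and i
  define \<eta> where "\<eta> i s = (int s * v i - w i) mod int R" for i and s :: nat
  define \<kappa> where "\<kappa> i x = real (card {s \<in> {..<R}. int R dvd int s * v i + - w i - x})" for i x
  define F where "F xl x = carry_norm k L (\<lambda>A. (xl + (\<Sum>i\<in>A. x i mod ?J)) div ?J) (\<lambda>i. x i div ?J)" for xl and x :: "nat \<Rightarrow> int"
  have R: "int R = ?J * ?P" and R0: "0 < R" by (simp_all add: R_def power_add)
  have F: "carry_norm k L (\<lambda>A. (xl + (\<Sum>i\<in>A. h r i mod ?J)) div ?J) (\<lambda>i. (h r i div ?J) mod ?P) =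
      F xl (\<lambda>i\<in>{..<k}. \<eta> i (r i))" for xl r
    unfolding F_def
  proof (rule carry_norm_cong)
    have *: "\<eta> i (r i) = ?J * ((h r i div ?J) mod ?P) + h r i mod ?J" for i
      unfolding \<eta>_def R h_def by (rule zmod_zmult2_eq) simp
    show "(h r i div ?J) mod ?P = (\<lambda>i\<in>{..<k}. \<eta> i (r i)) i div ?J" if "i < k" for i
      using that by (simp add: * div_pos_pos_trivial)
    fix A assume A: "A \<in> Pow {..<k}"
    have "(\<Sum>i\<in>A. h r i mod ?J) = (\<Sum>i\<in>A. (\<lambda>i\<in>{..<k}. \<eta> i (r i)) i mod ?J)"
      using A by (intro sum.cong) (auto simp: *)
    then show "(xl + (\<Sum>i\<in>A. h r i mod ?J)) div ?J =
        (xl + (\<Sum>i\<in>A. (\<lambda>i\<in>{..<k}. \<eta> i (r i)) i mod ?J)) div ?J" by simp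
  qed
  have \<kappa>: "\<kappa> i (x + ?J * y) = \<kappa> i x" if i: "i < k" for i x y
  proof -
    obtain z where "int R dvd z * v i - ?J" using v[OF i] by blast
    from card_residue_shift[OF R0 this, of "- w i" x y] show ?thesis by (simp add: \<kappa>_def)
  qed
  have split: "(\<Sum>r\<in>{..<k} \<rightarrow>\<^sub>E {..<R}. G (\<lambda>i\<in>{..<k}. \<eta> i (r i))) =
      (\<Sum>o'\<in>{..<k} \<rightarrow>\<^sub>E {0..<?J}. (\<Prod>i<k. \<kappa> i (o' i)) *
        (\<Sum>b'\<in>{..<k} \<rightarrow>\<^sub>E {0..<?P}. G (\<lambda>i\<in>{..<k}. o' i + ?J * b' i)))"
    for G :: "(nat \<Rightarrow> int) \<Rightarrow> real"
  proof -
    have "(\<Sum>r\<in>{..<k} \<rightarrow>\<^sub>E {..<R}. G (\<lambda>i\<in>{..<k}. \<eta> i (r i))) =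
        (\<Sum>x\<in>{..<k} \<rightarrow>\<^sub>E {0..<int R}. (\<Prod>i<k. real (card {s \<in> {..<R}. \<eta> i s = x i})) * G x)"
      using R0 by (intro sum_PiE_by_image) (auto simp: \<eta>_def)
    also have "\<dots> = (\<Sum>x\<in>{..<k} \<rightarrow>\<^sub>E {0..<int R}. (\<Prod>i<k. \<kappa> i (x i)) * G x)"
    proof (intro sum.cong refl arg_cong2[of _ _ _ _ "(*)"] prod.cong)
      fix x i assume "x \<in> {..<k} \<rightarrow>\<^sub>E {0..<int R}" "i \<in> {..<k}"
      then have "x i \<in> {0..<int R}" by (auto simp: PiE_iff)
      then show "real (card {s \<in> {..<R}. \<eta> i s = x i}) = \<kappa> i (x i)"
        by (simp add: \<eta>_def \<kappa>_def mod_eq_iff_dvd)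
    qed
    also have "\<dots> = (\<Sum>o'\<in>{..<k} \<rightarrow>\<^sub>E {0..<?J}. \<Sum>b'\<in>{..<k} \<rightarrow>\<^sub>E {0..<?P}.
        (\<Prod>i<k. \<kappa> i (o' i)) * G (\<lambda>i\<in>{..<k}. o' i + ?J * b' i))"
      unfolding R
      by (subst sum_PiE_mult_split) (auto intro!: sum.cong prod.cong arg_cong2[of _ _ _ _ "(*)"] simp: \<kappa>)
    finally show ?thesis by (simp add: sum_distrib_left)
  qed
  define W where "W = (\<Sum>o'\<in>{..<k} \<rightarrow>\<^sub>E {0..<?J}. \<Prod>i<k. \<kappa> i (o' i))"
  \<comment> \<open>The constant function \<open>1\<close> computes the total weight of the low
    digits.\<close>
  have W: "W * real q ^ (L * k) = real R ^ k"
    using split[of "\<lambda>_. 1"] by (simp add: W_def card_PiE nat_power_eq power_mult sum_distrib_right)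
  have FW: "(\<Sum>r\<in>{..<k} \<rightarrow>\<^sub>E {..<R}. F xl (\<lambda>i\<in>{..<k}. \<eta> i (r i))) \<le> W * E"
    if xl: "xl \<in> {0..<?J}" for xl
    unfolding split W_def sum_distrib_right
  proof (intro sum_mono mult_left_mono)
    fix o' assume o': "o' \<in> {..<k} \<rightarrow>\<^sub>E {0..<?J}"
    have oi: "o' i \<in> {0..<?J}" if "i < k" for i using o' that by (auto simp: PiE_iff)
    define c where "c A = (xl + (\<Sum>i\<in>A. o' i)) div ?J" for A
    have "F xl (\<lambda>i\<in>{..<k}. o' i + ?J * b' i) = carry_norm k L c b'" for b'
      unfolding F_def
    proof (rule carry_norm_cong)
      show "(\<lambda>i\<in>{..<k}. o' i + ?J * b' i) i div ?J = b' i" if "i < k" for i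
        using that oi[OF that] by (simp add: div_pos_pos_trivial)
      fix A assume A: "A \<in> Pow {..<k}"
      have "(\<Sum>i\<in>A. (\<lambda>i\<in>{..<k}. o' i + ?J * b' i) i mod ?J) = (\<Sum>i\<in>A. o' i)"
        using A oi by (intro sum.cong) (auto simp: mod_pos_pos_trivial subset_iff)
      then show "(xl + (\<Sum>i\<in>A. (\<lambda>i\<in>{..<k}. o' i + ?J * b' i) i mod ?J)) div ?J = c A"
        by (simp add: c_def)
    qed
    moreover have "(\<Sum>b'\<in>{..<k} \<rightarrow>\<^sub>E {0..<?P}. carry_norm k L c b') \<le> E"
      unfolding L_def E_def
    proof (rule sum_carry_norm_le[OF k t])
      fix A assume A: "A \<in> Pow {..<k}"
      \<comment> \<open>The incoming carries are themselves carries out of the lowest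
        \<open>j\<close> digits, into which nothing is carried from below.\<close>
      have "carry k j (\<lambda>_. 0) o' xl A \<in> {0..int k}"
        by (rule carry_bounds) (use A o' xl in auto)
      then show "c A \<in> {0..int k}" using A by (simp add: carry_def c_def)
    qed
    ultimately show "(\<Sum>b'\<in>{..<k} \<rightarrow>\<^sub>E {0..<?P}. F xl (\<lambda>i\<in>{..<k}. o' i + ?J * b' i)) \<le> E" by simp
    show "0 \<le> (\<Prod>i<k. \<kappa> i (o' i))"
      unfolding \<kappa>_def by (intro prod_nonneg) simp
  qed
  obtain z where z: "int M dvd z * m - ?J" using m by blast
  note prog = norm_sum_chi_cube_progression_le[OF z[unfolded M_def], folded M_def]
  have "(\<Sum>r\<in>{..<k} \<rightarrow>\<^sub>E {..<R}. norm (\<Sum>n<M. chi (cube k (sd (j + (L + e)))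
      (h r) (\<lambda>_. 0) (int n * m + a)))) \<le>
    (\<Sum>r\<in>{..<k} \<rightarrow>\<^sub>E {..<R}. real q ^ e *
      (\<Sum>xl\<in>{0..<?J}. \<iota> xl * F xl (\<lambda>i\<in>{..<k}. \<eta> i (r i))))"
    unfolding F[symmetric] \<iota>_def by (intro sum_mono prog(1))
  also have "\<dots> = real q ^ e * (\<Sum>xl\<in>{0..<?J}. \<iota> xl *
      (\<Sum>r\<in>{..<k} \<rightarrow>\<^sub>E {..<R}. F xl (\<lambda>i\<in>{..<k}. \<eta> i (r i))))"
    unfolding sum_distrib_left by (rule sum.swap)
  also have "\<dots> \<le> real q ^ e * (\<Sum>xl\<in>{0..<?J}. \<iota> xl * (W * E))"
    by (intro mult_left_mono sum_mono FW) (auto simp: \<iota>_def)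
  also have "\<dots> = real q ^ e * ((\<Sum>xl\<in>{0..<?J}. \<iota> xl) * (W * E))"
    by (simp add: sum_distrib_right)
  also have "\<dots> = real R ^ k * M * (E / real q ^ (L * (k + 1)))"
    unfolding W[symmetric] prog(2)[of a, symmetric] \<iota>_def by (simp add: power_add)
  also have "E / real q ^ (L * (k + 1)) = (1 - 4 / real b^2 / real q ^ ((k + 1) * t)) ^ n"
  proof -
    have "real q ^ (L * (k + 1)) = (real q ^ ((k + 1) * t)) ^ n"
      by (simp add: L_def algebra_simps flip: power_mult)
    moreover have "(real q ^ ((k + 1) * t) - 4 / real b^2) / real q ^ ((k + 1) * t) =
        1 - 4 / real b^2 / real q ^ ((k + 1) * t)"
      by (simp add: diff_divide_distrib)
    ultimately show ?thesis unfolding E_def by (metis power_divide)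
  qed
  finally show ?thesis by (simp add: h_def[abs_def])
qed

section \<open>Removing windows of digits\<close>

definition mean_cube :: "nat \<Rightarrow> nat \<Rightarrow> real \<Rightarrow> int \<Rightarrow> int \<Rightarrow> nat \<Rightarrow> (nat \<Rightarrow> int) \<Rightarrow> (nat \<Rightarrow> int) \<Rightarrow> real" where
  "mean_cube k \<mu> \<xi> m a N u w =
    norm (\<Sum>n<N. chi (cube k (sd \<mu>) u w (int n * m + a)) * unit_exp (real n * \<xi>)) / N"

lemma mean_cube_nonneg: "0 \<le> mean_cube k \<mu> \<xi> m a N u w"
  by (simp add: mean_cube_def)

text \<open>The phase \<open>\<xi>\<close> cancels against its conjugate up to a constant, so the
  new sums have none. Where the shifts \<open>r * v\<close> leave \<open>\<phi>\<close> unchanged at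
  all vertices, at most \<open>2 ^ k\<close> of them, the new difference of \<open>\<phi>\<close>
  vanishes and \<open>sd \<mu>\<close> may be replaced by \<open>sd \<mu>'\<close>; every other
  \<open>n\<close> costs at most \<open>2\<close>.\<close>

lemma mean_cube_step:
  fixes K R N :: nat and m :: int and \<beta> :: real
  assumes N: "0 < N" and R: "0 < R" and \<phi>: "\<And>x. sd \<mu> x = sd \<mu>' x + \<phi> x" and v: "v = int K * m"
    and bad: "\<And>a. real (card {n\<in>{..<N}. \<not> (\<forall>r<R. \<phi> (int n * m + a + int r * v) = \<phi> (int n * m + a))}) \<le> \<beta> * N"
  shows "(mean_cube k \<mu> \<xi> m a N u w)\<^sup>2 \<le>
    (\<Sum>r<R. \<Sum>r'<R. mean_cube (Suc k) \<mu>' 0 m a N (u(k := int r * v)) (w(k := int r' * v))) / real R ^ 2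
      + (2 * 2 ^ k * \<beta> + 4 * (real R * K / N))"
proof -
  define g where "g n = chi (cube k (sd \<mu>) u w (int n * m + a)) * unit_exp (real n * \<xi>)" for n
  define ok where "ok x \<longleftrightarrow> (\<forall>r<R. \<phi> (x + int r * v) = \<phi> x)" for x
  define bd where "bd = {n\<in>{..<N}. \<not> (\<forall>z\<in>shifts k u w. ok (int n * m + a + z))}"
  \<comment> \<open>The assumption \<open>bad\<close> is uniform in \<open>a\<close>, so translation
    by \<open>z\<close> is absorbed into \<open>a\<close>.\<close>
  have "bd \<subseteq> (\<Union>z\<in>shifts k u w. {n\<in>{..<N}. \<not> ok (int n * m + (a + z))})"
    by (auto simp: bd_def add.assoc)
  then have "card bd \<le> card (\<Union>z\<in>shifts k u w. {n\<in>{..<N}. \<not> ok (int n * m + (a + z))})"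
    using card_shifts_le by (intro card_mono) auto
  also have "\<dots> \<le> (\<Sum>z\<in>shifts k u w. card {n\<in>{..<N}. \<not> ok (int n * m + (a + z))})"
    using card_shifts_le by (intro card_UN_le) auto
  finally have "real (card bd) \<le> (\<Sum>z\<in>shifts k u w. real (card {n\<in>{..<N}. \<not> ok (int n * m + (a + z))}))"
    by (simp flip: of_nat_sum)
  also have "\<dots> \<le> (\<Sum>z\<in>shifts k u w. \<beta> * N)"
    unfolding ok_def by (intro sum_mono bad)
  also have "\<dots> \<le> 2 ^ k * (\<beta> * N)"
  proof -
    have "0 \<le> \<beta> * N" using bad[of 0] by (meson of_nat_0_le_iff order_trans)
    moreover have "real (card (shifts k u w)) \<le> 2 ^ k"
      using card_shifts_le[of k u w] by (metis of_nat_le_iff of_nat_numeral of_nat_power)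
    ultimately show ?thesis by (simp add: mult_right_mono)
  qed
  finally have bd: "real (card bd) \<le> 2 ^ k * (\<beta> * N)" .
  have term_le: "norm (\<Sum>n<N. g (n + r * K) * cnj (g (n + r' * K))) \<le>
      N * mean_cube (Suc k) \<mu>' 0 m a N (u(k := int r * v)) (w(k := int r' * v)) + 2 * (2 ^ k * (\<beta> * N))"
    if r: "r < R" "r' < R" for r r'
  proof -
    define u' where "u' = u(k := int r * v)"
    define w' where "w' = w(k := int r' * v)"
    define D where "D f n = cube (Suc k) f u' w' (int n * m + a)" for f and n :: nat
    have Dk: "D f n = cube k f u w (int n * m + a + int r * v) - cube k f u w (int n * m + a + int r' * v)" for f n
    proof -
      have "cube k f u' w' y = cube k f u w y" for y
        by (rule cube_cong) (auto simp: u'_def w'_def)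
      then show ?thesis by (simp add: D_def) (simp add: u'_def w'_def)
    qed
    have "g (n + r * K) * cnj (g (n + r' * K)) =
        chi (D (sd \<mu>) n) * (unit_exp (real (r * K) * \<xi>) * cnj (unit_exp (real (r' * K) * \<xi>)))" for n
    proof -
      have e1: "int (n + s * K) * m + a = int n * m + a + int s * v" for s
        by (simp add: v algebra_simps)
      have e2: "unit_exp (real (n + s * K) * \<xi>) = unit_exp (real n * \<xi>) * unit_exp (real (s * K) * \<xi>)" for s
        by (simp add: distrib_right unit_exp_add)
      have "g (n + r * K) * cnj (g (n + r' * K)) =
          (chi (cube k (sd \<mu>) u w (int n * m + a + int r * v)) *
            cnj (chi (cube k (sd \<mu>) u w (int n * m + a + int r' * v)))) *
          ((unit_exp (real n * \<xi>) * cnj (unit_exp (real n * \<xi>))) *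
           (unit_exp (real (r * K) * \<xi>) * cnj (unit_exp (real (r' * K) * \<xi>))))"
        unfolding g_def e1 e2 complex_cnj_mult by (simp only: mult_ac)
      then show ?thesis by (simp only: unit_exp_mult_cnj Dk chi_diff mult_1)
    qed
    then have "norm (\<Sum>n<N. g (n + r * K) * cnj (g (n + r' * K))) = norm (\<Sum>n<N. chi (D (sd \<mu>) n))"
      by (simp add: norm_mult flip: sum_distrib_right)
    also have "\<dots> \<le> norm (\<Sum>n<N. chi (D (sd \<mu>') n)) + norm (\<Sum>n<N. chi (D (sd \<mu>) n) - chi (D (sd \<mu>') n))"
      using norm_triangle_ineq[of "\<Sum>n<N. chi (D (sd \<mu>') n)" "\<Sum>n<N. chi (D (sd \<mu>) n) - chi (D (sd \<mu>') n)"]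
      by (simp add: sum_subtractf)
    also have "norm (\<Sum>n<N. chi (D (sd \<mu>') n)) = N * mean_cube (Suc k) \<mu>' 0 m a N u' w'"
      using N by (simp add: mean_cube_def D_def del: cube.simps)
    also have "norm (\<Sum>n<N. chi (D (sd \<mu>) n) - chi (D (sd \<mu>') n)) \<le> (\<Sum>n<N. if n \<in> bd then 2 else 0)"
    proof (rule sum_norm_le)
      fix n assume n: "n \<in> {..<N}"
      show "norm (chi (D (sd \<mu>) n) - chi (D (sd \<mu>') n)) \<le> (if n \<in> bd then 2 else 0)"
      proof (cases "n \<in> bd")
        case True
        then show ?thesis using norm_triangle_ineq4[of "chi (D (sd \<mu>) n)" "chi (D (sd \<mu>') n)"] by simp
      next
        case False
        have "cube k \<phi> u w (int n * m + a + int s * v) = cube k \<phi> u w (int n * m + a)" if "s < R" for s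
          unfolding cube_shift[of k \<phi> u w "int n * m + a" "int s * v"] using False n that
          by (intro cube_cong_shifts) (auto simp: bd_def ok_def)
        then have "D \<phi> n = 0" using r by (simp add: Dk)
        moreover have "sd \<mu> = (\<lambda>x. sd \<mu>' x + \<phi> x)" using \<phi> by auto
        ultimately have "D (sd \<mu>) n = D (sd \<mu>') n" unfolding D_def by (simp only: cube_add)
        then show ?thesis using False by simp
      qed
    qed
    also have "(\<Sum>n<N. if n \<in> bd then 2 else 0::real) = 2 * card bd"
      by (simp add: sum.If_cases bd_def Int_def conj_commute)
    finally show ?thesis using bd unfolding u'_def w'_def by linarith
  qed
  define V where "V = (\<Sum>r<R. \<Sum>r'<R. norm (\<Sum>n<N. g (n + r * K) * cnj (g (n + r' * K))))"
  define Q where "Q = (\<Sum>r<R. \<Sum>r'<R. mean_cube (Suc k) \<mu>' 0 m a N (u(k := int r * v)) (w(k := int r' * v)))"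
  have "V \<le> (\<Sum>r<R. \<Sum>r'<R. N * mean_cube (Suc k) \<mu>' 0 m a N (u(k := int r * v)) (w(k := int r' * v)) +
      2 * (2 ^ k * (\<beta> * N)))"
    unfolding V_def by (intro sum_mono term_le) auto
  also have "\<dots> = N * Q + real R ^ 2 * (2 * (2 ^ k * (\<beta> * N)))"
    unfolding Q_def by (simp add: sum.distrib sum_distrib_left power2_eq_square)
  finally have "V / (real R ^ 2 * N) \<le> (N * Q + real R ^ 2 * (2 * (2 ^ k * (\<beta> * N)))) / (real R ^ 2 * N)"
    using N R by (intro divide_right_mono) auto
  also have "\<dots> = Q / real R ^ 2 + 2 * 2 ^ k * \<beta>"
    using N R by (simp add: field_simps)
  finally have "V / (real R ^ 2 * N) \<le> Q / real R ^ 2 + 2 * 2 ^ k * \<beta>" .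
  moreover have "(mean_cube k \<mu> \<xi> m a N u w)\<^sup>2 \<le> V / (real R ^ 2 * N) + 4 * (real R * K / N)"
    using van_der_Corput[OF _ N R, of g K] by (simp add: V_def mean_cube_def g_def norm_mult)
  ultimately show ?thesis by (simp add: Q_def)
qed

end

context digit_phase
begin

text \<open>The quantity iterated is the average \<open>A i\<close> over all shifts
  \<open>r\<close>, \<open>r'\<close> chosen so far. Cauchy-Schwarz moves the square inside this
  average, and \<open>mean_cube_step\<close> applies to each term.\<close>

lemma iterated_mean_cube_le:
  fixes K \<mu> :: "nat \<Rightarrow> nat" and m a :: int and \<beta> \<tau> :: real and N R k :: nat
  defines "v \<equiv> \<lambda>i. int (K i) * m"
  defines "P \<equiv> \<lambda>i. {..<i} \<rightarrow>\<^sub>E {..<R}"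
  assumes N: "0 < N" and R: "0 < R" and k: "1 \<le> k" and \<tau>: "0 \<le> \<tau>" "\<tau> \<le> 1"
    and step: "\<And>i. i < k \<Longrightarrow> \<exists>\<phi>. (\<forall>x. sd (\<mu> i) x = sd (\<mu> (Suc i)) x + \<phi> x) \<and>
      (\<forall>a. real (card {n\<in>{..<N}. \<not> (\<forall>r<R. \<phi> (int n * m + a + int r * v i) = \<phi> (int n * m + a))}) \<le> \<beta> * N)"
    and err: "\<And>i. i < k \<Longrightarrow> 2 * 2 ^ i * \<beta> + 4 * (real R * K i / N) \<le> \<tau>"
  shows "(mean_cube 0 (\<mu> 0) \<xi> m a N u w / 2) ^ 2 ^ k \<le>
    (\<Sum>r\<in>P k. \<Sum>r'\<in>P k. mean_cube k (\<mu> k) 0 m a N (\<lambda>j. int (r j) * v j) (\<lambda>j. int (r' j) * v j)) /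
      (real R ^ k)\<^sup>2 + \<tau>"
proof -
  \<comment> \<open>Only the sum before the first step carries the linear phase.\<close>
  define \<xi>' where "\<xi>' i = (if i = 0 then \<xi> else 0)" for i :: nat
  define T where "T i r r' = mean_cube i (\<mu> i) (\<xi>' i) m a N (\<lambda>j. int (r j) * v j) (\<lambda>j. int (r' j) * v j)"
    for i and r r' :: "nat \<Rightarrow> nat"
  define A where "A i = (\<Sum>r\<in>P i. \<Sum>r'\<in>P i. T i r r') / (real R ^ i)\<^sup>2" for i
  have finP: "finite (P i)" and cardP: "card (P i) = R ^ i" for i
    by (auto simp: P_def card_PiE intro!: finite_PiE)
  have A: "A i = (\<Sum>p\<in>P i \<times> P i. T i (fst p) (snd p)) / card (P i \<times> P i)" for i
    by (simp add: A_def sum.cartesian_product case_prod_unfold cardP card_cartesian_product power2_eq_square)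
  have A2: "(A i)\<^sup>2 \<le> (\<Sum>r\<in>P i. \<Sum>r'\<in>P i. (T i r r')\<^sup>2) / (real R ^ i)\<^sup>2" for i
  proof -
    have "P i \<noteq> {}" using cardP[of i] R by auto
    then have "(A i)\<^sup>2 \<le> (\<Sum>p\<in>P i \<times> P i. (T i (fst p) (snd p))\<^sup>2) / card (P i \<times> P i)"
      unfolding A using finP by (intro power2_mean_le) auto
    then show ?thesis
      by (simp add: sum.cartesian_product case_prod_unfold cardP card_cartesian_product power2_eq_square)
  qed
  have stepA: "(A i)\<^sup>2 \<le> A (Suc i) + \<tau>" if i: "i < k" for i
  proof -
    obtain \<phi> where \<phi>: "\<And>x. sd (\<mu> i) x = sd (\<mu> (Suc i)) x + \<phi> x"
      "\<And>a. real (card {n\<in>{..<N}. \<not> (\<forall>r<R. \<phi> (int n * m + a + int r * v i) = \<phi> (int n * m + a))}) \<le> \<beta> * N"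
      using step[OF i] by blast
    have T2: "(T i r r')\<^sup>2 \<le> (\<Sum>x<R. \<Sum>y<R. T (Suc i) (r(i := x)) (r'(i := y))) / real R ^ 2 + \<tau>" for r r'
    proof -
      have upd: "(\<lambda>j. int (r j) * v j)(i := int x * v i) = (\<lambda>j. int ((r(i := x)) j) * v j)" for x and r :: "nat \<Rightarrow> nat"
        by auto
      have "(T i r r')\<^sup>2 \<le> (\<Sum>x<R. \<Sum>y<R. T (Suc i) (r(i := x)) (r'(i := y))) / real R ^ 2 +
          (2 * 2 ^ i * \<beta> + 4 * (real R * K i / N))"
        using mean_cube_step[OF N R \<phi>(1) _ \<phi>(2), of "K i" i "\<xi>' i" a "\<lambda>j. int (r j) * v j" "\<lambda>j. int (r' j) * v j"]
        unfolding upd T_def by (simp add: v_def \<xi>'_def)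
      then show ?thesis using err[OF i] by linarith
    qed
    have "(\<Sum>r\<in>P i. \<Sum>r'\<in>P i. (T i r r')\<^sup>2) \<le>
        (\<Sum>r\<in>P i. \<Sum>r'\<in>P i. (\<Sum>x<R. \<Sum>y<R. T (Suc i) (r(i := x)) (r'(i := y))) / real R ^ 2 + \<tau>)"
      by (intro sum_mono T2)
    also have "\<dots> = (\<Sum>r\<in>P i. \<Sum>r'\<in>P i. \<Sum>x<R. \<Sum>y<R. T (Suc i) (r(i := x)) (r'(i := y))) / real R ^ 2 +
        (real R ^ i)\<^sup>2 * \<tau>"
      by (simp add: sum.distrib sum_divide_distrib cardP power2_eq_square)
    also have "(\<Sum>r\<in>P i. \<Sum>r'\<in>P i. \<Sum>x<R. \<Sum>y<R. T (Suc i) (r(i := x)) (r'(i := y))) =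
        (\<Sum>r\<in>P (Suc i). \<Sum>r'\<in>P (Suc i). T (Suc i) r r')"
    proof -
      have "(\<Sum>r'\<in>P i. \<Sum>x<R. \<Sum>y<R. T (Suc i) (r(i := x)) (r'(i := y))) =
          (\<Sum>x<R. \<Sum>r'\<in>P i. \<Sum>y<R. T (Suc i) (r(i := x)) (r'(i := y)))" for r
        by (rule sum.swap)
      then show ?thesis by (simp add: P_def sum_PiE_Suc)
    qed
    also have "\<dots> = A (Suc i) * (real R ^ Suc i)\<^sup>2"
      using R by (simp add: A_def)
    finally have "(\<Sum>r\<in>P i. \<Sum>r'\<in>P i. (T i r r')\<^sup>2) \<le> (A (Suc i) + \<tau>) * (real R ^ i)\<^sup>2"
      using R by (simp add: power_mult_distrib field_simps)
    then have "(\<Sum>r\<in>P i. \<Sum>r'\<in>P i. (T i r r')\<^sup>2) / (real R ^ i)\<^sup>2 \<le> A (Suc i) + \<tau>"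
      using R by (simp add: pos_divide_le_eq)
    then show ?thesis using A2[of i] by linarith
  qed
  have "0 \<le> A i" for i
    unfolding A_def T_def by (intro divide_nonneg_nonneg sum_nonneg mean_cube_nonneg) simp
  then have "(A 0 / 2) ^ 2 ^ k \<le> A k + \<tau>"
    by (intro iterated_square_bound \<tau> stepA)
  moreover have "A 0 = mean_cube 0 (\<mu> 0) \<xi> m a N u w"
    by (simp add: A_def P_def T_def \<xi>'_def mean_cube_def)
  ultimately show ?thesis using k by (simp add: A_def T_def \<xi>'_def)
qed

lemma sd_split:
  assumes "\<mu>' \<le> \<mu>"
  shows "sd \<mu> x = sd \<mu>' x + sd (\<mu> - \<mu>') (x div int q ^ \<mu>')"
  using assms sd_add[of \<mu>' "\<mu> - \<mu>'" x] by simp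

text \<open>The part \<open>s0 * q ^ \<mu>\<close> of \<open>v\<close> acts only above the window.
  The part \<open>r * y\<close> can alter the window only by pushing \<open>x\<close> across a
  multiple of \<open>q ^ \<mu>'\<close>, that is, if \<open>x\<close> is within \<open>Z\<close> of
  one. For two such \<open>n\<close> with difference \<open>g\<close>, the number
  \<open>g * m\<close> is within \<open>2 * Z\<close> of a multiple, and \<open>gap\<close> rules
  out the differences from \<open>A\<close> to \<open>B - 1\<close>.\<close>

lemma window_bad_count:
  fixes m a y s0 :: int and N R A B Z \<mu> \<mu>' :: nat
  defines "\<phi> \<equiv> \<lambda>x. sd (\<mu> - \<mu>') (x div int q ^ \<mu>')"
  assumes \<mu>: "\<mu>' \<le> \<mu>" and v: "v = s0 * int q ^ \<mu> + y" and y: "int R * \<bar>y\<bar> \<le> int Z"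
    and A: "1 \<le> A" and B: "1 \<le> B"
    and gap: "\<And>g s. A \<le> g \<Longrightarrow> g < B \<Longrightarrow> \<bar>int g * m - s * int q ^ \<mu>'\<bar> > 2 * int Z"
  shows "card {n\<in>{..<N}. \<not> (\<forall>r<R. \<phi> (int n * m + a + int r * v) = \<phi> (int n * m + a))} \<le> A * (N div B + 1)"
proof -
  let ?M = "int q ^ \<mu>'"
  have ok: "\<phi> (x + int r * v) = \<phi> x" if r: "r < R" and x: "int Z \<le> x mod ?M" "x mod ?M < ?M - int Z" for x r
  proof -
    have "int r * \<bar>y\<bar> \<le> int R * \<bar>y\<bar>" using r by (intro mult_right_mono) auto
    then have ry: "\<bar>int r * y\<bar> \<le> int Z" using y by (simp add: abs_mult)
    have "x + int r * v = (x mod ?M + int r * y) + ?M * (x div ?M + int q ^ (\<mu> - \<mu>') * (int r * s0))"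
    proof -
      have "int q ^ \<mu> = ?M * int q ^ (\<mu> - \<mu>')" using \<mu> by (simp flip: power_add)
      moreover have "x = x mod ?M + ?M * (x div ?M)" by simp
      ultimately show ?thesis unfolding v by (simp add: algebra_simps)
    qed
    moreover have "(x mod ?M + int r * y) div ?M = 0"
      using ry x by (intro div_pos_pos_trivial) (auto simp: abs_le_iff)
    ultimately have "(x + int r * v) div ?M = x div ?M + int q ^ (\<mu> - \<mu>') * (int r * s0)"
      by (simp only: div_mult_self2) simp
    then show ?thesis by (simp add: \<phi>_def)
  qed
  have near: "\<exists>s. \<bar>x - s * ?M\<bar> \<le> int Z" if "\<not> (\<forall>r<R. \<phi> (x + int r * v) = \<phi> x)" for x
  proof -
    have xx: "x = x div ?M * ?M + x mod ?M" by (rule div_mult_mod_eq[symmetric])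
    have "x mod ?M < int Z \<or> ?M - int Z \<le> x mod ?M" using that ok[of _ x] by force
    then show ?thesis
    proof
      assume "x mod ?M < int Z"
      moreover have "0 \<le> x mod ?M" by simp
      ultimately have "\<bar>x - x div ?M * ?M\<bar> \<le> int Z" using xx by linarith
      then show ?thesis by blast
    next
      assume "?M - int Z \<le> x mod ?M"
      moreover have "x mod ?M < ?M" by simp
      moreover have "(x div ?M + 1) * ?M = x div ?M * ?M + ?M" by (simp add: algebra_simps)
      ultimately have "\<bar>x - (x div ?M + 1) * ?M\<bar> \<le> int Z" using xx by linarith
      then show ?thesis by blast
    qed
  qed
  show "card {n\<in>{..<N}. \<not> (\<forall>r<R. \<phi> (int n * m + a + int r * v) = \<phi> (int n * m + a))} \<le> A * (N div B + 1)"
  proof (rule card_gap_le[OF _ B _ A])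
    fix n n' assume n: "n \<in> {n\<in>{..<N}. \<not> (\<forall>r<R. \<phi> (int n * m + a + int r * v) = \<phi> (int n * m + a))}"
      and n': "n' \<in> {n\<in>{..<N}. \<not> (\<forall>r<R. \<phi> (int n * m + a + int r * v) = \<phi> (int n * m + a))}"
      and lt: "n < n'" "n' - n < B"
    obtain s s' where s: "\<bar>int n * m + a - s * ?M\<bar> \<le> int Z" "\<bar>int n' * m + a - s' * ?M\<bar> \<le> int Z"
      using near n n' by blast
    have "int (n' - n) * m - (s' - s) * ?M = (int n' * m + a - s' * ?M) - (int n * m + a - s * ?M)"
      using lt by (simp add: of_nat_diff algebra_simps)
    then have "\<bar>int (n' - n) * m - (s' - s) * ?M\<bar> \<le> 2 * int Z" using s by linarith
    then show "n' - n < A" using gap[of "n' - n" "s' - s"] lt by (meson not_le)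
  qed auto
qed

end

section \<open>The bound for a good modulus\<close>

text \<open>For each prime \<open>p\<close> dividing \<open>q\<close> the exponent of
  \<open>p\<close> in \<open>K * m\<close> is at most \<open>2 * s\<close>, and
  \<open>q ^ (2 * s)\<close> contains \<open>p\<close> at least that often.\<close>

lemma gcd_power_dvd:
  fixes K m q s e :: nat
  assumes "0 < K" "0 < m" "0 < q"
    and "\<And>p. prime p \<Longrightarrow> p dvd q \<Longrightarrow> \<not> p ^ Suc s dvd m"
    and "\<And>p. prime p \<Longrightarrow> p dvd q \<Longrightarrow> \<not> p ^ Suc s dvd K"
  shows "gcd (K * m) (q ^ e) dvd q ^ (2 * s)"
proof (rule multiplicity_le_imp_dvd)
  fix p :: nat assume p: "prime p"
  let ?g = "gcd (K * m) (q ^ e)"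
  show "multiplicity p ?g \<le> multiplicity p (q ^ (2 * s))"
  proof (cases "p dvd q")
    case True
    have "multiplicity p ?g \<le> multiplicity p (K * m)"
      using assms by (intro dvd_imp_multiplicity_le) auto
    also have "\<dots> = multiplicity p K + multiplicity p m"
      using assms p by (intro prime_elem_multiplicity_mult_distrib) auto
    also have "\<dots> \<le> s + s"
      using assms(4,5)[OF p True] assms(1,2) p
      by (intro add_mono) (metis not_less_eq_eq multiplicity_dvd' not_less)+
    also have "\<dots> \<le> 2 * s * multiplicity p q"
    proof -
      have "1 \<le> multiplicity p q"
        using True assms p by (simp add: prime_multiplicity_gt_zero_iff Suc_le_eq)
      then have "2 * s * 1 \<le> 2 * s * multiplicity p q" by (intro mult_left_mono) auto
      then show ?thesis by (simp only: mult_2 mult_1_right)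
    qed
    also have "\<dots> = multiplicity p (q ^ (2 * s))"
      using assms p by (simp add: prime_elem_multiplicity_power_distrib)
    finally show ?thesis .
  next
    case False
    then have "\<not> p dvd ?g" using p by (auto dest: prime_dvd_power)
    then show ?thesis by (simp add: not_dvd_imp_multiplicity_0)
  qed
qed (use assms in auto)

lemma sum_periodic:
  fixes f :: "nat \<Rightarrow> 'a::comm_semiring_1"
  assumes "\<And>n. f (n + M) = f n"
  shows "(\<Sum>n<C * M. f n) = of_nat C * (\<Sum>n<M. f n)"
proof -
  have shift: "f (c * M + n) = f n" for c n
    by (induction c) (use assms in \<open>simp_all add: add_ac\<close>, metis add.assoc add.commute assms)
  have "(\<Sum>n<C * M. f n) = (\<Sum>c<C. \<Sum>n\<in>{c * M..<c * M + M}. f n)"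
    by (rule sum.nat_group[symmetric])
  also have "\<dots> = (\<Sum>c<C. \<Sum>n<M. f n)"
  proof (rule sum.cong[OF refl])
    fix c
    have "(\<Sum>n\<in>{c * M..<c * M + M}. f n) = (\<Sum>n<M. f (n + c * M))"
      using sum.shift_bounds_nat_ivl[of f 0 "c * M" M] by (simp add: lessThan_atLeast0 add.commute)
    then show "(\<Sum>n\<in>{c * M..<c * M + M}. f n) = (\<Sum>n<M. f n)"
      using shift[of c] by (simp add: add.commute)
  qed
  finally show ?thesis by simp
qed

lemma Dirichlet_approx_int:
  fixes m Q M :: nat
  assumes "0 < Q" "0 < M" "Q * Y = M"
  obtains K h where "1 \<le> K" "K \<le> Q" "\<bar>int K * int m - h * int M\<bar> \<le> int Y"
proof -
  obtain h k where hk: "0 < k" "k \<le> int Q" "\<bar>of_int k * (real m / M) - of_int h\<bar> < 1 / Q"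
    using Dirichlet_approx[OF assms(1), of "real m / M"] by metis
  have "\<bar>of_int (k * int m - h * int M) / real M\<bar> < 1 / Q"
    using hk(3) assms(2) by (simp add: diff_divide_distrib)
  then have "\<bar>of_int (k * int m - h * int M)\<bar> < real M / Q"
    using assms(2) by (simp add: field_simps)
  also have "\<dots> = real Y" using assms by auto
  finally have "\<bar>k * int m - h * int M\<bar> < int Y" by linarith
  then show ?thesis using hk by (intro that[of "nat k" h]) auto
qed

context digit_phase
begin

lemma sd_eq_digit_sum:
  assumes "x < \<Lambda>"
  shows "sd \<Lambda> (int x) = int (digit_sum q x)"
proof -
  have "int (digit_sum q x) = (\<Sum>i\<le>x. int (base_digit q x i))" by (simp add: digit_sum_def)
  also have "\<dots> = (\<Sum>i<\<Lambda>. int (base_digit q x i))"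
    using assms by (intro sum.mono_neutral_left) (auto simp: not_le base_digit_eq_0[OF q2 less_imp_le])
  also have "\<dots> = sd \<Lambda> (int x)"
    by (simp add: sd_def base_digit_def zdiv_int zmod_int)
  finally show ?thesis ..
qed

text \<open>The upper ends of the windows are the levels \<open>(c + 1) * \<sigma> + 20 * s\<close>. The conditions ensure that
  \<open>m\<close> and the Dirichlet denominators \<open>K \<le> q ^ (\<sigma> + 10 * s)\<close> share only small factors with \<open>q\<close>, so that
  the multiples of \<open>K * m\<close> cover all residues divisible by \<open>q ^ (2 * s)\<close>, and that the multiples of
  \<open>m\<close> are well spaced modulo the lower end of each window.\<close>
definition good :: "nat \<Rightarrow> nat \<Rightarrow> nat \<Rightarrow> nat \<Rightarrow> bool" where
  "good k s \<sigma> m \<longleftrightarrow>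
    (\<forall>p. prime p \<longrightarrow> p dvd q \<longrightarrow> \<not> p ^ Suc s dvd m) \<and>
    (\<forall>c\<in>{1..<k}.
      (\<forall>p. prime p \<longrightarrow> p dvd q \<longrightarrow> (\<forall>K\<in>{1..q ^ (\<sigma> + 10 * s)}. p ^ Suc s dvd K \<longrightarrow>
        \<not> (\<exists>h. \<bar>int K * int m - h * int q ^ (c * \<sigma> + \<sigma> + 20 * s)\<bar> \<le> int (q ^ (c * \<sigma> + 10 * s))))) \<and>
      (\<forall>g\<in>{1..q ^ s}. \<not> (\<exists>h. \<bar>int g * int m - h * int q ^ (c * \<sigma> + 20 * s)\<bar> \<le> int (q ^ (c * \<sigma> + 14 * s)))))"

text \<open>The exponents fit as follows. \<open>R = q ^ (3 * s)\<close> leaves \<open>2 * s\<close>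
  frozen and \<open>s\<close> uniform digits in the sides. Relative to
  \<open>q ^ (c * \<sigma>)\<close>, the Dirichlet remainder \<open>q ^ (10 * s)\<close> times
  \<open>R\<close> is \<open>q ^ (13 * s)\<close>, below the spacing \<open>q ^ (14 * s)\<close>.
  Denominators up to \<open>q ^ (40 * s)\<close> keep \<open>R * K\<close> far below
  \<open>N\<close>.\<close>

lemma good_bound:
  fixes k t1 J t n \<sigma> D m a :: nat and \<xi> :: real
  assumes k: "1 \<le> k" "k < q ^ t1" "k \<le> q ^ J" and t: "t = t1 + (J + 2)"
  defines "s \<equiv> t * n"
  defines "N \<equiv> q ^ (50 * s)" and "\<tau> \<equiv> 2 ^ (k + 3) / real q ^ s"
  assumes s: "2 \<le> s" and \<tau>: "\<tau> \<le> 1"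
    and m: "good k s \<sigma> m" "D \<le> m" "m < q * D" and D: "D * q ^ (5 * s) \<le> q ^ (k * \<sigma> + 20 * s)"
    and \<sigma>: "\<sigma> \<le> 30 * s"
  shows "(norm (\<Sum>n<N. chi (int (digit_sum q (n * m + a))) * unit_exp (real n * \<xi>)) / N / 2) ^ 2 ^ k \<le>
    (1 - 4 / real b^2 / real q ^ ((k + 1) * t)) ^ n + \<tau>"
proof -
  define R where "R = q ^ (3 * s)"
  \<comment> \<open>Larger than \<open>n * m + a\<close> for all \<open>n < N\<close>, so that
    \<open>sd \<Lambda>\<close> is the full digit sum there.\<close>
  define \<Lambda> where "\<Lambda> = k * \<sigma> + 20 * s + Suc (N * m + a)"
  \<comment> \<open>\<open>\<mu> 1 = k * \<sigma> + 20 * s\<close> and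
    \<open>\<mu> k = \<sigma> + 20 * s\<close>; each step in between lowers the level by
    \<open>\<sigma>\<close>.\<close>
  define \<mu> where "\<mu> i = (if i = 0 then \<Lambda> else (k - i) * \<sigma> + \<sigma> + 20 * s)" for i
  define \<gamma> where "\<gamma> = 1 - 4 / real b^2 / real q ^ ((k + 1) * t)"
  have N0: "0 < N" and R0: "0 < R" by (simp_all add: N_def R_def)
  have m0: "0 < m" using m by (cases "D = 0") auto
  have qs: "4 \<le> q ^ s"
  proof -
    have "(2::nat) ^ 2 \<le> 2 ^ s" using s by (intro power_increasing) auto
    also have "\<dots> \<le> q ^ s" using q2 by (intro power_mono) auto
    finally show ?thesis by simp
  qed
  have G1: "\<not> p ^ Suc s dvd m" if "prime p" "p dvd q" for p
    using m that by (auto simp: good_def)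
  have "\<exists>K y h. 1 \<le> K \<and> K \<le> q ^ (\<sigma> + 10 * s) \<and> int K * int m = h * int q ^ \<mu> i + y \<and>
      \<bar>y\<bar> \<le> int (q ^ ((k - i) * \<sigma> + 10 * s))" if i: "i \<in> {1..<k}" for i
  proof -
    have "q ^ (\<sigma> + 10 * s) * q ^ ((k - i) * \<sigma> + 10 * s) = q ^ \<mu> i"
      using i by (simp add: \<mu>_def ac_simps flip: power_add)
    then obtain K h where "1 \<le> K" "K \<le> q ^ (\<sigma> + 10 * s)"
      "\<bar>int K * int m - h * int (q ^ \<mu> i)\<bar> \<le> int (q ^ ((k - i) * \<sigma> + 10 * s))"
      by (rule Dirichlet_approx_int[rotated 2, where m = m]) auto
    then show ?thesis
      by (intro exI[of _ K] exI[of _ "int K * int m - h * int (q ^ \<mu> i)"] exI[of _ h]) auto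
  qed
  then obtain K' where K': "\<And>i. i \<in> {1..<k} \<Longrightarrow> 1 \<le> K' i \<and> K' i \<le> q ^ (\<sigma> + 10 * s) \<and>
      (\<exists>y h. int (K' i) * int m = h * int q ^ \<mu> i + y \<and> \<bar>y\<bar> \<le> int (q ^ ((k - i) * \<sigma> + 10 * s)))"
    by metis
  define K where "K i = (if i = 0 then 1 else K' i)" for i
  define v where "v i = int (K i) * int m" for i
  have K_good: "1 \<le> K i \<and> (\<forall>p. prime p \<longrightarrow> p dvd q \<longrightarrow> \<not> p ^ Suc s dvd K i)" if i: "i < k" for i
  proof (cases "i = 0")
    case True
    then show ?thesis by (auto simp: K_def dest: not_prime_unit)
  next
    case False
    then have i1: "i \<in> {1..<k}" and c1: "k - i \<in> {1..<k}" using i by auto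
    from K'[OF i1] obtain y h where y: "1 \<le> K' i" "K' i \<le> q ^ (\<sigma> + 10 * s)"
      "int (K' i) * int m = h * int q ^ \<mu> i + y" "\<bar>y\<bar> \<le> int (q ^ ((k - i) * \<sigma> + 10 * s))" by blast
    then have "\<exists>h. \<bar>int (K' i) * int m - h * int q ^ ((k - i) * \<sigma> + \<sigma> + 20 * s)\<bar> \<le> int (q ^ ((k - i) * \<sigma> + 10 * s))"
      using False by (intro exI[of _ h]) (simp add: \<mu>_def)
    moreover have "K' i \<in> {1..q ^ (\<sigma> + 10 * s)}" using y by simp
    ultimately have "\<not> p ^ Suc s dvd K' i" if "prime p" "p dvd q" for p
      using m(1) c1 that unfolding good_def by blast
    then show ?thesis using y(1) False by (simp add: K_def)
  qed
  have solve: "\<exists>z. int (q ^ e) dvd z * (int L * int m) - int q ^ (2 * s)"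
    if "1 \<le> L" "\<forall>p. prime p \<longrightarrow> p dvd q \<longrightarrow> \<not> p ^ Suc s dvd L" for L e
  proof -
    have "gcd (L * m) (q ^ e) dvd q ^ (2 * s)"
      using that m0 G1 by (intro gcd_power_dvd) auto
    then have "int (gcd (L * m) (q ^ e)) dvd int (q ^ (2 * s))" by (simp only: of_nat_dvd_iff)
    then have "gcd (int L * int m) (int (q ^ e)) dvd int q ^ (2 * s)"
      by (simp flip: gcd_int_int_eq)
    then obtain z where "[int L * int m * z = int q ^ (2 * s)] (mod int (q ^ e))"
      using cong_solve_dvd_int by blast
    then show ?thesis by (intro exI[of _ z]) (simp add: cong_iff_dvd_diff mult.commute)
  qed
  have step: "\<exists>\<phi>. (\<forall>x. sd (\<mu> i) x = sd (\<mu> (Suc i)) x + \<phi> x) \<and>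
      (\<forall>a. real (card {n\<in>{..<N}. \<not> (\<forall>r<R. \<phi> (int n * int m + a + int r * v i) = \<phi> (int n * int m + a))}) \<le>
        6 / real q ^ s * N)" if i: "i < k" for i
  proof (cases "i = 0")
    case True
    define lam where "lam = k * \<sigma> + 20 * s"
    have \<mu>1: "\<mu> (Suc i) = lam"
      using True k by (cases k) (auto simp: \<mu>_def lam_def)
    \<comment> \<open>Multiples with \<open>h \<le> 0\<close> are far from \<open>g * m\<close>
      because \<open>g > 2 * R\<close>; those with \<open>h \<ge> 1\<close> because
      \<open>(g + 2 * R) * m < q ^ lam\<close>, by the upper bound on \<open>D\<close>.\<close>
    have gap: "\<bar>int g * int m - h * int q ^ lam\<bar> > 2 * int (R * m)"
      if g: "2 * R + 1 \<le> g" "g < q ^ (4 * s)" for g h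
    proof (cases "h \<le> 0")
      case True
      then have "h * int q ^ lam \<le> 0" by (simp add: mult_le_0_iff)
      moreover have "2 * int (R * m) < int g * int m"
      proof -
        have "(2 * R) * m < g * m" using g m0 by (intro mult_strict_right_mono) auto
        then have "int ((2 * R) * m) < int (g * m)" by (simp only: of_nat_less_iff)
        then show ?thesis by simp
      qed
      ultimately show ?thesis by linarith
    next
      case False
      have "q * (g + 2 * R) \<le> q * (q ^ (4 * s) + q ^ (4 * s))"
      proof -
        have "2 * R \<le> q ^ s * R" using qs by (intro mult_right_mono) auto
        also have "\<dots> = q ^ (4 * s)" by (simp add: R_def flip: power_add)
        finally show ?thesis using g by (intro mult_left_mono add_mono) auto
      qed
      also have "\<dots> \<le> q * (q * q ^ (4 * s))"
        using q2 by (intro mult_left_mono) (auto simp: mult_2[symmetric] intro: mult_right_mono)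
      also have "\<dots> = q ^ (2 + 4 * s)" by (simp add: power_add power2_eq_square)
      also have "\<dots> \<le> q ^ (5 * s)" using s q2 by (intro power_increasing) auto
      finally have *: "q * (g + 2 * R) \<le> q ^ (5 * s)" .
      have "(g + 2 * R) * m < (g + 2 * R) * (q * D)" using g m by (intro mult_strict_left_mono) auto
      also have "\<dots> = q * (g + 2 * R) * D" by simp
      also have "\<dots> \<le> q ^ (5 * s) * D" using * by (intro mult_right_mono) auto
      also have "\<dots> \<le> q ^ lam" using D by (simp add: lam_def mult.commute)
      finally have "int ((g + 2 * R) * m) < int (q ^ lam)" by (simp only: of_nat_less_iff)
      moreover have "1 * int q ^ lam \<le> h * int q ^ lam" using False by (intro mult_right_mono) auto
      moreover have "int ((g + 2 * R) * m) = int g * int m + 2 * int (R * m)"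
        by (simp add: algebra_simps)
      ultimately show ?thesis unfolding of_nat_power by linarith
    qed
    have R1: "2 * R + 1 \<le> 3 * R" using R0 by simp
    have "(2 * R + 1) * (N div q ^ (4 * s) + 1) \<le> 3 * R * (2 * q ^ (46 * s))"
    proof (rule mult_mono[OF R1])
      have "N = q ^ (46 * s) * q ^ (4 * s)" by (simp add: N_def flip: power_add)
      then show "N div q ^ (4 * s) + 1 \<le> 2 * q ^ (46 * s)" by simp
    qed auto
    also have "\<dots> = 6 * q ^ (49 * s)" by (simp add: R_def flip: power_add)
    finally have cnt: "real ((2 * R + 1) * (N div q ^ (4 * s) + 1)) \<le> real (6 * q ^ (49 * s))"
      by (simp only: of_nat_le_iff)
    note w = window_bad_count[where \<mu> = \<Lambda> and \<mu>' = lam and v = "int m" and ?s0.0 = 0 and y = "int m"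
        and R = R and Z = "R * m" and A = "2 * R + 1" and B = "q ^ (4 * s)" and m = "int m" and N = N, OF _ _ _ _ _ gap]
    show ?thesis
    proof (intro exI[of _ "\<lambda>x. sd (\<Lambda> - lam) (x div int q ^ lam)"] conjI allI)
      show "sd (\<mu> i) x = sd (\<mu> (Suc i)) x + sd (\<Lambda> - lam) (x div int q ^ lam)" for x
        unfolding \<mu>1 using True sd_split[of lam \<Lambda> x] by (simp add: \<mu>_def \<Lambda>_def lam_def)
      show "real (card {n\<in>{..<N}. \<not> (\<forall>r<R. sd (\<Lambda> - lam) ((int n * int m + a + int r * v i) div int q ^ lam) =
          sd (\<Lambda> - lam) ((int n * int m + a) div int q ^ lam))}) \<le> 6 / real q ^ s * N" for a
      proof -
        have "v i = int m" using True by (simp add: v_def K_def)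
        then have "card {n\<in>{..<N}. \<not> (\<forall>r<R. sd (\<Lambda> - lam) ((int n * int m + a + int r * v i) div int q ^ lam) =
          sd (\<Lambda> - lam) ((int n * int m + a) div int q ^ lam))} \<le> (2 * R + 1) * (N div q ^ (4 * s) + 1)"
          using w[of a] by (auto simp: \<Lambda>_def lam_def)
        then have "real (card {n\<in>{..<N}. \<not> (\<forall>r<R. sd (\<Lambda> - lam) ((int n * int m + a + int r * v i) div int q ^ lam) =
          sd (\<Lambda> - lam) ((int n * int m + a) div int q ^ lam))}) \<le> real (6 * q ^ (49 * s))"
          using cnt by (meson of_nat_le_iff order_trans)
        also have "\<dots> = 6 / real q ^ s * N"
        proof -
          have "N = q ^ (49 * s) * q ^ s" by (simp add: N_def flip: power_add)
          then show ?thesis by simp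
        qed
        finally show ?thesis .
      qed
    qed
  next
    case False
    then have i1: "i \<in> {1..<k}" and c1: "k - i \<in> {1..<k}" using i by auto
    define c where "c = k - i"
    have \<mu>i: "\<mu> i = c * \<sigma> + \<sigma> + 20 * s" "\<mu> (Suc i) = c * \<sigma> + 20 * s"
      using False i by (auto simp: \<mu>_def c_def simp flip: add_mult_distrib mult_Suc_right) (metis Suc_diff_Suc add.commute mult_Suc)
    obtain y h where y: "v i = h * int q ^ \<mu> i + y" "\<bar>y\<bar> \<le> int (q ^ (c * \<sigma> + 10 * s))"
      using K'[OF i1] False by (auto simp: v_def K_def c_def)
    define Z where "Z = q ^ (c * \<sigma> + 13 * s)"
    have "int R * \<bar>y\<bar> \<le> int R * int (q ^ (c * \<sigma> + 10 * s))" using y by (intro mult_left_mono) auto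
    also have "\<dots> = int Z" by (simp add: R_def Z_def ac_simps flip: power_add)
    finally have RZ: "int R * \<bar>y\<bar> \<le> int Z" .
    have gap: "\<bar>int g * int m - h' * int q ^ (c * \<sigma> + 20 * s)\<bar> > 2 * int Z" if g: "1 \<le> g" "g < q ^ s" for g h'
    proof -
      have "g \<in> {1..q ^ s}" using g by simp
      then have "\<not> \<bar>int g * int m - h' * int q ^ (c * \<sigma> + 20 * s)\<bar> \<le> int (q ^ (c * \<sigma> + 14 * s))"
        using m(1) c1 unfolding good_def c_def by blast
      \<comment> \<open>The factor \<open>2\<close> of the two-sided gap costs one more
        \<open>q ^ s\<close>, hence \<open>14 * s\<close> after \<open>13 * s\<close>.\<close>
      moreover have "2 * Z \<le> q ^ s * Z" using qs by (intro mult_right_mono) auto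
      then have "2 * Z \<le> q ^ (c * \<sigma> + 14 * s)"
        by (simp add: Z_def ac_simps flip: power_add)
      then have "int (2 * Z) \<le> int (q ^ (c * \<sigma> + 14 * s))" by (simp only: of_nat_le_iff)
      ultimately show ?thesis by linarith
    qed
    note w = window_bad_count[where \<mu> = "\<mu> i" and \<mu>' = "c * \<sigma> + 20 * s" and v = "v i" and ?s0.0 = h and y = y
        and R = R and Z = Z and A = 1 and B = "q ^ s" and m = "int m" and N = N, OF _ y(1) RZ _ _ gap]
    show ?thesis
    proof (intro exI[of _ "\<lambda>x. sd (\<mu> i - (c * \<sigma> + 20 * s)) (x div int q ^ (c * \<sigma> + 20 * s))"] conjI allI)
      show "sd (\<mu> i) x = sd (\<mu> (Suc i)) x + sd (\<mu> i - (c * \<sigma> + 20 * s)) (x div int q ^ (c * \<sigma> + 20 * s))" for x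
        unfolding \<mu>i(2) by (rule sd_split) (simp add: \<mu>i)
      show "real (card {n\<in>{..<N}. \<not> (\<forall>r<R. sd (\<mu> i - (c * \<sigma> + 20 * s)) ((int n * int m + a + int r * v i) div int q ^ (c * \<sigma> + 20 * s)) =
          sd (\<mu> i - (c * \<sigma> + 20 * s)) ((int n * int m + a) div int q ^ (c * \<sigma> + 20 * s)))}) \<le> 6 / real q ^ s * N"
        (is "real (card ?bad) \<le> _") for a
      proof -
        have "card ?bad \<le> 1 * (N div q ^ s + 1)"
          using w[of a] by (auto simp: \<mu>i)
        also have "\<dots> \<le> 6 * q ^ (49 * s)"
        proof -
          have "N = q ^ (49 * s) * q ^ s" by (simp add: N_def flip: power_add)
          moreover have "1 \<le> q ^ (49 * s)" by simp
          ultimately show ?thesis by simp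
        qed
        finally have "real (card ?bad) \<le> real (6 * q ^ (49 * s))" by (simp only: of_nat_le_iff)
        also have "\<dots> = 6 / real q ^ s * N"
        proof -
          have "N = q ^ (49 * s) * q ^ s" by (simp add: N_def flip: power_add)
          then show ?thesis by simp
        qed
        finally show ?thesis .
      qed
    qed
  qed
  have err: "2 * 2 ^ i * (6 / real q ^ s) + 4 * (real R * K i / N) \<le> \<tau>" if i: "i < k" for i
  proof -
    have "K i \<le> q ^ (\<sigma> + 10 * s)" using K'[of i] i by (cases "i = 0") (auto simp: K_def)
    also have "\<dots> \<le> q ^ (40 * s)" using \<sigma> q2 by (intro power_increasing) auto
    finally have "R * K i * q ^ s \<le> R * q ^ (40 * s) * q ^ s" by (intro mult_mono) auto
    also have "\<dots> = q ^ (44 * s)" by (simp add: R_def flip: power_add)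
    also have "\<dots> \<le> N" unfolding N_def using q2 by (intro power_increasing) auto
    finally have "real (R * K i * q ^ s) \<le> real N" by (simp only: of_nat_le_iff)
    then have 1: "real R * K i / N \<le> 1 / real q ^ s"
      using N0 by (simp add: field_simps)
    have "(2::real) * 2 ^ i \<le> 2 ^ k"
      using i power_increasing[of "Suc i" k "2::real"] by simp
    then have 2: "2 * 2 ^ i * (6 / real q ^ s) \<le> 2 ^ k * (6 / real q ^ s)"
      by (intro mult_right_mono) auto
    have "(2::real) ^ 1 \<le> 2 ^ k" using k by (intro power_increasing) auto
    then have "(2 ^ k * 6 + 4) / real q ^ s \<le> 2 ^ (k + 3) / real q ^ s"
      by (intro divide_right_mono) (auto simp: power_add)
    then show ?thesis using 1 2 unfolding \<tau>_def by (simp add: add_divide_distrib)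
  qed
  let ?P = "{..<k} \<rightarrow>\<^sub>E {..<R}"
  have fin: "(\<Sum>r\<in>?P. mean_cube k (\<mu> k) 0 (int m) (int a) N (\<lambda>j. int (r j) * v j) (\<lambda>j. int (r' j) * v j)) \<le>
      real R ^ k * \<gamma> ^ n" for r'
  proof -
    \<comment> \<open>The exponent is \<open>\<mu> k\<close>, split into \<open>2 * s\<close> frozen
      digits, \<open>s\<close> digits that save, and the rest. By
      \<open>\<sigma> \<le> 30 * s\<close> the length \<open>N\<close> is a multiple of the period
      \<open>M\<close>.\<close>
    define M where "M = q ^ (2 * s + (s + (\<sigma> + 17 * s)))"
    define C where "C = q ^ (30 * s - \<sigma>)"
    have NM: "N = C * M" using \<sigma> by (simp add: N_def M_def C_def flip: power_add)
    have \<mu>k: "\<mu> k = 2 * s + (s + (\<sigma> + 17 * s))" using k by (simp add: \<mu>_def)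
    \<comment> \<open>For fixed \<open>r'\<close> the second shifts are absorbed into the base
      point; the sum over \<open>r\<close> alone gives the saving.\<close>
    define a' where "a' = int a + (\<Sum>j<k. int (r' j) * v j)"
    define f where "f r x = chi (cube k (sd (\<mu> k)) (\<lambda>j. int (r j) * v j - int (r' j) * v j) (\<lambda>_. 0) (int x * int m + a'))"
      for r :: "nat \<Rightarrow> nat" and x :: nat
    have mc: "mean_cube k (\<mu> k) 0 (int m) (int a) N (\<lambda>j. int (r j) * v j) (\<lambda>j. int (r' j) * v j) =
        norm (\<Sum>x<M. f r x) / M" for r
    proof -
      have "f r (x + M) = f r x" for x
        unfolding f_def by (intro arg_cong[of _ _ chi] cube_sd_cong) (simp add: \<mu>k M_def algebra_simps)
      then have "(\<Sum>x<N. f r x) = of_nat C * (\<Sum>x<M. f r x)"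
        unfolding NM by (rule sum_periodic)
      moreover have "mean_cube k (\<mu> k) 0 (int m) (int a) N (\<lambda>j. int (r j) * v j) (\<lambda>j. int (r' j) * v j) =
          norm (\<Sum>x<N. f r x) / N"
        unfolding mean_cube_def f_def a'_def
        by (subst cube_differences) (simp add: add.assoc)
      ultimately show ?thesis
        using N0 unfolding NM by (simp add: norm_mult)
    qed
    have "(\<Sum>r\<in>?P. norm (\<Sum>x<M. f r x)) \<le> real R ^ k * M * \<gamma> ^ n"
    proof -
      have R': "R = q ^ (2 * s + s)" by (simp add: R_def)
      have "\<forall>p. prime p \<longrightarrow> p dvd q \<longrightarrow> \<not> p ^ Suc s dvd 1"
        by (auto dest: prime_gt_1_nat)
      from solve[OF order_refl this] have "\<exists>z. int M dvd z * int m - int q ^ (2 * s)"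
        by (simp only: M_def of_nat_1 mult_1)
      moreover have "\<exists>z. int R dvd z * v i - int q ^ (2 * s)" if "i < k" for i
        using solve[of "K i"] K_good[OF that] unfolding R' v_def by blast
      ultimately show ?thesis
        using sum_norm_chi_cube_le[OF k t, where m = "int m" and v = v and j = "2 * s" and n = n and e = "\<sigma> + 17 * s"
            and a = a' and w = "\<lambda>j. int (r' j) * v j"]
        unfolding f_def \<mu>k \<gamma>_def M_def R' s_def by blast
    qed
    then show ?thesis
      unfolding mc using N0 NM by (simp flip: sum_divide_distrib) (simp add: field_simps)
  qed
  have "(mean_cube 0 (\<mu> 0) \<xi> (int m) (int a) N (\<lambda>_. 0) (\<lambda>_. 0) / 2) ^ 2 ^ k \<le>
      (\<Sum>r\<in>?P. \<Sum>r'\<in>?P. mean_cube k (\<mu> k) 0 (int m) (int a) N (\<lambda>j. int (r j) * v j) (\<lambda>j. int (r' j) * v j)) /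
      (real R ^ k)\<^sup>2 + \<tau>"
    unfolding v_def
    by (rule iterated_mean_cube_le[OF N0 R0 k(1) _ \<tau> step[unfolded v_def] err]) (auto simp: \<tau>_def)
  also have "(\<Sum>r\<in>?P. \<Sum>r'\<in>?P. mean_cube k (\<mu> k) 0 (int m) (int a) N (\<lambda>j. int (r j) * v j) (\<lambda>j. int (r' j) * v j)) \<le>
      (\<Sum>r'\<in>?P. real R ^ k * \<gamma> ^ n)"
    by (subst sum.swap) (intro sum_mono fin)
  also have "\<dots> = \<gamma> ^ n * (real R ^ k)\<^sup>2"
    by (simp add: card_PiE power2_eq_square)
  finally have "(mean_cube 0 (\<mu> 0) \<xi> (int m) (int a) N (\<lambda>_. 0) (\<lambda>_. 0) / 2) ^ 2 ^ k \<le> \<gamma> ^ n + \<tau>"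
    using R0 by (simp add: divide_right_mono)
  moreover have "mean_cube 0 (\<mu> 0) \<xi> (int m) (int a) N (\<lambda>_. 0) (\<lambda>_. 0) =
      norm (\<Sum>n<N. chi (int (digit_sum q (n * m + a))) * unit_exp (real n * \<xi>)) / N"
  proof -
    have "sd \<Lambda> (int n * int m + int a) = int (digit_sum q (n * m + a))" if "n < N" for n
    proof -
      have "n * m \<le> N * m" using that by (intro mult_right_mono) auto
      then have "n * m + a < \<Lambda>" unfolding \<Lambda>_def by linarith
      from sd_eq_digit_sum[OF this] show ?thesis by simp
    qed
    then show ?thesis by (simp add: mean_cube_def \<mu>_def)
  qed
  ultimately show ?thesis by (simp add: \<gamma>_def)
qed

end

section \<open>Counting exceptional moduli\<close>

lemma card_UN_le_mult:
  fixes B :: real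
  assumes "finite I" "\<And>i. i \<in> I \<Longrightarrow> real (card (A i)) \<le> B"
  shows "real (card (\<Union>i\<in>I. A i)) \<le> card I * B"
proof -
  have "real (card (\<Union>i\<in>I. A i)) \<le> real (\<Sum>i\<in>I. card (A i))"
    using card_UN_le[OF assms(1)] by (simp only: of_nat_le_iff)
  also have "\<dots> \<le> (\<Sum>i\<in>I. B)" unfolding of_nat_sum by (intro sum_mono assms)
  finally show ?thesis by simp
qed

lemma real_card_Un_le: "real (card (A \<union> B)) \<le> real (card A) + real (card B)"
  using card_Un_le[of A B] by (simp flip: of_nat_add)

context digit_phase
begin

text \<open>Union bound. At most \<open>Q / 2 ^ s\<close> of the denominators up to \<open>Q\<close>
  are multiples of \<open>p ^ Suc s\<close>, and each spoils at most \<open>6 * X / Q\<close> values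
  of \<open>m\<close>. The spacing condition has \<open>q ^ s\<close> values of \<open>g\<close>,
  each spoiling at most \<open>6 * X / q ^ (6 * s)\<close>. The lower bound on \<open>D\<close>
  supplies \<open>Y < D\<close> in \<open>card_near_multiple_le\<close>.\<close>

lemma card_not_good_le:
  assumes D: "q ^ ((k - 1) * \<sigma> + 14 * s) < D"
  shows "real (card {m \<in> {D..<q * D}. \<not> good k s \<sigma> m}) \<le> real (q + 6 * k * (q + 1)) * (real (q * D) / 2 ^ s)"
proof -
  define X where "X = q * D"
  define P where "P = {p \<in> {1..q}. prime p \<and> p dvd q}"
  define Q where "Q = q ^ (\<sigma> + 10 * s)"
  define E where "E = real X / 2 ^ s"
  define near where "near K U Y = {m \<in> {D..<X}. \<exists>h. \<bar>int K * int m - h * int q ^ U\<bar> \<le> int Y}" for K U Y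
  have D1: "1 \<le> D" "D \<le> X" using D q2 by (auto simp: X_def)
  have E0: "0 \<le> E" by (simp add: E_def)
  have finP: "finite P" by (simp add: P_def)
  have "P \<subseteq> {1..q}" by (auto simp: P_def)
  then have cardP: "real (card P) \<le> q"
    using card_mono[of "{1..q}" P] by simp
  have memP: "p \<in> P" if "prime p" "p dvd q" for p
    using that dvd_imp_le[of p q] prime_ge_1_nat[of p] by (auto simp: P_def)
  have pow2: "2 ^ s * 2 \<le> real (p ^ Suc s)" if "p \<in> P" for p
  proof -
    have "2 ^ Suc s \<le> p ^ Suc s" using that prime_ge_2_nat[of p] by (intro power_mono) (auto simp: P_def)
    then have "real (2 ^ Suc s) \<le> real (p ^ Suc s)" by (simp only: of_nat_le_iff)
    then show ?thesis by simp
  qed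
  have near_le: "real (card (near K U Y)) \<le> 6 * real X * Y / real q ^ U" if "1 \<le> K" "K \<le> Y" "Y < D" for K U Y
    using card_near_multiple_le[OF that D1(2), of "int q ^ U"] by (simp add: near_def)
  have mono: "q ^ (c * \<sigma> + e) < D" if "c \<in> {1..<k}" "e \<le> 14 * s" for c e
  proof -
    have "c * \<sigma> \<le> (k - 1) * \<sigma>" using that by (intro mult_right_mono) auto
    then have "q ^ (c * \<sigma> + e) \<le> q ^ ((k - 1) * \<sigma> + 14 * s)"
      using that q2 by (intro power_increasing add_mono) auto
    then show ?thesis using D by simp
  qed
  have B1: "real (card (\<Union>p\<in>P. {m \<in> {D..<X}. p ^ Suc s dvd m})) \<le> q * E"
  proof -
    have pd: "real (card {m \<in> {D..<X}. p ^ Suc s dvd m}) \<le> E" if p: "p \<in> P" for p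
    proof -
      have "1 \<le> p ^ Suc s" using p by (auto simp: P_def)
      then have "real (card {m \<in> {D..<X}. p ^ Suc s dvd m}) \<le> real X / real (p ^ Suc s)"
        by (rule card_multiples_le[OF D1(1)])
      also have "\<dots> \<le> E" unfolding E_def
      proof (rule divide_left_mono)
        show "2 ^ s \<le> real (p ^ Suc s)" using pow2[OF p] zero_le_power[of "2::real" s] by linarith
        have "0 < real (p ^ Suc s)" using \<open>1 \<le> p ^ Suc s\<close> unfolding of_nat_0_less_iff by linarith
        then show "0 < real (p ^ Suc s) * 2 ^ s" by (intro mult_pos_pos) auto
      qed simp
      finally show ?thesis .
    qed
    have "real (card (\<Union>p\<in>P. {m \<in> {D..<X}. p ^ Suc s dvd m})) \<le> card P * E"
      by (rule card_UN_le_mult[OF finP pd])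
    also have "\<dots> \<le> q * E" using cardP E0 by (intro mult_right_mono)
    finally show ?thesis .
  qed
  define W where "W c p = (\<Union>K\<in>{K \<in> {1..<Suc Q}. p ^ Suc s dvd K}. near K (c * \<sigma> + \<sigma> + 20 * s) (q ^ (c * \<sigma> + 10 * s)))" for c p
  define V where "V c = (\<Union>g\<in>{1..q ^ s}. near g (c * \<sigma> + 20 * s) (q ^ (c * \<sigma> + 14 * s)))" for c
  have W_le: "real (card (W c p)) \<le> 6 * E" if c: "c \<in> {1..<k}" and p: "p \<in> P" for c p
  proof -
    let ?I = "{K \<in> {1..<Suc Q}. p ^ Suc s dvd K}"
    have K: "real (card (near K (c * \<sigma> + \<sigma> + 20 * s) (q ^ (c * \<sigma> + 10 * s)))) \<le> 6 * real X / Q"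
      if K: "K \<in> ?I" for K
    proof -
      have "Q \<le> q ^ (c * \<sigma> + 10 * s)"
        unfolding Q_def using c q2 by (intro power_increasing) (auto simp: Suc_le_eq)
      then have "real (card (near K (c * \<sigma> + \<sigma> + 20 * s) (q ^ (c * \<sigma> + 10 * s)))) \<le>
          6 * real X * real (q ^ (c * \<sigma> + 10 * s)) / real q ^ (c * \<sigma> + \<sigma> + 20 * s)"
        using K mono[OF c, of "10 * s"] by (intro near_le) auto
      also have "\<dots> = 6 * real X / Q"
      proof -
        have "real q ^ (c * \<sigma> + \<sigma> + 20 * s) = real (q ^ (c * \<sigma> + 10 * s)) * Q"
          by (simp add: Q_def ac_simps flip: power_add)
        then show ?thesis by simp
      qed
      finally show ?thesis .
    qed
    have "real (card (W c p)) \<le> card ?I * (6 * real X / Q)"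
      unfolding W_def by (intro card_UN_le_mult K) auto
    also have "\<dots> \<le> (Q / 2 ^ s) * (6 * real X / Q)"
    proof (intro mult_right_mono)
      have "1 \<le> p ^ Suc s" using p by (auto simp: P_def)
      then have "real (card ?I) \<le> real (Suc Q) / real (p ^ Suc s)"
        by (intro card_multiples_le) auto
      \<comment> \<open>\<open>Suc Q \<le> 2 * Q\<close>, and this factor \<open>2\<close> is paid
        by the exponent \<open>Suc s\<close> instead of \<open>s\<close>.\<close>
      also have "\<dots> \<le> (2 * Q) / (2 ^ s * 2)"
        using pow2[OF p] by (intro frac_le) (auto simp: Q_def Suc_le_eq)
      finally show "real (card ?I) \<le> Q / 2 ^ s" by simp
    qed auto
    also have "\<dots> = 6 * E" by (simp add: E_def Q_def)
    finally show ?thesis .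
  qed
  have V_le: "real (card (V c)) \<le> 6 * E" if c: "c \<in> {1..<k}" for c
  proof -
    have g: "real (card (near g (c * \<sigma> + 20 * s) (q ^ (c * \<sigma> + 14 * s)))) \<le> 6 * real X / real q ^ (6 * s)"
      if g: "g \<in> {1..q ^ s}" for g
    proof -
      have "q ^ s \<le> q ^ (c * \<sigma> + 14 * s)" using q2 by (intro power_increasing) auto
      then have "real (card (near g (c * \<sigma> + 20 * s) (q ^ (c * \<sigma> + 14 * s)))) \<le>
          6 * real X * real (q ^ (c * \<sigma> + 14 * s)) / real q ^ (c * \<sigma> + 20 * s)"
        using g mono[OF c, of "14 * s"] by (intro near_le) auto
      also have "\<dots> = 6 * real X / real q ^ (6 * s)"
      proof -
        have "real q ^ (c * \<sigma> + 20 * s) = real (q ^ (c * \<sigma> + 14 * s)) * real q ^ (6 * s)"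
          by (simp add: ac_simps flip: power_add)
        then show ?thesis by simp
      qed
      finally show ?thesis .
    qed
    have "real (card (V c)) \<le> card {1..q ^ s} * (6 * real X / real q ^ (6 * s))"
      unfolding V_def by (intro card_UN_le_mult g) auto
    also have "\<dots> = 6 * real X / real q ^ (5 * s)"
    proof -
      have "real q ^ (6 * s) = real q ^ (5 * s) * real q ^ s" by (simp flip: power_add)
      then show ?thesis by simp
    qed
    also have "\<dots> \<le> 6 * real X / 2 ^ s"
    proof -
      have "(2::real) ^ s \<le> real q ^ s" using q2 by (intro power_mono) auto
      also have "\<dots> \<le> real q ^ (5 * s)" using q2 by (intro power_increasing) auto
      finally show ?thesis by (intro divide_left_mono) (auto intro!: mult_pos_pos)
    qed
    finally show ?thesis by (simp add: E_def)
  qed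
  have B2: "real (card (\<Union>c\<in>{1..<k}. (\<Union>p\<in>P. W c p) \<union> V c)) \<le> k * ((q + 1) * (6 * E))"
  proof -
    have "real (card ((\<Union>p\<in>P. W c p) \<union> V c)) \<le> (q + 1) * (6 * E)" if c: "c \<in> {1..<k}" for c
    proof -
      have "real (card ((\<Union>p\<in>P. W c p) \<union> V c)) \<le> real (card (\<Union>p\<in>P. W c p)) + real (card (V c))"
        by (rule real_card_Un_le)
      also have "\<dots> \<le> card P * (6 * E) + 6 * E"
        using W_le[OF c] V_le[OF c] finP by (intro add_mono card_UN_le_mult) auto
      also have "\<dots> \<le> q * (6 * E) + 6 * E"
        using cardP E0 by (intro add_mono mult_right_mono) auto
      finally show ?thesis by (simp add: distrib_right)
    qed
    then have "real (card (\<Union>c\<in>{1..<k}. (\<Union>p\<in>P. W c p) \<union> V c)) \<le> card {1..<k} * ((q + 1) * (6 * E))"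
      by (intro card_UN_le_mult) auto
    also have "\<dots> \<le> k * ((q + 1) * (6 * E))" using E0 by (intro mult_right_mono) auto
    finally show ?thesis .
  qed
  have "{m \<in> {D..<X}. \<not> good k s \<sigma> m} \<subseteq>
    (\<Union>p\<in>P. {m \<in> {D..<X}. p ^ Suc s dvd m}) \<union> (\<Union>c\<in>{1..<k}. (\<Union>p\<in>P. W c p) \<union> V c)"
  proof
    fix m assume m: "m \<in> {m \<in> {D..<X}. \<not> good k s \<sigma> m}"
    then consider p where "prime p" "p dvd q" "p ^ Suc s dvd m"
      | c p K h where "c \<in> {1..<k}" "prime p" "p dvd q" "K \<in> {1..Q}" "p ^ Suc s dvd K"
          "\<bar>int K * int m - h * int q ^ (c * \<sigma> + \<sigma> + 20 * s)\<bar> \<le> int (q ^ (c * \<sigma> + 10 * s))"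
      | c g h where "c \<in> {1..<k}" "g \<in> {1..q ^ s}"
          "\<bar>int g * int m - h * int q ^ (c * \<sigma> + 20 * s)\<bar> \<le> int (q ^ (c * \<sigma> + 14 * s))"
      unfolding good_def Q_def by blast
    then show "m \<in> (\<Union>p\<in>P. {m \<in> {D..<X}. p ^ Suc s dvd m}) \<union> (\<Union>c\<in>{1..<k}. (\<Union>p\<in>P. W c p) \<union> V c)"
    proof cases
      case 1
      then show ?thesis using memP m by blast
    next
      case 2
      then have "m \<in> near K (c * \<sigma> + \<sigma> + 20 * s) (q ^ (c * \<sigma> + 10 * s))"
        using m unfolding near_def by blast
      moreover have "K \<in> {K \<in> {1..<Suc Q}. p ^ Suc s dvd K}" using 2 by auto
      ultimately have "m \<in> W c p" unfolding W_def by blast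
      then show ?thesis using 2 memP by blast
    next
      case 3
      then have "m \<in> near g (c * \<sigma> + 20 * s) (q ^ (c * \<sigma> + 14 * s))"
        using m unfolding near_def by blast
      then have "m \<in> V c" using 3 unfolding V_def by blast
      then show ?thesis using 3 by blast
    qed
  qed
  moreover have "finite ((\<Union>p\<in>P. {m \<in> {D..<X}. p ^ Suc s dvd m}) \<union> (\<Union>c\<in>{1..<k}. (\<Union>p\<in>P. W c p) \<union> V c))"
    using finP by (auto simp: W_def V_def near_def)
  ultimately have "real (card {m \<in> {D..<X}. \<not> good k s \<sigma> m}) \<le>
      real (card ((\<Union>p\<in>P. {m \<in> {D..<X}. p ^ Suc s dvd m}) \<union> (\<Union>c\<in>{1..<k}. (\<Union>p\<in>P. W c p) \<union> V c)))"
    by (simp only: of_nat_le_iff card_mono)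
  also have "\<dots> \<le> q * E + k * ((q + 1) * (6 * E))"
    using B1 B2 real_card_Un_le by (meson add_mono order_trans)
  also have "\<dots> = real (q + 6 * k * (q + 1)) * E" by (simp add: algebra_simps)
  finally show ?thesis by (simp only: X_def E_def)
qed

text \<open>Up to a constant of modulus \<open>1\<close>, the block starting at \<open>i * N\<close>
  is the first block with \<open>a\<close> replaced by \<open>a + i * N * m\<close>; hence the need
  for estimates uniform in \<open>a\<close>. The incomplete block is estimated by
  \<open>N\<close>.\<close>

lemma norm_sum_le_blocks:
  fixes N N' m a :: nat and \<xi> \<epsilon> :: real
  assumes N: "0 < N"
    and block: "\<And>a. norm (\<Sum>n<N. chi (int (digit_sum q (n * m + a))) * unit_exp (real n * \<xi>)) \<le> N * \<epsilon>"
  shows "norm (\<Sum>n<N'. chi (int (digit_sum q (n * m + a))) * unit_exp (real n * \<xi>)) \<le> N' * \<epsilon> + N"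
proof -
  define f where "f n = chi (int (digit_sum q (n * m + a))) * unit_exp (real n * \<xi>)" for n
  define c where "c = N' div N"
  have f1: "norm (f n) = 1" for n by (simp add: f_def norm_mult)
  have \<epsilon>: "0 \<le> \<epsilon>" using order_trans[OF norm_ge_zero block[of 0]] N by (simp add: zero_le_mult_iff)
  have N': "N' = c * N + N' mod N" by (simp add: c_def)
  have rest: "N' - c * N = N' mod N" unfolding c_def by (rule minus_div_mult_eq_mod)
  have "(\<Sum>n<N'. f n) = (\<Sum>n<c * N. f n) + (\<Sum>n\<in>{c * N..<N'}. f n)"
    using N' sum.atLeastLessThan_concat[of 0 "c * N" N' f] by (simp add: lessThan_atLeast0)
  moreover have "(\<Sum>n<c * N. f n) = (\<Sum>i<c. unit_exp (real (i * N) * \<xi>) *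
      (\<Sum>n<N. chi (int (digit_sum q (n * m + (i * N * m + a)))) * unit_exp (real n * \<xi>)))"
  proof -
    have "(\<Sum>n\<in>{i * N..<i * N + N}. f n) = unit_exp (real (i * N) * \<xi>) *
      (\<Sum>n<N. chi (int (digit_sum q (n * m + (i * N * m + a)))) * unit_exp (real n * \<xi>))" for i
    proof -
      have "(\<Sum>n\<in>{i * N..<i * N + N}. f n) = (\<Sum>n<N. f (n + i * N))"
        using sum.shift_bounds_nat_ivl[of f 0 "i * N" N] by (simp add: lessThan_atLeast0 add.commute)
      also have "\<dots> = (\<Sum>n<N. unit_exp (real (i * N) * \<xi>) *
          (chi (int (digit_sum q (n * m + (i * N * m + a)))) * unit_exp (real n * \<xi>)))"
      proof (rule sum.cong[OF refl])
        fix n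
        have "(n + i * N) * m + a = n * m + (i * N * m + a)" by (simp add: algebra_simps)
        moreover have "unit_exp (real (n + i * N) * \<xi>) = unit_exp (real n * \<xi>) * unit_exp (real (i * N) * \<xi>)"
          by (simp only: of_nat_add distrib_right unit_exp_add)
        ultimately show "f (n + i * N) = unit_exp (real (i * N) * \<xi>) *
          (chi (int (digit_sum q (n * m + (i * N * m + a)))) * unit_exp (real n * \<xi>))"
          unfolding f_def by (simp only: mult_ac)
      qed
      finally show ?thesis by (simp only: sum_distrib_left)
    qed
    then show ?thesis by (simp only: sum.nat_group[symmetric])
  qed
  ultimately have "norm (\<Sum>n<N'. f n) \<le> norm (\<Sum>i<c. unit_exp (real (i * N) * \<xi>) *
      (\<Sum>n<N. chi (int (digit_sum q (n * m + (i * N * m + a)))) * unit_exp (real n * \<xi>))) +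
      norm (\<Sum>n\<in>{c * N..<N'}. f n)"
    by (simp only: norm_triangle_ineq)
  also have "\<dots> \<le> (\<Sum>i<c. N * \<epsilon>) + (\<Sum>n\<in>{c * N..<N'}. 1)"
    by (intro add_mono sum_norm_le) (simp_all only: norm_mult norm_unit_exp mult_1 block f1 order_refl)
  also have "\<dots> = real (c * N) * \<epsilon> + real (N' mod N)"
    by (simp only: sum_constant card_lessThan card_atLeastLessThan rest of_nat_mult mult.assoc mult_1_right)
  also have "\<dots> \<le> N' * \<epsilon> + N"
  proof (intro add_mono mult_right_mono \<epsilon>)
    have "c * N \<le> N'" using N' by linarith
    then show "real (c * N) \<le> real N'" by (simp only: of_nat_le_iff)
    show "real (N' mod N) \<le> real N" using N by (simp add: less_imp_le)
  qed
  finally show ?thesis by (simp add: f_def)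
qed

text \<open>The exponent \<open>51 * s\<close> makes \<open>N'\<close> at least \<open>q ^ s\<close>
  blocks long, so the incomplete block costs a relative \<open>1 / real q ^ s\<close>. Exceptional
  \<open>m\<close> receive the trivial bound \<open>N'\<close>.\<close>

lemma S0_le:
  fixes k t1 J t n \<sigma> D N' :: nat and \<xi> \<epsilon> :: real
  assumes k: "1 \<le> k" "k < q ^ t1" "k \<le> q ^ J" and t: "t = t1 + (J + 2)"
  defines "s \<equiv> t * n"
  defines "\<tau> \<equiv> 2 ^ (k + 3) / real q ^ s"
  assumes s: "2 \<le> s" and \<tau>: "\<tau> \<le> 1"
    and D: "D * q ^ (5 * s) \<le> q ^ (k * \<sigma> + 20 * s)" "q ^ ((k - 1) * \<sigma> + 14 * s) < D"
    and \<sigma>: "\<sigma> \<le> 30 * s" and N': "q ^ (51 * s) \<le> N'"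
    and \<epsilon>: "0 \<le> \<epsilon>" "(1 - 4 / real b^2 / real q ^ ((k + 1) * t)) ^ n + \<tau> \<le> (\<epsilon> / 2) ^ 2 ^ k"
  shows "S0 b q l N' D \<xi> \<le> real (q * D) * N' * (\<epsilon> + 1 / real q ^ s + real (q + 6 * k * (q + 1)) / 2 ^ s)"
proof -
  define N where "N = q ^ (50 * s)"
  define X where "X = real (q * D)"
  define f where "f m a = norm (\<Sum>n<N'. unit_exp (real l / real b * real (digit_sum q (n * m + a))) * unit_exp (real n * \<xi>))" for m a
  have f: "f m a = norm (\<Sum>n<N'. chi (int (digit_sum q (n * m + a))) * unit_exp (real n * \<xi>))" for m a
    by (simp add: f_def chi_def unit_exp_def)
  have N0: "0 < N" by (simp add: N_def)
  have triv: "f m a \<le> N'" for m a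
    unfolding f by (rule order_trans[OF norm_sum]) (simp add: norm_mult)
  have NN: "real N \<le> N' / real q ^ s"
  proof -
    have "N * q ^ s = q ^ (51 * s)" by (simp add: N_def flip: power_add)
    then have "real (N * q ^ s) \<le> real N'" using N' by (simp only: of_nat_le_iff)
    then show ?thesis by (simp add: field_simps)
  qed
  have goodm: "f m a \<le> N' * \<epsilon> + N' / real q ^ s" if m: "m \<in> {D..<q * D}" "good k s \<sigma> m" for m a
  proof -
    have "norm (\<Sum>n<N. chi (int (digit_sum q (n * m + a))) * unit_exp (real n * \<xi>)) \<le> N * \<epsilon>" for a
    proof -
      define x where "x = norm (\<Sum>n<N. chi (int (digit_sum q (n * m + a))) * unit_exp (real n * \<xi>)) / N / 2"
      have "x ^ 2 ^ k \<le> (1 - 4 / real b^2 / real q ^ ((k + 1) * t)) ^ n + \<tau>"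
        unfolding x_def N_def s_def \<tau>_def
        by (rule good_bound[OF k t, where D = D and \<sigma> = \<sigma>])
          (use m s \<tau> D \<sigma> in \<open>simp_all add: s_def \<tau>_def\<close>)
      also have "\<dots> \<le> (\<epsilon> / 2) ^ 2 ^ k" by (rule \<epsilon>)
      finally have "x \<le> \<epsilon> / 2"
        using \<epsilon>(1) power_strict_mono[of "\<epsilon> / 2" x "2 ^ k"] by (meson divide_nonneg_pos not_le zero_less_numeral zero_less_power)
      then show ?thesis using N0 by (simp add: x_def field_simps)
    qed
    then have "f m a \<le> N' * \<epsilon> + N"
      unfolding f by (rule norm_sum_le_blocks[OF N0])
    then show ?thesis using NN by simp
  qed
  have "S0 b q l N' D \<xi> = (\<Sum>m\<in>{D..<q * D}. SUP a. f m a)"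
    by (simp add: S0_def f_def)
  also have "\<dots> \<le> (\<Sum>m\<in>{D..<q * D}. (N' * \<epsilon> + N' / real q ^ s) + (if good k s \<sigma> m then 0 else real N'))"
  proof (intro sum_mono cSUP_least)
    fix m a assume "m \<in> {D..<q * D}"
    then show "f m a \<le> (N' * \<epsilon> + N' / real q ^ s) + (if good k s \<sigma> m then 0 else real N')"
      using goodm[of m a] triv[of m a] \<epsilon>(1) by (auto intro: add_increasing)
  qed simp
  also have "\<dots> = card {D..<q * D} * (N' * \<epsilon> + N' / real q ^ s) +
      real (card {m \<in> {D..<q * D}. \<not> good k s \<sigma> m}) * real N'"
    by (simp add: sum.distrib sum.If_cases Int_def conj_commute)
  also have "\<dots> \<le> X * (N' * \<epsilon> + N' / real q ^ s) + (real (q + 6 * k * (q + 1)) * (X / 2 ^ s)) * real N'"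
  proof (intro add_mono mult_right_mono)
    show "real (card {D..<q * D}) \<le> X"
      unfolding X_def card_atLeastLessThan of_nat_le_iff by simp
    show "real (card {m \<in> {D..<q * D}. \<not> good k s \<sigma> m}) \<le> real (q + 6 * k * (q + 1)) * (X / 2 ^ s)"
      unfolding X_def by (rule card_not_good_le[OF D(2)])
  qed (use \<epsilon>(1) in auto)
  also have "\<dots> = X * N' * (\<epsilon> + 1 / real q ^ s + real (q + 6 * k * (q + 1)) / 2 ^ s)"
    by (simp add: field_simps)
  finally show ?thesis by (simp add: X_def)
qed

end

section \<open>The exponent\<close>

lemma admissible_exponent_mono:
  assumes "admissible_exponent b q \<rho>1 \<rho>2 \<eta>" "0 < \<eta>'" "\<eta>' \<le> \<eta>"
  shows "admissible_exponent b q \<rho>1 \<rho>2 \<eta>'"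
proof -
  obtain C where C: "C > 0"
    "\<And>N D l \<xi>. N > 1 \<Longrightarrow> D > 1 \<Longrightarrow> real N powr \<rho>1 \<le> real D \<Longrightarrow> real D \<le> real N powr \<rho>2 \<Longrightarrow>
        l \<in> {1..b - 1} \<Longrightarrow> \<bar>S0 b q l N D \<xi> / real D\<bar> \<le> C * real N powr (1 - \<eta>)"
    using assms(1) unfolding admissible_exponent_def by blast
  have "\<bar>S0 b q l N D \<xi> / real D\<bar> \<le> C * real N powr (1 - \<eta>')"
    if h: "N > 1" "D > 1" "real N powr \<rho>1 \<le> real D" "real D \<le> real N powr \<rho>2" "l \<in> {1..b - 1}"
    for N D l :: nat and \<xi> :: real
  proof -
    have "real N powr (1 - \<eta>) \<le> real N powr (1 - \<eta>')" using h assms(3) by (intro powr_mono) auto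
    then have "C * real N powr (1 - \<eta>) \<le> C * real N powr (1 - \<eta>')" using C(1) by simp
    then show ?thesis using C(2)[OF h, of \<xi>] by linarith
  qed
  then show ?thesis using C(1) assms(2) unfolding admissible_exponent_def by blast
qed

lemma S0_nonneg: "0 \<le> S0 b q l N D \<xi>"
  and S0_le_trivial: "1 \<le> q \<Longrightarrow> S0 b q l N D \<xi> \<le> real (q * D) * N"
proof -
  define f where "f m a = norm (\<Sum>n<N. unit_exp (real l / real b * real (digit_sum q (n * m + a))) * unit_exp (real n * \<xi>))" for m a
  have S0: "S0 b q l N D \<xi> = (\<Sum>m\<in>{D..<q * D}. SUP a. f m a)" by (simp add: S0_def f_def)
  have f: "0 \<le> f m a" "f m a \<le> N" for m a
    unfolding f_def by (simp, rule order_trans[OF norm_sum], simp add: norm_mult)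
  have "0 \<le> (SUP a. f m a)" for m
  proof (rule cSUP_upper2[where x = 0])
    show "bdd_above (range (f m))" using f by (intro bdd_aboveI[where M = "real N"]) auto
  qed (use f in auto)
  then show "0 \<le> S0 b q l N D \<xi>" unfolding S0 by (intro sum_nonneg)
  have "(SUP a. f m a) \<le> N" for m using f by (intro cSUP_least) auto
  then have "S0 b q l N D \<xi> \<le> (\<Sum>m\<in>{D..<q * D}. real N)" unfolding S0 by (intro sum_mono)
  also have "\<dots> = real (q * D - D) * N" by simp
  also have "\<dots> \<le> real (q * D) * N" by (intro mult_right_mono) (simp_all only: of_nat_le_iff diff_le_self of_nat_0_le_iff)
  finally show "S0 b q l N D \<xi> \<le> real (q * D) * N" .
qed

lemma exists_power_bracket:
  fixes B X :: nat
  assumes "2 \<le> B" "1 \<le> X"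
  obtains n where "B ^ n \<le> X" "X < B ^ Suc n"
proof -
  have "X < B ^ X" using assms power_gt_expt[of B X] by simp
  define j where "j = (LEAST j. X < B ^ j)"
  have j: "X < B ^ j" unfolding j_def using \<open>X < B ^ X\<close> by (rule LeastI)
  have "j \<noteq> 0" using j assms by (intro notI) simp
  then obtain n where n: "j = Suc n" by (cases j) auto
  have "\<not> X < B ^ n" using not_less_Least[of n "\<lambda>j. X < B ^ j"] n by (simp add: j_def)
  then show ?thesis using that[of n] j n by simp
qed

context digit_phase
begin

text \<open>Replacing \<open>N\<close> by \<open>min N D\<close>, that is, splitting into blocks of length at most \<open>D\<close>, costs the
  factor \<open>min 1 \<rho>1\<close> in the exponent and makes \<open>D\<close> at least as large as the block length, which the
  spacing arguments need.\<close>
lemma S0_exponential_bound: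
  fixes k :: nat and P :: real
  assumes k: "2 \<le> k" "2 * P \<le> k" and P: "1 \<le> P"
  defines "t \<equiv> 2 * k + 2"
  defines "\<theta> \<equiv> 4 / real b^2 / real q ^ ((k + 1) * t)"
  assumes n: "k + 6 \<le> n"
    and ND: "q ^ (51 * t * n) \<le> min N D" "min N D < q ^ (51 * t * Suc n)" "real D \<le> real (min N D) powr P"
  shows "S0 b q l N D \<xi> \<le>
    real (q * D) * N * ((2 * (1 + 2 ^ (k + 3)) + 1 + real (q + 6 * k * (q + 1))) * exp (- (\<theta> / 2 ^ k * n)))"
proof -
  define s where "s = t * n"
  define m where "m = min N D"
  define \<tau> where "\<tau> = 2 ^ (k + 3) / real q ^ s"
  define c where "c = \<theta> / 2 ^ k"
  define \<epsilon> where "\<epsilon> = 2 * (1 + 2 ^ (k + 3)) * exp (- (c * n))"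
  have t4: "4 \<le> t" using k by (simp add: t_def)
  have b2': "4 \<le> real b^2" using b2 power_mono[of 2 "real b" 2] by simp
  have q1: "1 \<le> real q ^ j" for j using q2 by (intro one_le_power) simp
  have \<theta>: "0 < \<theta>" "\<theta> \<le> 1"
  proof -
    show "0 < \<theta>" unfolding \<theta>_def using b2 q2 by simp
    have "4 / real b^2 \<le> real b^2 / real b^2" by (intro divide_right_mono b2') simp
    also have "\<dots> = 1" using b2 by simp
    finally have "4 / real b^2 \<le> 1" .
    then have "\<theta> \<le> 1 / real q ^ ((k + 1) * t)" unfolding \<theta>_def by (intro divide_right_mono) auto
    also have "\<dots> \<le> 1" using q1[of "(k + 1) * t"] by (simp add: divide_le_eq)
    finally show "\<theta> \<le> 1" .
  qed
  have c: "0 < c" "c \<le> \<theta>" "c \<le> 1"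
  proof -
    show "0 < c" using \<theta> by (simp add: c_def)
    show "c \<le> \<theta>" unfolding c_def using \<theta> by (simp add: divide_le_eq)
    then show "c \<le> 1" using \<theta> by simp
  qed
  have s_n: "n \<le> s" "4 * n \<le> s" "6 * t \<le> s" "k + 6 \<le> s"
  proof -
    show "4 * n \<le> s" unfolding s_def using t4 by (intro mult_right_mono) auto
    then show "n \<le> s" "k + 6 \<le> s" using n by auto
    have "t * 6 \<le> t * n" using n by (intro mult_left_mono) auto
    then show "6 * t \<le> s" by (simp add: s_def mult.commute)
  qed
  \<comment> \<open>The losses in \<open>2 ^ s\<close> and \<open>q ^ s\<close> are dominated by the
    main saving, since \<open>s \<ge> 4 * n\<close> and \<open>\<theta> \<le> 1\<close>.\<close>
  have exp_small: "1 / 2 ^ s \<le> exp (- real n)"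
  proof -
    have "exp (real n) = exp 1 ^ n" by (simp flip: exp_of_nat_mult)
    also have "\<dots> \<le> 4 ^ n" using exp_le by (intro power_mono) auto
    also have "\<dots> = 2 ^ (2 * n)" by (simp add: power_mult)
    also have "\<dots> \<le> (2::real) ^ s" using s_n by (intro power_increasing) auto
    finally show ?thesis by (simp add: exp_minus field_simps)
  qed
  have qs_small: "1 / real q ^ s \<le> 1 / 2 ^ s"
    using q2 power_mono[of 2 "real q" s] by (intro divide_left_mono) auto
  have exp_mono: "exp (- real n) \<le> exp (- (\<theta> * n))" "exp (- (\<theta> * n)) \<le> exp (- (c * n))"
    using c \<theta> by (auto intro!: mult_right_mono mult_left_le_one_le)
  \<comment> \<open>The least such \<open>\<sigma>\<close> serves both conditions on
    \<open>D\<close>: its inequality times \<open>q ^ (5 * s)\<close> is the upper one; minimality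
    gives the lower one, where \<open>k \<le> s\<close> allows the passage from
    \<open>15 * s\<close> to \<open>14 * s\<close>.\<close>
  define \<sigma> where "\<sigma> = (LEAST \<sigma>. D \<le> q ^ (k * \<sigma> + 15 * s))"
  have \<sigma>1: "D \<le> q ^ (k * \<sigma> + 15 * s)"
    unfolding \<sigma>_def
  proof (rule LeastI)
    have "D < q ^ D" using power_gt_expt q2 by simp
    also have "\<dots> \<le> q ^ (k * D + 15 * s)" using k q2 by (intro power_increasing) (auto simp: trans_le_add1)
    finally show "D \<le> q ^ (k * D + 15 * s)" by simp
  qed
  have "\<sigma> \<noteq> 0"
  proof
    assume "\<sigma> = 0"
    then have "q ^ (51 * s) \<le> q ^ (15 * s)"
      using \<sigma>1 ND(1) by (simp add: s_def mult.assoc)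
    then have "51 * s \<le> 15 * s" using q2 power_increasing_iff[of q] by simp
    then show False using s_n by simp
  qed
  have \<sigma>2: "q ^ (k * (\<sigma> - 1) + 15 * s) < D"
    using not_less_Least[of "\<sigma> - 1" "\<lambda>\<sigma>. D \<le> q ^ (k * \<sigma> + 15 * s)"] \<open>\<sigma> \<noteq> 0\<close>
    unfolding \<sigma>_def[symmetric] by simp
  \<comment> \<open>Squared, so that \<open>2 * P \<le> k\<close> yields the natural exponent
    \<open>k\<close>.\<close>
  have D2: "D ^ 2 < q ^ (51 * t * Suc n * k)"
  proof -
    have m1: "1 \<le> real m" using ND(1) q2 unfolding m_def by (metis le_trans nat_le_real_less of_nat_1 of_nat_le_iff one_le_power le_trans one_le_numeral)
    have "real D ^ 2 \<le> (real m powr P) ^ 2" using ND(3) by (intro power_mono) (auto simp: m_def)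
    also have "\<dots> = real m powr (2 * P)" using m1 by (simp add: powr_power mult.commute)
    also have "\<dots> \<le> real m powr k" using k m1 by (intro powr_mono) auto
    also have "\<dots> = real (m ^ k)" using m1 by (simp add: powr_realpow)
    finally have "D ^ 2 \<le> m ^ k" by (simp flip: of_nat_power)
    also have "\<dots> < (q ^ (51 * t * Suc n)) ^ k" using ND(2) k unfolding m_def by (intro power_strict_mono) auto
    finally show ?thesis by (simp only: power_mult)
  qed
  have \<sigma>3: "\<sigma> \<le> 30 * s"
  proof (rule ccontr)
    assume "\<not> \<sigma> \<le> 30 * s"
    then have "k * (30 * s) \<le> k * (\<sigma> - 1)" by (intro mult_left_mono) auto
    then have "q ^ (k * (30 * s)) \<le> q ^ (k * (\<sigma> - 1) + 15 * s)"
      using q2 by (intro power_increasing trans_le_add1) auto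
    also have "\<dots> < D" by (rule \<sigma>2)
    finally have "(q ^ (k * (30 * s))) ^ 2 < D ^ 2" by (intro power_strict_mono) auto
    also note D2
    finally have "k * (30 * s) * 2 < 51 * t * Suc n * k"
      using q2 by (simp add: power_strict_increasing_iff flip: power_mult)
    \<comment> \<open>Rounding \<open>n\<close> up costs \<open>51 * t\<close>, which is at most
      \<open>9 * s\<close> because \<open>n \<ge> 6\<close>.\<close>
    moreover have "51 * t * Suc n \<le> 60 * s"
    proof -
      have "51 * t * Suc n = 51 * t + 51 * s" by (simp add: s_def)
      then show ?thesis using s_n(3) by linarith
    qed
    then have "51 * t * Suc n * k \<le> 60 * s * k" by (rule mult_right_mono) simp
    ultimately show False by (simp add: mult.commute mult.left_commute)
  qed
  have "S0 b q l N D \<xi> \<le> real (q * D) * N * (\<epsilon> + 1 / real q ^ s + real (q + 6 * k * (q + 1)) / 2 ^ s)"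
    unfolding s_def
  proof (rule S0_le[where k = k and ?t1.0 = k and J = k and \<sigma> = \<sigma>])
    \<comment> \<open>\<open>t1 = J = k\<close> meets both size conditions, which is the origin of
      \<open>t = 2 * k + 2\<close>.\<close>
    have "k < q ^ k" using power_gt_expt q2 by simp
    then show "k < q ^ k" "k \<le> q ^ k" by auto
    show "1 \<le> k" using k by simp
    show "t = k + (k + 2)" by (simp add: t_def)
    show "2 \<le> t * n" using s_n by (simp add: s_def)
    show "2 ^ (k + 3) / real q ^ (t * n) \<le> 1"
    proof -
      have "(2::real) ^ (k + 3) \<le> 2 ^ s" using s_n by (intro power_increasing) auto
      also have "\<dots> \<le> real q ^ s" using q2 by (intro power_mono) auto
      finally show ?thesis using q2 by (simp add: s_def)
    qed
    show "D * q ^ (5 * (t * n)) \<le> q ^ (k * \<sigma> + 20 * (t * n))"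
    proof -
      have "D * q ^ (5 * s) \<le> q ^ (k * \<sigma> + 15 * s) * q ^ (5 * s)" using \<sigma>1 by (intro mult_right_mono) auto
      also have "\<dots> = q ^ (k * \<sigma> + 20 * s)" by (simp add: ac_simps flip: power_add)
      finally show ?thesis by (simp add: s_def)
    qed
    show "q ^ ((k - 1) * \<sigma> + 14 * (t * n)) < D"
    proof -
      obtain k' where k': "k = Suc k'" using k by (cases k) auto
      obtain \<sigma>' where \<sigma>': "\<sigma> = Suc \<sigma>'" using \<open>\<sigma> \<noteq> 0\<close> by (cases \<sigma>) auto
      have "(k - 1) * \<sigma> + 14 * s \<le> k * (\<sigma> - 1) + 15 * s"
        using s_n(4) by (simp add: k' \<sigma>')
      then have "q ^ ((k - 1) * \<sigma> + 14 * s) \<le> q ^ (k * (\<sigma> - 1) + 15 * s)"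
        using q2 by (intro power_increasing) auto
      then show ?thesis using \<sigma>2 by (simp add: s_def)
    qed
    show "\<sigma> \<le> 30 * (t * n)" using \<sigma>3 by (simp add: s_def)
    show "q ^ (51 * (t * n)) \<le> N" using ND(1) by (simp add: mult.assoc)
    show "0 \<le> \<epsilon>" by (simp add: \<epsilon>_def)
    show "(1 - 4 / real b^2 / real q ^ ((k + 1) * t)) ^ n + 2 ^ (k + 3) / real q ^ (t * n) \<le> (\<epsilon> / 2) ^ 2 ^ k"
    proof -
      have "1 - \<theta> \<le> exp (- \<theta>)" using exp_ge_add_one_self[of "- \<theta>"] by simp
      then have "(1 - \<theta>) ^ n \<le> exp (- \<theta>) ^ n" using \<theta> by (intro power_mono) auto
      also have "\<dots> = exp (- (\<theta> * n))" by (simp flip: exp_of_nat_mult add: mult.commute)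
      finally have 1: "(1 - \<theta>) ^ n \<le> exp (- (\<theta> * n))" .
      have "2 ^ (k + 3) * (1 / real q ^ s) \<le> 2 ^ (k + 3) * exp (- (\<theta> * n))"
      proof (rule mult_left_mono)
        show "1 / real q ^ s \<le> exp (- (\<theta> * n))" using qs_small exp_small exp_mono(1) by linarith
      qed simp
      with 1 have "(1 - \<theta>) ^ n + 2 ^ (k + 3) / real q ^ s \<le> (1 + 2 ^ (k + 3)) * exp (- (\<theta> * n))"
        by (simp add: distrib_right)
      \<comment> \<open>Enlarging the constant makes the right-hand side a \<open>2 ^ k\<close>-th
        power; taking the root turns the rate \<open>\<theta>\<close> into \<open>c\<close>.\<close>
      also have "\<dots> \<le> (1 + 2 ^ (k + 3)) ^ 2 ^ k * exp (- (\<theta> * n))"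
        by (intro mult_right_mono self_le_power) auto
      also have "exp (- (\<theta> * n)) = exp (- (c * n)) ^ 2 ^ k"
        by (simp add: c_def flip: exp_of_nat_mult)
      also have "(1 + 2 ^ (k + 3)) ^ 2 ^ k * exp (- (c * n)) ^ 2 ^ k = (\<epsilon> / 2) ^ 2 ^ k"
      proof -
        have "\<epsilon> / 2 = (1 + 2 ^ (k + 3)) * exp (- (c * n))" by (simp only: \<epsilon>_def)
        then show ?thesis by (simp only: power_mult_distrib)
      qed
      finally show ?thesis by (simp add: \<theta>_def s_def)
    qed
  qed
  also have "\<dots> \<le> real (q * D) * N * ((2 * (1 + 2 ^ (k + 3)) + 1 + real (q + 6 * k * (q + 1))) * exp (- (c * n)))"
  proof (rule mult_left_mono)
    have 1: "1 / 2 ^ s \<le> exp (- (c * n))" using exp_small exp_mono by linarith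
    have "1 / real q ^ s \<le> exp (- (c * n))" using 1 qs_small by linarith
    moreover have "real (q + 6 * k * (q + 1)) * (1 / 2 ^ s) \<le> real (q + 6 * k * (q + 1)) * exp (- (c * n))"
      using 1 by (intro mult_left_mono) auto
    ultimately show "\<epsilon> + 1 / real q ^ s + real (q + 6 * k * (q + 1)) / 2 ^ s \<le>
        (2 * (1 + 2 ^ (k + 3)) + 1 + real (q + 6 * k * (q + 1))) * exp (- (c * n))"
      unfolding \<epsilon>_def by (simp add: distrib_right)
  qed simp
  finally show ?thesis by (simp only: c_def)
qed

end

text \<open>\<open>m = min N D\<close> is at least \<open>N powr min 1 \<rho>1\<close>, and
  \<open>n\<close> is about \<open>ln m / (51 * t * ln q)\<close>, so \<open>exp (- (c * n))\<close>
  saves a power of \<open>N\<close>. The factor \<open>exp c\<close> pays for rounding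
  \<open>n\<close>; the summand \<open>q * exp (c * n0)\<close> of \<open>A\<close> covers
  \<open>n < n0\<close> by the trivial bound.\<close>

lemma admissible_exponent_of_steps:
  fixes b q k :: nat and \<rho>1 \<rho>2 :: real
  assumes \<rho>: "0 < \<rho>1" "\<rho>1 \<le> \<rho>2" and b: "2 \<le> b" and q: "2 \<le> q" and gcd: "gcd b (q - 1) = 1"
    and k: "2 \<le> k" "2 * max 1 \<rho>2 \<le> k"
  defines "t \<equiv> 2 * k + 2"
  defines "\<theta> \<equiv> 4 / real b^2 / real q ^ ((k + 1) * t)"
  shows "admissible_exponent b q \<rho>1 \<rho>2 (min 1 \<rho>1 * (\<theta> / 2 ^ k) / (51 * real t * ln q))"
proof -
  define c where "c = \<theta> / 2 ^ k"
  define Y where "Y = 51 * real t * ln q"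
  define \<eta> where "\<eta> = min 1 \<rho>1 * c / Y"
  define n0 where "n0 = k + 6"
  define A where "A = q * (2 * (1 + 2 ^ (k + 3)) + 1 + real (q + 6 * k * (q + 1))) + q * exp (c * n0)"
  have lnq: "0 < ln (real q)" using q by simp
  have \<theta>: "0 < \<theta>" using b q by (simp add: \<theta>_def)
  then have c: "0 < c" by (simp add: c_def)
  have t: "0 < real t" by (simp add: t_def)
  have Y: "0 < Y" using lnq t by (simp add: Y_def)
  have \<eta>: "0 < \<eta>" unfolding \<eta>_def using \<rho> c Y by simp
  have A0: "0 < A" unfolding A_def using q by (intro add_nonneg_pos) auto
  have "\<bar>S0 b q l N D \<xi> / real D\<bar> \<le> (A * exp c) * real N powr (1 - \<eta>)"
    if N: "N > 1" and D: "D > 1" and ND: "real N powr \<rho>1 \<le> real D" "real D \<le> real N powr \<rho>2"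
      and l: "l \<in> {1..b - 1}"
    for N D l :: nat and \<xi> :: real
  proof -
    interpret digit_phase q b l
      using assms l by unfold_locales auto
    define m where "m = min N D"
    have m1: "1 \<le> m" "1 < real m" using N D by (auto simp: m_def)
    have "2 ^ 1 \<le> q ^ (51 * t)" using q by (intro order_trans[OF power_increasing[of 1 "51 * t" 2] power_mono]) (auto simp: t_def)
    then obtain n where n: "(q ^ (51 * t)) ^ n \<le> m" "m < (q ^ (51 * t)) ^ Suc n"
      using exists_power_bracket[OF _ m1(1), of "q ^ (51 * t)"] by auto
    then have n': "q ^ (51 * t * n) \<le> m" "m < q ^ (51 * t * Suc n)"
      by (simp_all only: power_mult)
    have S: "S0 b q l N D \<xi> \<le> real D * N * (A * exp (- (c * n)))"
    proof (cases "n0 \<le> n")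
      case True
      \<comment> \<open>For \<open>D < N\<close> the minimum is \<open>D\<close> itself and exponent
        \<open>1\<close> suffices; hence \<open>max 1 \<rho>2\<close>.\<close>
      have Dm: "real D \<le> real (min N D) powr max 1 \<rho>2"
      proof (cases "N \<le> D")
        case True
        have "real N powr \<rho>2 \<le> real N powr max 1 \<rho>2" using N by (intro powr_mono) auto
        then show ?thesis using ND(2) True by (simp add: min_def)
      next
        case False
        have "real D powr 1 \<le> real D powr max 1 \<rho>2" using D by (intro powr_mono) auto
        then show ?thesis using False D by (simp add: min_def)
      qed
      have "S0 b q l N D \<xi> \<le> real (q * D) * N *
          ((2 * (1 + 2 ^ (k + 3)) + 1 + real (q + 6 * k * (q + 1))) * exp (- (c * n)))"
        unfolding c_def \<theta>_def t_def
        using True by (intro S0_exponential_bound[OF k _ _ n'[unfolded t_def m_def] Dm]) (auto simp: n0_def)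
      also have "\<dots> = real D * N * ((q * (2 * (1 + 2 ^ (k + 3)) + 1 + real (q + 6 * k * (q + 1)))) * exp (- (c * n)))"
        by (simp only: of_nat_mult mult_ac)
      also have "\<dots> \<le> real D * N * (A * exp (- (c * n)))"
        unfolding A_def by (intro mult_left_mono mult_right_mono) auto
      finally show ?thesis .
    next
      case False
      have "exp (c * n) \<le> exp (c * n0)" using False c by simp
      then have "1 \<le> exp (c * n0) * exp (- (c * n))" by (simp flip: exp_add)
      then have "real q * 1 \<le> q * (exp (c * n0) * exp (- (c * n)))" by (intro mult_left_mono) auto
      also have "\<dots> = (q * exp (c * n0)) * exp (- (c * n))" by simp
      also have "\<dots> \<le> A * exp (- (c * n))" unfolding A_def by (intro mult_right_mono) auto
      finally have "real D * N * q \<le> real D * N * (A * exp (- (c * n)))"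
        by (intro mult_left_mono) auto
      moreover have "S0 b q l N D \<xi> \<le> real D * N * q"
        using S0_le_trivial[of q b l N D \<xi>] q by (simp add: mult_ac)
      ultimately show ?thesis by linarith
    qed
    have "exp (- (c * n)) \<le> exp c * real N powr (- \<eta>)"
    proof -
      have "real N powr min 1 \<rho>1 \<le> real m"
      proof (cases "N \<le> D")
        case True
        have "real N powr min 1 \<rho>1 \<le> real N powr 1" using N by (intro powr_mono) auto
        then show ?thesis using True N by (simp add: m_def min_def)
      next
        case False
        have "real N powr min 1 \<rho>1 \<le> real N powr \<rho>1" using N by (intro powr_mono) auto
        then show ?thesis using ND(1) False by (simp add: m_def min_def)
      qed
      then have "ln (real N powr min 1 \<rho>1) \<le> ln (real m)" using N by (subst ln_le_cancel_iff) (use m1 in auto)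
      also have "\<dots> \<le> ln (real (q ^ (51 * t * Suc n)))"
        using n'(2) m1 by (subst ln_le_cancel_iff) (auto simp del: power_Suc of_nat_power)
      also have "\<dots> = 51 * t * (real n + 1) * ln q" using q by (simp add: ln_realpow algebra_simps)
      finally have "min 1 \<rho>1 * ln N \<le> Y * (real n + 1)" using N by (simp add: ln_powr Y_def mult_ac)
      then have "c * (min 1 \<rho>1 * ln N) / Y \<le> c * (Y * (real n + 1)) / Y"
        using c Y by (intro divide_right_mono mult_left_mono) auto
      also have "\<dots> = c * (real n + 1)" using Y by simp
      finally have "\<eta> * ln N \<le> c * (real n + 1)"
        by (simp add: \<eta>_def Y_def mult_ac)
      then have "exp (- (c * n)) \<le> exp (c + - \<eta> * ln N)" by (simp add: algebra_simps)
      also have "\<dots> = exp c * real N powr (- \<eta>)" using N by (simp add: powr_def exp_diff exp_minus field_simps)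
      finally show ?thesis .
    qed
    then have "real D * N * (A * exp (- (c * n))) \<le> real D * N * (A * (exp c * real N powr (- \<eta>)))"
      using A0 by (intro mult_left_mono) auto
    also have "\<dots> = real D * ((A * exp c) * (real N * real N powr (- \<eta>)))" by (simp only: mult_ac)
    also have "real N * real N powr (- \<eta>) = real N powr (1 - \<eta>)"
      using N powr_add[of "real N" 1 "- \<eta>"] by simp
    finally have "S0 b q l N D \<xi> \<le> real D * ((A * exp c) * real N powr (1 - \<eta>))" using S by linarith
    then have "S0 b q l N D \<xi> / real D \<le> (A * exp c) * real N powr (1 - \<eta>)"
      using D by (simp add: divide_le_eq mult.commute)
    moreover have "0 \<le> S0 b q l N D \<xi> / real D" using S0_nonneg by simp
    ultimately show ?thesis by simp
  qed
  moreover have "0 < A * exp c" using A0 by simp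
  ultimately have "admissible_exponent b q \<rho>1 \<rho>2 \<eta>"
    using \<eta> unfolding admissible_exponent_def by blast
  then show ?thesis by (simp add: \<eta>_def c_def Y_def)
qed

section \<open>Comparison with the explicit exponent\<close>

lemma log_smallest_prime_divisor_pos:
  assumes "2 \<le> q"
  shows "0 < log (real q) (real (smallest_prime_divisor q))"
proof -
  have "{p. prime p \<and> p dvd q} \<subseteq> {..q}" using assms by (auto dest: dvd_imp_le)
  then have "finite {p. prime p \<and> p dvd q}" by (rule finite_subset) simp
  moreover have "{p. prime p \<and> p dvd q} \<noteq> {}" using assms prime_factor_nat[of q] by auto
  ultimately have "smallest_prime_divisor q \<in> {p. prime p \<and> p dvd q}"
    unfolding smallest_prime_divisor_def by (rule Min_in)
  then have "1 < smallest_prime_divisor q" by (auto dest: prime_gt_1_nat)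
  then show ?thesis using assms by (intro zero_less_log_cancel_iff[THEN iffD2]) auto
qed

text \<open>With \<open>\<kappa> = 3 * \<rho>2 + 5 \<ge> k + 3\<close>, the exponential
  \<open>E\<close> absorbs \<open>real b^2\<close>, \<open>q ^ ((k + 1) * t)\<close> and
  \<open>2 ^ k\<close>, whose product is at most \<open>q powr (\<kappa> ^ 2 * b)\<close>; the
  denominator \<open>Den\<close> absorbs \<open>51 * t * ln q\<close>.\<close>

lemma explicit_eta_bounds:
  fixes b q k :: nat and \<rho>1 \<rho>2 :: real
  assumes \<rho>: "0 < \<rho>1" "\<rho>1 \<le> \<rho>2" and b: "2 \<le> b" and q: "2 \<le> q" and k: "2 \<le> k" "real k \<le> 2 * \<rho>2 + 2"
  defines "t \<equiv> 2 * k + 2"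
  defines "\<theta> \<equiv> 4 / real b^2 / real q ^ ((k + 1) * t)"
  shows "0 < explicit_eta b q \<rho>1 \<rho>2"
    and "explicit_eta b q \<rho>1 \<rho>2 \<le> min 1 \<rho>1 * (\<theta> / 2 ^ k) / (51 * real t * ln q)"
proof -
  define \<kappa> where "\<kappa> = 3 * \<rho>2 + 5"
  define lc where "lc = ln ((3 * \<rho>2 + 4) * real q)"
  define lq where "lq = ln (real q)"
  define mn where "mn = min (1 / 4) (3 * log (real q) (real (smallest_prime_divisor q)))"
  define Lg where "Lg = lc + real b * lq * \<kappa>"
  define E where "E = exp (- \<kappa> * (lc + \<kappa> * real b * lq))"
  define Den where "Den = 8 powr (1 + \<rho>2) * (288 * \<rho>2 + 300) * (3 * \<rho>2 + 2) * Lg"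
  have ex: "explicit_eta b q \<rho>1 \<rho>2 = \<rho>1 * mn / Den * E"
    by (simp add: explicit_eta_def mn_def Den_def Lg_def E_def lc_def lq_def \<kappa>_def)
  have lq: "0 < lq" using q by (simp add: lq_def)
  have "1 * 1 < (3 * \<rho>2 + 4) * real q" using \<rho> q by (intro mult_strict_mono) auto
  then have lc: "0 < lc" unfolding lc_def by (intro ln_gt_zero) simp
  have \<kappa>: "5 < \<kappa>" "real k \<le> \<kappa> - 3" using \<rho> k by (auto simp: \<kappa>_def)
  have mn: "0 < mn" "mn \<le> 1 / 4" using log_smallest_prime_divisor_pos[OF q] by (auto simp: mn_def)
  have E: "0 < E" by (simp add: E_def)
  have tLg: "t * lq \<le> 4 * Lg"
  proof -
    have "t * lq \<le> (2 * \<kappa>) * lq" using \<kappa> lq by (intro mult_right_mono) (auto simp: t_def)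
    also have "\<dots> \<le> (b * \<kappa>) * lq" using b \<kappa> lq by (intro mult_right_mono) auto
    also have "\<dots> \<le> Lg" using lc by (simp add: Lg_def mult_ac)
    finally have "t * lq \<le> Lg" .
    moreover have "0 \<le> Lg" using lc lq \<kappa> by (simp add: Lg_def)
    ultimately show ?thesis by linarith
  qed
  have tpos: "0 < t * lq" using lq by (simp add: t_def)
  then have Lg: "0 < Lg" using tLg by linarith
  have e8: "8 \<le> 8 powr (1 + \<rho>2)" using powr_mono[of 1 "1 + \<rho>2" 8] \<rho> by simp
  have Den: "0 < Den" unfolding Den_def using e8 \<rho> Lg by (intro mult_pos_pos) auto
  show "0 < explicit_eta b q \<rho>1 \<rho>2" unfolding ex using \<rho> mn Den E by simp
  have "E \<le> \<theta> / 2 ^ k"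
  proof -
    have qp: "real q ^ j = exp (j * lq)" for j :: nat
      using q by (simp add: lq_def exp_of_nat_mult)
    have "b \<le> 2 ^ b" using power_gt_expt[of 2 b] by simp
    then have "real b \<le> 2 ^ b" by (metis of_nat_le_iff of_nat_numeral of_nat_power)
    also have "\<dots> \<le> real q ^ b" using q by (intro power_mono) auto
    finally have "real b^2 \<le> (real q ^ b)^2" by (intro power_mono) auto
    also have "\<dots> = exp (2 * b * lq)" using qp[of "b * 2"] by (simp add: power_mult mult_ac)
    finally have b2: "real b^2 \<le> exp (2 * b * lq)" .
    have k2: "2 ^ k \<le> exp (k * lq)" using q power_mono[of 2 "real q" k] unfolding qp by simp
    have "real b^2 * (real q ^ ((k + 1) * t) * 2 ^ k) \<le> exp (2 * b * lq) * (exp (real ((k + 1) * t) * lq) * exp (k * lq))"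
      unfolding qp by (intro mult_mono b2 k2) auto
    also have "\<dots> = exp ((2 * b + real ((k + 1) * t) + k) * lq)"
      by (simp only: exp_add[symmetric]) (simp add: algebra_simps)
    also have "\<dots> \<le> exp (\<kappa>\<^sup>2 * b * lq)"
    proof -
      have "real ((k + 1) * t) \<le> (\<kappa> - 2) * (2 * \<kappa> - 4)"
        unfolding of_nat_mult using \<kappa> by (intro mult_mono) (auto simp: t_def)
      \<comment> \<open>In \<open>\<kappa> ^ 2 * b = 2 * b + b * (\<kappa> ^ 2 - 2)\<close> the
        first term pays for \<open>real b^2\<close> and the second, by \<open>b \<ge> 2\<close>, for
        \<open>(k + 1) * t + k\<close>.\<close>
      moreover have "2 * (\<kappa>\<^sup>2 - 2) \<le> b * (\<kappa>\<^sup>2 - 2)"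
      proof -
        have "5 * 5 \<le> \<kappa> * \<kappa>" using \<kappa> by (intro mult_mono) auto
        then show ?thesis using b by (intro mult_right_mono) (auto simp: power2_eq_square)
      qed
      ultimately have "2 * b + real ((k + 1) * t) + k \<le> \<kappa>\<^sup>2 * b"
        using \<kappa> by (simp add: power2_eq_square algebra_simps)
      then show ?thesis using lq by simp
    qed
    finally have *: "real b^2 * (real q ^ ((k + 1) * t) * 2 ^ k) \<le> exp (\<kappa>\<^sup>2 * b * lq)" .
    have "E \<le> exp (- (\<kappa>\<^sup>2 * b * lq))"
      using \<kappa> lc by (simp add: E_def power2_eq_square algebra_simps)
    also have "\<dots> = 1 / exp (\<kappa>\<^sup>2 * b * lq)" by (simp add: exp_minus field_simps)
    also have "\<dots> \<le> 4 / (real b^2 * (real q ^ ((k + 1) * t) * 2 ^ k))"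
      using * b q by (intro frac_le) auto
    also have "\<dots> = \<theta> / 2 ^ k" by (simp add: \<theta>_def)
    finally show ?thesis .
  qed
  have "\<rho>1 * mn * (51 * (t * lq)) \<le> min 1 \<rho>1 * Den"
  proof -
    \<comment> \<open>For \<open>\<rho>1 \<le> 1\<close> the summand \<open>300\<close> suffices;
      otherwise \<open>\<rho>1 \<le> \<rho>2\<close> is used.\<close>
    have "\<rho>1 * 288 \<le> min 1 \<rho>1 * (288 * \<rho>2 + 300)"
    proof (cases "\<rho>1 \<le> 1")
      case True
      then show ?thesis using \<rho> by (simp add: min_def)
    qed (use \<rho> in \<open>simp add: min_def\<close>)
    moreover have "8 * 2 * Lg \<le> 8 powr (1 + \<rho>2) * (3 * \<rho>2 + 2) * Lg"
      using \<rho> e8 Lg by (intro mult_right_mono mult_mono) auto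
    ultimately have "(\<rho>1 * 288) * (8 * 2 * Lg) \<le>
        (min 1 \<rho>1 * (288 * \<rho>2 + 300)) * (8 powr (1 + \<rho>2) * (3 * \<rho>2 + 2) * Lg)"
      by (rule mult_mono) (use \<rho> Lg in auto)
    also have "\<dots> = min 1 \<rho>1 * Den" by (simp add: Den_def mult_ac)
    finally have 1: "\<rho>1 * 4608 * Lg \<le> min 1 \<rho>1 * Den" by simp
    have "\<rho>1 * mn * (51 * (t * lq)) \<le> \<rho>1 * (1 / 4) * (51 * (4 * Lg))"
    proof (rule mult_mono)
      show "\<rho>1 * mn \<le> \<rho>1 * (1 / 4)" using \<rho> mn by (intro mult_left_mono) auto
      show "51 * (t * lq) \<le> 51 * (4 * Lg)" by (rule mult_left_mono[OF tLg]) simp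
    qed (use \<rho> tpos in auto)
    also have "\<dots> = (\<rho>1 * Lg) * 51" by simp
    also have "\<dots> \<le> (\<rho>1 * Lg) * 4608" using \<rho> Lg by (intro mult_left_mono) auto
    finally show ?thesis using 1 by (simp add: mult_ac)
  qed
  moreover have "x / Den \<le> y / z" if "x * z \<le> y * Den" "0 < z" for x y z :: real
    using that Den by (simp add: pos_divide_le_eq pos_le_divide_eq)
  ultimately have "\<rho>1 * mn / Den \<le> min 1 \<rho>1 / (51 * (t * lq))"
    using tpos by simp
  then have "\<rho>1 * mn / Den * E \<le> min 1 \<rho>1 / (51 * (t * lq)) * (\<theta> / 2 ^ k)"
    using \<open>E \<le> \<theta> / 2 ^ k\<close> \<rho> E tpos by (intro mult_mono) auto
  then show "explicit_eta b q \<rho>1 \<rho>2 \<le> min 1 \<rho>1 * (\<theta> / 2 ^ k) / (51 * real t * ln q)"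
    unfolding ex lq_def by (simp add: mult_ac)
qed

theorem theorem6:
  fixes b q :: nat and \<rho>1 \<rho>2 :: real
  assumes "0 < \<rho>1" and "\<rho>1 \<le> \<rho>2"
    and "b \<ge> 2" and "q \<ge> 2" and "gcd b (q - 1) = 1"
  shows "(\<exists>\<eta>. admissible_exponent b q \<rho>1 \<rho>2 \<eta>) \<and>
         admissible_exponent b q \<rho>1 \<rho>2 (explicit_eta b q \<rho>1 \<rho>2)"
proof -
  \<comment> \<open>The least integer allowed by \<open>2 * max 1 \<rho>2 \<le> k\<close>; rounding
    keeps it at most \<open>2 * \<rho>2 + 2\<close>, also for small \<open>\<rho>2\<close>.\<close>
  define k where "k = nat \<lceil>2 * max 1 \<rho>2\<rceil>"
  have rk: "real k = of_int \<lceil>2 * max 1 \<rho>2\<rceil>" by (simp add: k_def)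
  have k2: "2 * max 1 \<rho>2 \<le> k" unfolding rk by (rule le_of_int_ceiling)
  then have "2 \<le> real k" by linarith
  then have k1: "2 \<le> k" by simp
  have k3: "real k \<le> 2 * \<rho>2 + 2"
  proof (cases "\<rho>2 \<le> 1")
    case True
    then have "real k = 2" unfolding rk by (simp add: max_def)
    then show ?thesis using assms by simp
  next
    case False
    then have "max 1 \<rho>2 = \<rho>2" by simp
    then show ?thesis using of_int_ceiling_le_add_one[of "2 * \<rho>2"] unfolding rk by linarith
  qed
  note eta = explicit_eta_bounds[OF assms(1-4) k1 k3]
  show ?thesis
    using admissible_exponent_mono[OF admissible_exponent_of_steps[OF assms k1 k2] eta] by blast
qed

end
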